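(* Fix a constant $\gamma_0\in(0,1]$. There is a constant $K>0$ depending only on $\gamma_0$ such that the following holds. Let $n,m\ge 1$, let $p_{ij}\in[0,1]$ for $i\in[n]$, $j\in[m]$, and let $A$ be the biadjacency matrix of an inhomogeneous Erdős–Rényi bipartite graph $\mathcal G(n,m,p_{ij})$. With $d,\rho_{\max},\tilde\rho_{\max},\gamma,N,\eta$ as defined in the context, assume that $\gamma\ge\gamma_0$, $d\ge \gamma^{-1/2}$ and $d^{7/2}\max_{ij}p_{ij}\le N^{-1/10}$. Then $$\frac{1}{\sqrt d}\,\mathbb E[\sigma_{\max}(A-\mathbb E A)]\le 1+\sqrt\gamma+K\,\frac{\eta}{\sqrt{1\vee \log\eta}}.$$ Moreover, with probability at least $1-KN^{-3}$, $$\frac{1}{\sqrt d}\,\sigma_{\max}(A-\mathbb E A)\le 1+\sqrt\gamma+K\,\frac{\eta}{\sqrt{1\vee\log\eta}}.$$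
   Context: An inhomogeneous Erdős–Rényi bipartite graph $G\sim\mathcal G(n,m,p_{ij})$ is a random bipartite graph on a vertex set $V_1\cup V_2$ with $|V_1|=n$, $|V_2|=m$, in which each edge $ij$ ($i\in[n]$, $j\in[m]$) is included independently with probability $p_{ij}$. Its biadjacency matrix is $A\in\{0,1\}^{n\times m}$ with $A_{ij}=1$ if $ij$ is an edge and $A_{ij}=0$ otherwise. Notation: $d:=\max\big\{\max_{i\in[n]}\sum_{k=1}^m p_{ik},\ \max_{j\in[m]}\sum_{k=1}^n p_{kj}\big\}$ is the maximal expected degree; $\rho_{\max}:=\frac1d\max_{i\in[n]}\sum_{j\in[m]}p_{ij}$; $\tilde\rho_{\max}:=\frac1d\max_{j\in[m]}\sum_{i\in[n]}p_{ij}$; $\gamma:=\rho_{\max}\wedge\tilde\rho_{\max}\in(0,1]$; $N:=n\vee m$; $\eta:=\sqrt{\log N/d}$. Here $x\vee y$ and $x\wedge y$ denote the maximum and minimum, and $1\vee\log\eta$ is understood as $1$ when $\eta=0$. $\sigma_{\max}$ denotes the largest singular value. *)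

theory Defs
  imports "HOL-Probability.Product_PMF" "Jordan_Normal_Form.Char_Poly"
begin

text \<open>
  Vertices are numbered from 0: \<open>V\<^sub>1 = {..<n}\<close> and \<open>V\<^sub>2 = {..<m}\<close>. A bipartite graph is given by its
  edge set, where \<open>(i, j)\<close> is the edge between \<open>i \<in> V\<^sub>1\<close> and \<open>j \<in> V\<^sub>2\<close>. The random graph is given by
  its law on edge sets: independent edge indicators, that of \<open>(i, j)\<close> being Bernoulli(\<open>p i j\<close>).
\<close>

definition bipartite_ER :: "nat \<Rightarrow> nat \<Rightarrow> (nat \<Rightarrow> nat \<Rightarrow> real) \<Rightarrow> (nat \<times> nat) set pmf" where
  "bipartite_ER n m p =
     map_pmf (\<lambda>f. {e. f e})
       (Pi_pmf ({..<n} \<times> {..<m}) False (\<lambda>(i, j). bernoulli_pmf (p i j)))"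

definition biadjacency :: "nat \<Rightarrow> nat \<Rightarrow> (nat \<times> nat) set \<Rightarrow> real mat" where
  "biadjacency n m E = Matrix.mat n m (\<lambda>(i, j). if (i, j) \<in> E then 1 else 0)"

definition expectation_mat :: "nat \<Rightarrow> nat \<Rightarrow> 'a pmf \<Rightarrow> ('a \<Rightarrow> real mat) \<Rightarrow> real mat" where
  "expectation_mat n m P X =
     Matrix.mat n m (\<lambda>(i, j). measure_pmf.expectation P (\<lambda>\<omega>. X \<omega> $$ (i, j)))"

definition centered_biadjacency ::
    "nat \<Rightarrow> nat \<Rightarrow> (nat \<Rightarrow> nat \<Rightarrow> real) \<Rightarrow> (nat \<times> nat) set \<Rightarrow> real mat" where
  "centered_biadjacency n m p E =
     biadjacency n m E - expectation_mat n m (bipartite_ER n m p) (biadjacency n m)"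

text \<open>
  The eigenvalues of \<open>M\<^sup>T M\<close> may include zeros beyond the \<open>min n m\<close> singular values of an \<open>n \<times> m\<close>
  matrix; this does not affect the maximum.
\<close>

definition singular_values :: "real mat \<Rightarrow> real set" where
  "singular_values M = {sqrt l | l. eigenvalue (transpose_mat M * M) l}"

definition sigma_max :: "real mat \<Rightarrow> real" where
  "sigma_max M = Max (singular_values M)"

definition max_row_sum :: "nat \<Rightarrow> nat \<Rightarrow> (nat \<Rightarrow> nat \<Rightarrow> real) \<Rightarrow> real" where
  "max_row_sum n m p = (MAX i\<in>{..<n}. \<Sum>k<m. p i k)"

definition max_col_sum :: "nat \<Rightarrow> nat \<Rightarrow> (nat \<Rightarrow> nat \<Rightarrow> real) \<Rightarrow> real" where
  "max_col_sum n m p = (MAX j\<in>{..<m}. \<Sum>k<n. p k j)"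

definition max_expected_degree :: "nat \<Rightarrow> nat \<Rightarrow> (nat \<Rightarrow> nat \<Rightarrow> real) \<Rightarrow> real" where
  "max_expected_degree n m p = max (max_row_sum n m p) (max_col_sum n m p)"

definition rho_max :: "nat \<Rightarrow> nat \<Rightarrow> (nat \<Rightarrow> nat \<Rightarrow> real) \<Rightarrow> real" where
  "rho_max n m p = max_row_sum n m p / max_expected_degree n m p"

definition rho_tilde_max :: "nat \<Rightarrow> nat \<Rightarrow> (nat \<Rightarrow> nat \<Rightarrow> real) \<Rightarrow> real" where
  "rho_tilde_max n m p = max_col_sum n m p / max_expected_degree n m p"

definition gamma_ratio :: "nat \<Rightarrow> nat \<Rightarrow> (nat \<Rightarrow> nat \<Rightarrow> real) \<Rightarrow> real" where
  "gamma_ratio n m p = min (rho_max n m p) (rho_tilde_max n m p)"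

definition eta :: "nat \<Rightarrow> nat \<Rightarrow> (nat \<Rightarrow> nat \<Rightarrow> real) \<Rightarrow> real" where
  "eta n m p = sqrt (ln (real (max n m)) / max_expected_degree n m p)"

text \<open>
  Since \<open>ln 0 = 0\<close> in the library, \<open>max 1 (ln \<eta>)\<close> is 1 when \<open>\<eta> = 0\<close>, as intended.
\<close>

definition sigma_bound :: "real \<Rightarrow> nat \<Rightarrow> nat \<Rightarrow> (nat \<Rightarrow> nat \<Rightarrow> real) \<Rightarrow> real" where
  "sigma_bound K n m p =
     1 + sqrt (gamma_ratio n m p) + K * (eta n m p / sqrt (max 1 (ln (eta n m p))))"

end

theory Submission
  imports Defs "Jordan_Normal_Form.Spectral_Radius" "HOL-Real_Asymp.Real_Asymp"
begin

text \<open>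
  Let \<open>X = A - E A\<close>, let \<open>H\<close> be the symmetric matrix with off-diagonal blocks \<open>X\<close> and \<open>X\<^sup>T\<close>, and let
  \<open>B\<close> be its non-backtracking matrix. By the Ihara--Bass correspondence, a bound \<open>r\<close> on the spectral
  radius of \<open>B\<close> makes a quadratic form built from \<open>H\<close> and \<open>r\<close> positive semidefinite. If the rows and
  columns of \<open>X\<close> have squared lengths at most \<open>a'\<close> and \<open>b'\<close>, taking \<open>r\<^sup>4\<close> close to \<open>a' b'\<close> turns this into
  \<open>\<sigma>\<^sub>m\<^sub>a\<^sub>x X \<le> \<surd>a' + \<surd>b' + 2\<close>. The row and column lengths are controlled by Chernoff bounds for the degrees.
  The powers of \<open>B\<close> are controlled by the expected squared Frobenius norm, a sum over pairs of
  non-backtracking walks in which every edge is traversed at least twice. Such a pair is explored step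
  by step, and a potential on the explored graph is chosen so that its weighted sum over the next step
  grows by a factor of about \<open>(a b)\<^sup>1\<^sup>/\<^sup>4\<close>; cycles are rare enough to be paid for by the sparsity of the
  graph. The expectation bound follows from the high-probability bound and \<open>\<sigma>\<^sub>m\<^sub>a\<^sub>x X \<le> N\<close>.
\<close>

text \<open>Moments of the symmetric matrix itself are inflated by vertices of atypically high
  degree, which a walk exploits by going back and forth along their edges. Without backtracking the
  count is governed by the expected degrees; the actual degrees enter only through the diagonal of
  the quadratic form, where a bound for each row and column is enough. Up to terms of order 1 the
  form bounds the squared norm by \<open>r^2 * (1 + a' / r^2) * (1 + b' / r^2) = r^2 + a' + b' + a'
  * b' / r^2\<close>. This is minimal at \<open>r^2 = sqrt (a' * b')\<close>, with value
  \<open>(sqrt a' + sqrt b')^2\<close>; hence the fourth root. For small \<eta> the leading constant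
  has to be exact, so a step of the walk may lose only a factor \<open>1 + 1 / l\<close>, over
  lengths \<open>l\<close> of order \<open>sqrt (d * ln N)\<close>. Counting cycles globally would
  be too crude; the potential charges each choice at the step where it is made. For \<eta> at least
  1 the error term dominates \<open>sqrt d\<close>, and a constant loss per step is
  harmless.\<close>

section \<open>Non-backtracking walks\<close>

text \<open>
  \<open>m u v\<close> counts the traversals of the edge \<open>{u, v}\<close> so far, in both directions; an edge is open
  while this count is 1. In the functions on walks below, \<open>x0\<close> is the vertex visited just before
  \<open>x\<close>, and stepping back to it has weight 0.
\<close>

definition degree_in :: "'v set \<Rightarrow> ('v \<Rightarrow> 'v \<Rightarrow> nat) \<Rightarrow> 'v \<Rightarrow> nat" where
  "degree_in V m x = card {w \<in> V. m x w \<noteq> 0}"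

definition open_degree :: "'v set \<Rightarrow> ('v \<Rightarrow> 'v \<Rightarrow> nat) \<Rightarrow> 'v \<Rightarrow> nat" where
  "open_degree V m x = card {w \<in> V. m x w = 1}"

definition traverse :: "('v \<Rightarrow> 'v \<Rightarrow> nat) \<Rightarrow> 'v \<Rightarrow> 'v \<Rightarrow> 'v \<Rightarrow> 'v \<Rightarrow> nat" where
  "traverse m x w = (\<lambda>u v. if (u = x \<and> v = w) \<or> (u = w \<and> v = x) then Suc (m u v) else m u v)"

definition no_open_edge :: "'v set \<Rightarrow> ('v \<Rightarrow> 'v \<Rightarrow> nat) \<Rightarrow> bool" where
  "no_open_edge V m \<longleftrightarrow> (\<forall>u\<in>V. \<forall>v\<in>V. m u v \<noteq> 1)"

text \<open>An edge is charged at its first traversal only: every centred Bernoulli moment of order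
  at least 2 is bounded by the same \<open>p\<close>, however large the order.\<close>

fun walk_weight :: "('v \<Rightarrow> 'v \<Rightarrow> real) \<Rightarrow> ('v \<Rightarrow> 'v \<Rightarrow> nat) \<Rightarrow> 'v \<Rightarrow> 'v \<Rightarrow> 'v list \<Rightarrow> real" where
  "walk_weight P m x0 x [] = 1"
| "walk_weight P m x0 x (w # ws) =
     (if w = x0 \<or> w = x then 0
      else (if m x w = 0 then P x w else 1) * walk_weight P (traverse m x w) x w ws)"

fun traverse_walk :: "('v \<Rightarrow> 'v \<Rightarrow> nat) \<Rightarrow> 'v \<Rightarrow> 'v list \<Rightarrow> 'v \<Rightarrow> 'v \<Rightarrow> nat" where
  "traverse_walk m x [] = m"
| "traverse_walk m x (w # ws) = traverse_walk (traverse m x w) w ws"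

text \<open>The flag \<open>fr\<close> says that the last step discovered a new vertex.\<close>

fun at_frontier :: "'v set \<Rightarrow> ('v \<Rightarrow> 'v \<Rightarrow> nat) \<Rightarrow> bool \<Rightarrow> 'v \<Rightarrow> 'v list \<Rightarrow> bool" where
  "at_frontier V m fr x [] = fr"
| "at_frontier V m fr x (w # ws) = at_frontier V (traverse m x w) (degree_in V m w = 0) w ws"

definition walks :: "'v set \<Rightarrow> nat \<Rightarrow> 'v list set" where
  "walks V l = {xs. set xs \<subseteq> V \<and> length xs = l}"

lemma finite_walks [simp]: "finite V \<Longrightarrow> finite (walks V l)"
  unfolding walks_def by (rule finite_lists_length_eq)

lemma walks_0 [simp]: "walks V 0 = {[]}"
  by (auto simp: walks_def)

lemma sum_walks_Suc:
  assumes "finite V"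
  shows "(\<Sum>xs\<in>walks V (Suc l). f xs) = (\<Sum>w\<in>V. \<Sum>ws\<in>walks V l. f (w # ws))"
proof -
  have "walks V (Suc l) = (\<lambda>(w, ws). w # ws) ` (V \<times> walks V l)"
    by (auto simp: walks_def length_Suc_conv image_iff)
  moreover have "inj_on (\<lambda>(w, ws). w # ws) (V \<times> walks V l)"
    by (auto simp: inj_on_def)
  ultimately have "(\<Sum>xs\<in>walks V (Suc l). f xs) = (\<Sum>z\<in>V \<times> walks V l. f (case z of (w, ws) \<Rightarrow> w # ws))"
    by (simp add: sum.reindex)
  then show ?thesis by (simp add: sum.cartesian_product case_prod_unfold)
qed

section \<open>Change of the degrees under one traversal\<close>

lemma traverse_commute: "traverse m x w = traverse m w x"
  by (auto simp: traverse_def fun_eq_iff)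

lemma traverse_sym:
  assumes "m u v = m v u"
  shows "traverse m x w u v = traverse m x w v u"
proof -
  have c: "((v = x \<and> u = w) \<or> (v = w \<and> u = x)) = ((u = x \<and> v = w) \<or> (u = w \<and> v = x))"
    by blast
  show ?thesis unfolding traverse_def c assms ..
qed

lemma traverse_row: "x \<noteq> w \<Longrightarrow> traverse m x w x = (m x)(w := Suc (m x w))"
  by (auto simp: traverse_def fun_eq_iff)

lemma traverse_row_other: "u \<noteq> x \<Longrightarrow> u \<noteq> w \<Longrightarrow> traverse m x w u = m u"
  by (auto simp: traverse_def fun_eq_iff)

lemma degree_traverse_other [simp]:
  "u \<noteq> x \<Longrightarrow> u \<noteq> w \<Longrightarrow> degree_in V (traverse m x w) u = degree_in V m u"
  "u \<noteq> x \<Longrightarrow> u \<noteq> w \<Longrightarrow> open_degree V (traverse m x w) u = open_degree V m u"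
  by (auto simp: degree_in_def open_degree_def traverse_row_other)

lemma degree_traverse:
  assumes "finite V" "w \<in> V" "x \<noteq> w"
  shows "degree_in V (traverse m x w) x = (if m x w = 0 then Suc (degree_in V m x) else degree_in V m x)"
proof (cases "m x w = 0")
  case True
  have "{v \<in> V. traverse m x w x v \<noteq> 0} = insert w {v \<in> V. m x v \<noteq> 0}"
    using assms by (auto simp: traverse_row)
  then show ?thesis using True assms by (simp add: degree_in_def)
next
  case False
  have "{v \<in> V. traverse m x w x v \<noteq> 0} = {v \<in> V. m x v \<noteq> 0}"
    using assms False by (auto simp: traverse_row)
  then show ?thesis using False by (simp add: degree_in_def)
qed

lemma open_degree_traverse:
  assumes "finite V" "w \<in> V" "x \<noteq> w"
  shows "open_degree V (traverse m x w) x =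
    (if m x w = 0 then Suc (open_degree V m x)
     else if m x w = 1 then open_degree V m x - 1 else open_degree V m x)"
proof -
  consider "m x w = 0" | "m x w = 1" | "m x w \<noteq> 0" "m x w \<noteq> 1" by blast
  then show ?thesis
  proof cases
    case 1
    have "{v \<in> V. traverse m x w x v = 1} = insert w {v \<in> V. m x v = 1}"
      using assms 1 by (auto simp: traverse_row)
    then show ?thesis using 1 assms by (simp add: open_degree_def)
  next
    case 2
    have "{v \<in> V. traverse m x w x v = 1} = {v \<in> V. m x v = 1} - {w}"
      using assms 2 by (auto simp: traverse_row)
    then show ?thesis using 2 assms by (simp add: open_degree_def)
  next
    case 3
    have "{v \<in> V. traverse m x w x v = 1} = {v \<in> V. m x v = 1}"
      using assms 3 by (auto simp: traverse_row)
    then show ?thesis using 3 assms by (simp add: open_degree_def)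
  qed
qed

lemma open_degree_le_degree: "finite V \<Longrightarrow> open_degree V m x \<le> degree_in V m x"
  unfolding open_degree_def degree_in_def by (intro card_mono) auto

lemma open_degree_pos:
  assumes "finite V" "w \<in> V" "m x w = 1"
  shows "open_degree V m x \<ge> 1"
proof -
  have "{v \<in> V. m x v = 1} \<noteq> {}" using assms by auto
  then show ?thesis using assms by (simp add: open_degree_def card_gt_0_iff Suc_le_eq)
qed

lemma degree_pos:
  assumes "finite V" "w \<in> V" "m x w \<noteq> 0"
  shows "degree_in V m x \<noteq> 0"
  using assms by (auto simp: degree_in_def)

lemma sum_degree_traverse:
  assumes "finite V" "w \<in> V" "x \<in> V" "x \<noteq> w"
  shows "(\<Sum>u\<in>V. degree_in V (traverse m x w) u) \<le> (\<Sum>u\<in>V. degree_in V m u) + 2"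
proof -
  have "degree_in V (traverse m x w) x \<le> degree_in V m x + 1"
    using degree_traverse[of V w x m] assms by auto
  moreover have "degree_in V (traverse m x w) w \<le> degree_in V m w + 1"
    using degree_traverse[of V x w m] assms by (auto simp: traverse_commute[of m x w])
  ultimately have "(\<Sum>u\<in>V. degree_in V (traverse m x w) u)
      \<le> (\<Sum>u\<in>V. degree_in V m u + (if u = x then 1 else 0) + (if u = w then 1 else 0))"
    using assms by (intro sum_mono) auto
  also have "\<dots> = (\<Sum>u\<in>V. degree_in V m u) + 2"
    using assms by (simp add: sum.distrib)
  finally show ?thesis .
qed

section \<open>A potential on explored graphs\<close>

text \<open>
  The contribution of a vertex with \<open>k\<close> explored edges, \<open>j\<close> of them open. The first factor pays for
  the second traversal of the open edges (each is seen from both of its ends), the second for the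
  choice among the open edges at a branching vertex, and the powers of \<open>E\<close>, which decrease with the
  remaining time, for passing a branching vertex along edges that are no longer open.
\<close>

definition vertex_potential :: "real \<Rightarrow> real \<Rightarrow> nat \<Rightarrow> nat \<Rightarrow> real" where
  "vertex_potential \<theta> E k j = (1 / sqrt \<theta>) ^ j * (if k \<ge> 3 then 2 ^ j * fact j else 1) * E ^ (k - 2)"

lemma vertex_potential_pos: "\<theta> > 0 \<Longrightarrow> E > 0 \<Longrightarrow> vertex_potential \<theta> E k j > 0"
  by (simp add: vertex_potential_def)

text \<open>The lossless case, which covers the discovery of a path: the degree stays below 3 and
  both exponents \<open>k - 2\<close> truncate to 0, so only the share of the new open edge
  appears.\<close>

lemma vertex_potential_new_low:
  assumes "k \<le> 1"
  shows "vertex_potential \<theta> E (Suc k) (Suc j) = vertex_potential \<theta> E k j / sqrt \<theta>"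
  using assms by (simp add: vertex_potential_def)

text \<open>\<open>R * Em\<close> is the price of a degree above 2. When the degree passes from 2 to
  3 the factorial is switched on at once, with at most 3 open edges, and
  \<open>48 = 2 ^ 3 * fact 3\<close>. From then on it grows by \<open>2 * (j + 1)\<close> per
  edge.\<close>

lemma vertex_potential_new:
  assumes "\<theta> > 0" "1 \<le> E" "E \<le> Em" "j \<le> k" "48 \<le> R" "2 * (real k + 1) \<le> R"
  shows "vertex_potential \<theta> E (Suc k) (Suc j) \<le> vertex_potential \<theta> E k j * (R * Em / sqrt \<theta>)"
proof -
  define A where "A = (1 / sqrt \<theta>) ^ j * E ^ (k - 2) / sqrt \<theta>"
  have A: "A \<ge> 0" using assms by (simp add: A_def)
  have REm: "R * Em \<ge> 1 * 1" using assms by (intro mult_mono) auto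
  consider "k \<le> 1" | "k = 2" | "k \<ge> 3" by linarith
  then show ?thesis
  proof cases
    case 1
    then have "vertex_potential \<theta> E (Suc k) (Suc j) = A * 1"
      by (simp add: vertex_potential_def A_def)
    also have "\<dots> \<le> A * (R * Em)" using A REm by (intro mult_left_mono) auto
    also have "\<dots> = vertex_potential \<theta> E k j * (R * Em / sqrt \<theta>)"
      using 1 by (simp add: vertex_potential_def A_def)
    finally show ?thesis .
  next
    case 2
    then have "j = 0 \<or> j = 1 \<or> j = 2" using assms by auto
    then have "(2::real) ^ (Suc j) * fact (Suc j) \<le> 48" by (auto simp: fact_2)
    then have "(2::real) ^ (Suc j) * fact (Suc j) \<le> R" using \<open>48 \<le> R\<close> by (rule order_trans)
    then have "(2::real) ^ (Suc j) * fact (Suc j) * E \<le> R * Em"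
      by (rule mult_mono) (use assms in auto)
    then have "A * (2 ^ (Suc j) * fact (Suc j) * E) \<le> A * (R * Em)"
      using A by (intro mult_left_mono)
    then show ?thesis using 2 by (simp add: vertex_potential_def A_def mult_ac)
  next
    case 3
    have "2 * real (Suc j) \<le> R" using assms by auto
    then have "2 * real (Suc j) * E \<le> R * Em" using assms by (intro mult_mono) auto
    then have "A * (2 ^ j * fact j) * (2 * real (Suc j) * E) \<le> A * (2 ^ j * fact j) * (R * Em)"
      using A by (intro mult_left_mono) auto
    moreover have "Suc k - 2 = Suc (k - 2)" using 3 by linarith
    then have "E ^ (Suc k - 2) = E * E ^ (k - 2)" by (simp only: power_Suc)
    ultimately show ?thesis using 3 by (simp add: vertex_potential_def A_def algebra_simps add_divide_distrib)
  qed
qed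

lemma vertex_potential_close:
  assumes "\<theta> > 0" "E > 0" "j \<ge> 1"
  shows "vertex_potential \<theta> E k (j - 1) \<le> vertex_potential \<theta> E k j * sqrt \<theta>"
proof -
  obtain i where i: "j = Suc i" using assms by (cases j) auto
  have "1 \<le> 2 * real (Suc i)" by simp
  then have "(1 / sqrt \<theta>) ^ i * E ^ (k - 2) * (2 ^ i * fact i) * 1 \<le>
    (1 / sqrt \<theta>) ^ i * E ^ (k - 2) * (2 ^ i * fact i) * (2 * real (Suc i))"
    using assms by (intro mult_left_mono) auto
  then show ?thesis using assms i by (simp add: vertex_potential_def mult_ac)
qed

text \<open>The divisor \<open>2 * j\<close> is what the factorial was stored for: summed over the
  \<open>j\<close> open edges, closing one of them costs only half of what a single edge costs at a
  vertex of low degree. The other half is left for the edges that are no longer open.\<close>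

lemma vertex_potential_close_branching:
  assumes "\<theta> > 0" "E > 0" "j \<ge> 1" "k \<ge> 3"
  shows "vertex_potential \<theta> E k (j - 1) = vertex_potential \<theta> E k j * (sqrt \<theta> / (2 * real j))"
proof -
  obtain i where i: "j = Suc i" using assms by (cases j) auto
  have "2 ^ Suc i * fact (Suc i) = (2 ^ i * fact i) * (2 * real (Suc i))" by simp
  then have "(2 ^ i * fact i :: real) = 2 ^ Suc i * fact (Suc i) / (2 * real (Suc i))"
    by (simp only:) simp
  then have "vertex_potential \<theta> E k i = (1 / sqrt \<theta>) ^ i * (2 ^ Suc i * fact (Suc i) / (2 * real (Suc i))) * E ^ (k - 2)"
    unfolding vertex_potential_def using assms by (simp only: if_True)
  also have "\<dots> = vertex_potential \<theta> E k (Suc i) * (sqrt \<theta> / (2 * real (Suc i)))"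
    unfolding vertex_potential_def using assms by (simp del: of_nat_Suc fact_Suc add: field_simps)
  finally show ?thesis using i by simp
qed

definition potential :: "'v set \<Rightarrow> real \<Rightarrow> real \<Rightarrow> ('v \<Rightarrow> 'v \<Rightarrow> nat) \<Rightarrow> real" where
  "potential V \<theta> E m = (\<Prod>x\<in>V. vertex_potential \<theta> E (degree_in V m x) (open_degree V m x))"

lemma potential_pos: "\<theta> > 0 \<Longrightarrow> E > 0 \<Longrightarrow> potential V \<theta> E m > 0"
  by (simp add: potential_def prod_pos vertex_potential_pos)

lemma potential_traverse_le:
  assumes "finite V" "x \<in> V" "w \<in> V" "x \<noteq> w" "\<theta> > 0" "E > 0"
    and "vertex_potential \<theta> E (degree_in V (traverse m x w) x) (open_degree V (traverse m x w) x)
      \<le> vertex_potential \<theta> E (degree_in V m x) (open_degree V m x) * r"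
    and "vertex_potential \<theta> E (degree_in V (traverse m x w) w) (open_degree V (traverse m x w) w)
      \<le> vertex_potential \<theta> E (degree_in V m w) (open_degree V m w) * s"
    and "r \<ge> 0" "s \<ge> 0"
  shows "potential V \<theta> E (traverse m x w) \<le> potential V \<theta> E m * (r * s)"
proof -
  let ?f = "\<lambda>m u. vertex_potential \<theta> E (degree_in V m u) (open_degree V m u)"
  have split: "(\<Prod>u\<in>V. g u) = g x * g w * (\<Prod>u\<in>V - {x, w}. g u)" for g :: "'a \<Rightarrow> real"
  proof -
    have "V - {x} - {w} = V - {x, w}" by auto
    then show ?thesis
      using prod.remove[of V x g] prod.remove[of "V - {x}" w g] assms(1-4) by (simp add: mult.assoc)
  qed
  have rest: "(\<Prod>u\<in>V - {x, w}. ?f (traverse m x w) u) = (\<Prod>u\<in>V - {x, w}. ?f m u)"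
    by (intro prod.cong) auto
  have pos: "?f m u > 0" for m u using assms by (simp add: vertex_potential_pos)
  have "?f (traverse m x w) x * ?f (traverse m x w) w \<le> (?f m x * r) * (?f m w * s)"
    using assms pos by (intro mult_mono mult_nonneg_nonneg) (auto intro: less_imp_le)
  moreover have "(\<Prod>u\<in>V - {x, w}. ?f m u) \<ge> 0" using pos by (intro prod_nonneg) (auto intro: less_imp_le)
  ultimately have "?f (traverse m x w) x * ?f (traverse m x w) w * (\<Prod>u\<in>V - {x, w}. ?f m u)
      \<le> (?f m x * r) * (?f m w * s) * (\<Prod>u\<in>V - {x, w}. ?f m u)"
    by (rule mult_right_mono)
  then show ?thesis
    unfolding potential_def split[of "?f (traverse m x w)"] split[of "?f m"] rest
    by (simp add: mult_ac)
qed

text \<open>As time passes the factor of every vertex can only shrink. The drop is kept explicitly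
  at the current vertex alone, where it has to compensate the number of explored edges.\<close>

lemma potential_time:
  assumes "finite V" "x \<in> V" "\<theta> > 0" "\<mu> \<ge> 0"
  shows "potential V \<theta> (exp (\<mu> * real t)) m
    \<le> potential V \<theta> (exp (\<mu> * real (Suc t))) m * exp (- \<mu> * real (degree_in V m x - 2))"
proof -
  let ?f = "\<lambda>t u. vertex_potential \<theta> (exp (\<mu> * real t)) (degree_in V m u) (open_degree V m u)"
  have pos: "?f m u > 0" for m u using assms by (simp add: vertex_potential_pos)
  have eq: "?f t u = ?f (Suc t) u * exp (- \<mu> * real (degree_in V m u - 2))" for u
  proof -
    have "exp (\<mu> * real t) ^ k = exp (\<mu> * real (Suc t)) ^ k * exp (- \<mu> * real k)" for k
      by (simp add: exp_of_nat_mult[symmetric] exp_add[symmetric] algebra_simps)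
    then show ?thesis by (simp add: vertex_potential_def mult_ac)
  qed
  have le: "?f t u \<le> ?f (Suc t) u" for u
    unfolding eq[of u] using pos[of "Suc t" u] assms by (intro mult_left_le) auto
  have "(\<Prod>u\<in>V - {x}. ?f t u) \<le> (\<Prod>u\<in>V - {x}. ?f (Suc t) u)"
    using le pos by (intro prod_mono) (auto intro: less_imp_le)
  then have "?f t x * (\<Prod>u\<in>V - {x}. ?f t u) \<le> ?f t x * (\<Prod>u\<in>V - {x}. ?f (Suc t) u)"
    using pos[of t x] by (intro mult_left_mono) auto
  then have "?f t x * (\<Prod>u\<in>V - {x}. ?f t u) \<le>
      (?f (Suc t) x * exp (- \<mu> * real (degree_in V m x - 2))) * (\<Prod>u\<in>V - {x}. ?f (Suc t) u)"
    by (simp only: eq[of x, symmetric])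
  then show ?thesis
    unfolding potential_def prod.remove[OF assms(1,2)] by (simp only: mult_ac)
qed

lemma potential_time':
  assumes "finite V" "x \<in> V" "\<theta> > 0" "\<mu> \<ge> 0"
  shows "potential V \<theta> (exp (\<mu> * real t)) m \<le> potential V \<theta> (exp (\<mu> * real (Suc t))) m"
proof -
  have "potential V \<theta> (exp (\<mu> * real (Suc t))) m * exp (- \<mu> * real (degree_in V m x - 2))
      \<le> potential V \<theta> (exp (\<mu> * real (Suc t))) m * 1"
    using assms potential_pos[of \<theta> "exp (\<mu> * real (Suc t))" V m]
    by (intro mult_left_mono) (auto intro: less_imp_le)
  with potential_time[OF assms, of t m] show ?thesis by simp
qed

section \<open>Growth of the potential in one step\<close>

lemma card_le_sum_degree:
  assumes "finite V"
  shows "card {w \<in> V. degree_in V m w \<noteq> 0} \<le> (\<Sum>u\<in>V. degree_in V m u)"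
proof -
  have "card {w \<in> V. degree_in V m w \<noteq> 0} = (\<Sum>u\<in>{w \<in> V. degree_in V m w \<noteq> 0}. 1)" by simp
  also have "\<dots> \<le> (\<Sum>u\<in>{w \<in> V. degree_in V m w \<noteq> 0}. degree_in V m u)"
    by (intro sum_mono) auto
  also have "\<dots> \<le> (\<Sum>u\<in>V. degree_in V m u)"
    using assms by (intro sum_mono2) auto
  finally show ?thesis .
qed

text \<open>With \<open>k + 2\<close> in the role of the degree, this weighs the number of explored
  edges against the drop of \<open>potential_time\<close>; the bound is uniform in the
  degree.\<close>

lemma mult_exp_minus_le:
  fixes \<mu> :: real
  assumes "\<mu> > 0"
  shows "(real k + 2) * exp (- \<mu> * real k) \<le> 2 + 1 / \<mu>"
proof -
  have "\<mu> * real k \<le> exp (\<mu> * real k)" using exp_ge_add_one_self[of "\<mu> * real k"] by linarith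
  then have "real k * exp (- \<mu> * real k) \<le> 1 / \<mu>"
    using assms by (simp add: exp_minus field_simps)
  moreover have "2 * exp (- \<mu> * real k) \<le> 2" using assms by simp
  ultimately show ?thesis by (simp only: distrib_right)
qed

text \<open>\<open>c\<close> is a supersolution of \<open>P\<close> that evens out unequal expected
  degrees. A new edge brings the growth \<open>\<theta>^2\<close>, shared by its first two
  traversals, hence \<open>\<theta>\<close> per step. \<open>\<Lambda>1\<close> is the requirement
  at the frontier and at degree at most 2, \<open>\<Lambda>2\<close> the one at branching vertices.
  The last three assumptions make the steps along new edges cheap: leaving the explored graph,
  joining two explored vertices away from the frontier, and coming back from the frontier.
  \<open>T\<close> is the total number of steps of both walks.\<close>

locale walk_counting =
  fixes V :: "'v set" and P :: "'v \<Rightarrow> 'v \<Rightarrow> real" and c :: "'v \<Rightarrow> real"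
    and \<theta> \<mu> \<epsilon> \<delta> q R cmax \<Lambda> Em :: real and T :: nat
  assumes fin: "finite V"
    and P_nonneg: "\<And>x y. x \<in> V \<Longrightarrow> y \<in> V \<Longrightarrow> 0 \<le> P x y"
    and P_le: "\<And>x y. x \<in> V \<Longrightarrow> y \<in> V \<Longrightarrow> P x y \<le> q"
    and c_ge: "\<And>x. x \<in> V \<Longrightarrow> 1 \<le> c x" and c_le: "\<And>x. x \<in> V \<Longrightarrow> c x \<le> cmax"
    and P_c: "\<And>x. x \<in> V \<Longrightarrow> (\<Sum>y\<in>V. P x y * c y) \<le> \<theta> ^ 2 * c x"
    and \<theta>_ge: "1 \<le> \<theta>" and \<mu>_pos: "0 < \<mu>" and \<epsilon>_pos: "0 < \<epsilon>" and \<epsilon>_le: "\<epsilon> \<le> 1" and \<delta>_pos: "0 < \<delta>"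
    and R_ge: "48 \<le> R" "4 * real T + 2 \<le> R"
    and Em: "exp (\<mu> * real T) \<le> Em"
    and \<Lambda>1: "\<theta> + \<delta> * \<theta> \<le> \<Lambda>" and \<Lambda>2: "\<theta> / 2 + (2 + 1 / \<mu>) + \<delta> * \<theta> \<le> \<Lambda>"
    and small_departure: "\<epsilon> * cmax * (R * Em) \<le> \<delta> / 2"
    and small_excess: "2 * real T * q * (R * Em)\<^sup>2 \<le> \<delta> / 2 * \<theta>\<^sup>2"
    and small_return: "2 * real T * q * (R * Em) \<le> \<delta> * \<theta>\<^sup>2 * \<epsilon>"
begin

text \<open>
  The factor \<open>\<epsilon>\<close> is paid when the walk leaves the explored graph through a new vertex. It is
  recovered when the walk comes back through a new edge between explored vertices, which costs \<open>q\<close>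
  times the number of explored vertices.
\<close>

definition mode_factor :: "bool \<Rightarrow> 'v \<Rightarrow> real" where
  "mode_factor fr x = (if fr then \<epsilon> * c x else 1)"

definition pot :: "nat \<Rightarrow> ('v \<Rightarrow> 'v \<Rightarrow> nat) \<Rightarrow> real" where
  "pot t = potential V \<theta> (exp (\<mu> * real t))"

text \<open>The inequality is a budget: a step raises the total degree by at most 2, so with
  \<open>t\<close> steps left it is at most \<open>2 * (T - t)\<close>. It bounds both the degrees
  and the number of explored vertices. The last clause says that the only explored edge at a
  frontier vertex is the one that led there.\<close>

definition admissible :: "nat \<Rightarrow> ('v \<Rightarrow> 'v \<Rightarrow> nat) \<Rightarrow> 'v \<Rightarrow> 'v \<Rightarrow> bool \<Rightarrow> bool" where
  "admissible t m x0 x fr \<longleftrightarrow> (\<forall>u v. m u v = m v u) \<and>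
     (\<Sum>u\<in>V. degree_in V m u) + 2 * t \<le> 2 * T \<and> (fr \<longrightarrow> (\<forall>w\<in>V. w \<noteq> x0 \<longrightarrow> m x w = 0))"

lemma \<theta>_pos: "\<theta> > 0" using \<theta>_ge by simp

lemma pot_pos: "pot t m > 0"
  unfolding pot_def using \<theta>_pos by (intro potential_pos) auto

lemma q_nonneg:
  assumes "V \<noteq> {}"
  shows "0 \<le> q"
proof -
  obtain x where "x \<in> V" using assms by blast
  then show ?thesis using P_nonneg[of x x] P_le[of x x] by linarith
qed

lemma Em_ge1: "1 \<le> Em"
proof -
  have "1 \<le> exp (\<mu> * real T)" using \<mu>_pos by simp
  with Em show ?thesis by linarith
qed

lemma exp_le_Em: "t \<le> T \<Longrightarrow> exp (\<mu> * real t) \<le> Em"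
proof -
  assume "t \<le> T"
  then have "exp (\<mu> * real t) \<le> exp (\<mu> * real T)" using \<mu>_pos by simp
  with Em show ?thesis by linarith
qed

lemma degree_le:
  assumes "admissible t m x0 x fr" "u \<in> V"
  shows "degree_in V m u \<le> 2 * T"
proof -
  have "degree_in V m u \<le> (\<Sum>u\<in>V. degree_in V m u)"
    using assms fin by (intro member_le_sum) auto
  then show ?thesis using assms by (simp add: admissible_def)
qed

lemma ratio_new:
  assumes "admissible t' m x0 x fr" "u \<in> V" "t \<le> T"
  shows "vertex_potential \<theta> (exp (\<mu> * real t)) (Suc (degree_in V m u)) (Suc (open_degree V m u))
    \<le> vertex_potential \<theta> (exp (\<mu> * real t)) (degree_in V m u) (open_degree V m u) * (R * Em / sqrt \<theta>)"
proof (rule vertex_potential_new)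
  have "real (degree_in V m u) \<le> 2 * real T"
    using degree_le[OF assms(1,2)] by linarith
  then have "2 * (real (degree_in V m u) + 1) \<le> 4 * real T + 2" by simp
  then show "2 * (real (degree_in V m u) + 1) \<le> R" using R_ge(2) by (rule order_trans)
  show "1 \<le> exp (\<mu> * real t)" using \<mu>_pos by simp
qed (use \<theta>_pos R_ge exp_le_Em[OF assms(3)] fin in \<open>auto intro: open_degree_le_degree\<close>)

lemma pot_traverse_new:
  assumes adm: "admissible t' m x0 x fr" and "x \<in> V" "w \<in> V" "x \<noteq> w" "t \<le> T" "m x w = 0"
  shows "pot t (traverse m x w) \<le> pot t m * ((R * Em)\<^sup>2 / \<theta>)"
    and "degree_in V m x \<le> 1 \<Longrightarrow> pot t (traverse m x w) \<le> pot t m * (R * Em / \<theta>)"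
    and "degree_in V m w \<le> 1 \<Longrightarrow> pot t (traverse m x w) \<le> pot t m * (R * Em / \<theta>)"
    and "degree_in V m x \<le> 1 \<Longrightarrow> degree_in V m w \<le> 1 \<Longrightarrow> pot t (traverse m x w) \<le> pot t m * (1 / \<theta>)"
proof -
  have sym: "m w x = 0" using adm \<open>m x w = 0\<close> unfolding admissible_def by metis
  have dx: "degree_in V (traverse m x w) x = Suc (degree_in V m x)"
    "open_degree V (traverse m x w) x = Suc (open_degree V m x)"
    using assms fin by (simp_all add: degree_traverse open_degree_traverse)
  have dw: "degree_in V (traverse m x w) w = Suc (degree_in V m w)"
    "open_degree V (traverse m x w) w = Suc (open_degree V m w)"
    using assms fin sym
    by (simp_all add: degree_traverse open_degree_traverse traverse_commute[of m x w])
  have RE: "R * Em \<ge> 0" using R_ge Em_ge1 by simp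
  have sq: "sqrt \<theta> * sqrt \<theta> = \<theta>" using \<theta>_pos by simp
  note base = potential_traverse_le[OF fin \<open>x \<in> V\<close> \<open>w \<in> V\<close> \<open>x \<noteq> w\<close> \<theta>_pos exp_gt_zero,
      of "\<mu> * real t" m, unfolded dx dw, folded pot_def]
  note gen = ratio_new[OF adm _ \<open>t \<le> T\<close>]
  have low: "degree_in V m u \<le> 1 \<Longrightarrow>
    vertex_potential \<theta> (exp (\<mu> * real t)) (Suc (degree_in V m u)) (Suc (open_degree V m u))
    \<le> vertex_potential \<theta> (exp (\<mu> * real t)) (degree_in V m u) (open_degree V m u) * (1 / sqrt \<theta>)" for u
    by (simp add: vertex_potential_new_low)
  show "pot t (traverse m x w) \<le> pot t m * ((R * Em)\<^sup>2 / \<theta>)"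
    using base[OF gen[OF \<open>x \<in> V\<close>] gen[OF \<open>w \<in> V\<close>]] RE \<theta>_pos sq by (simp add: power2_eq_square)
  show "pot t (traverse m x w) \<le> pot t m * (R * Em / \<theta>)" if "degree_in V m x \<le> 1"
    using base[OF low[OF that] gen[OF \<open>w \<in> V\<close>]] RE \<theta>_pos sq by simp
  show "pot t (traverse m x w) \<le> pot t m * (R * Em / \<theta>)" if "degree_in V m w \<le> 1"
    using base[OF gen[OF \<open>x \<in> V\<close>] low[OF that]] RE \<theta>_pos sq by simp
  show "pot t (traverse m x w) \<le> pot t m * (1 / \<theta>)" if "degree_in V m x \<le> 1" "degree_in V m w \<le> 1"
    using base[OF low[OF that(1)] low[OF that(2)]] \<theta>_pos sq by simp
qed

lemma pot_traverse_old:
  assumes sym: "m w x = m x w" and "x \<in> V" "w \<in> V" "x \<noteq> w" "m x w \<noteq> 0"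
  shows "m x w = 1 \<Longrightarrow> pot t (traverse m x w) \<le> pot t m * \<theta>"
    and "m x w = 1 \<Longrightarrow> degree_in V m x \<ge> 3 \<Longrightarrow>
      pot t (traverse m x w) \<le> pot t m * (\<theta> / (2 * real (open_degree V m x)))"
    and "m x w \<noteq> 1 \<Longrightarrow> pot t (traverse m x w) \<le> pot t m"
proof -
  have dx: "degree_in V (traverse m x w) x = degree_in V m x"
    "open_degree V (traverse m x w) x = (if m x w = 1 then open_degree V m x - 1 else open_degree V m x)"
    using assms fin by (simp_all add: degree_traverse open_degree_traverse)
  have dw: "degree_in V (traverse m x w) w = degree_in V m w"
    "open_degree V (traverse m x w) w = (if m x w = 1 then open_degree V m w - 1 else open_degree V m w)"
    using assms fin by (simp_all add: degree_traverse open_degree_traverse traverse_commute[of m x w])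
  have sq: "sqrt \<theta> * sqrt \<theta> = \<theta>" using \<theta>_pos by simp
  note base = potential_traverse_le[OF fin \<open>x \<in> V\<close> \<open>w \<in> V\<close> \<open>x \<noteq> w\<close> \<theta>_pos exp_gt_zero,
      of "\<mu> * real t" m, folded pot_def]
  have close: "m u v = 1 \<Longrightarrow> v \<in> V \<Longrightarrow>
    vertex_potential \<theta> (exp (\<mu> * real t)) (degree_in V m u) (open_degree V m u - 1)
    \<le> vertex_potential \<theta> (exp (\<mu> * real t)) (degree_in V m u) (open_degree V m u) * sqrt \<theta>" for u v
    using \<theta>_pos fin open_degree_pos[of V v m u] by (intro vertex_potential_close) auto
  show "pot t (traverse m x w) \<le> pot t m * \<theta>" if "m x w = 1"
    using base[of "sqrt \<theta>" "sqrt \<theta>"] close[of x w] close[of w x] that assms dx dw sq \<theta>_pos by simp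
  show "pot t (traverse m x w) \<le> pot t m * (\<theta> / (2 * real (open_degree V m x)))"
    if "m x w = 1" "degree_in V m x \<ge> 3"
    using base[of "sqrt \<theta> / (2 * real (open_degree V m x))" "sqrt \<theta>"] close[of w x] that assms dx dw sq \<theta>_pos
      vertex_potential_close_branching[of \<theta> "exp (\<mu> * real t)" "open_degree V m x" "degree_in V m x"]
      open_degree_pos[of V w m x] fin by simp
  show "pot t (traverse m x w) \<le> pot t m" if "m x w \<noteq> 1"
    using base[of 1 1] that dx dw by simp
qed

definition step_term :: "nat \<Rightarrow> ('v \<Rightarrow> 'v \<Rightarrow> nat) \<Rightarrow> 'v \<Rightarrow> 'v \<Rightarrow> real" where
  "step_term t m x w = (if m x w = 0 then P x w else 1) *
     (mode_factor (degree_in V m w = 0) w * pot t (traverse m x w))"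

text \<open>The supersolution property enters here: the factor \<open>c w\<close> of the frontier is
  summed against \<open>P x w\<close> and gives back \<open>c x\<close>.\<close>

lemma sum_fresh_le:
  assumes x: "x \<in> V" and "S \<subseteq> V" "r \<ge> 0"
    and le: "\<And>w. w \<in> S \<Longrightarrow> m x w = 0 \<and> degree_in V m w = 0 \<and> pot t (traverse m x w) \<le> B * r"
    and B: "B \<ge> 0"
  shows "(\<Sum>w\<in>S. step_term t m x w) \<le> \<epsilon> * \<theta>\<^sup>2 * c x * (B * r)"
proof -
  have "(\<Sum>w\<in>S. step_term t m x w) \<le> (\<Sum>w\<in>S. P x w * c w * (\<epsilon> * (B * r)))"
  proof (rule sum_mono)
    fix w assume w: "w \<in> S"
    then have "w \<in> V" using assms by auto
    have "P x w * (\<epsilon> * c w) * pot t (traverse m x w) \<le> P x w * (\<epsilon> * c w) * (B * r)"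
      using le[OF w] P_nonneg[OF x \<open>w \<in> V\<close>] \<epsilon>_pos c_ge[OF \<open>w \<in> V\<close>] by (intro mult_left_mono) auto
    then show "step_term t m x w \<le> P x w * c w * (\<epsilon> * (B * r))"
      using le[OF w] by (simp add: step_term_def mode_factor_def mult_ac)
  qed
  also have "\<dots> = (\<Sum>w\<in>S. P x w * c w) * (\<epsilon> * (B * r))"
    by (simp add: sum_distrib_right)
  also have "\<dots> \<le> (\<Sum>w\<in>V. P x w * c w) * (\<epsilon> * (B * r))"
    using assms fin P_nonneg c_ge \<epsilon>_pos
    by (intro mult_right_mono sum_mono2 mult_nonneg_nonneg)
       (auto intro: order_trans[OF zero_le_one])
  also have "\<dots> \<le> (\<theta>\<^sup>2 * c x) * (\<epsilon> * (B * r))"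
    using P_c[OF x] B \<open>r \<ge> 0\<close> \<epsilon>_pos by (intro mult_right_mono) auto
  finally show ?thesis by (simp add: mult_ac)
qed

text \<open>The targets are among the at most \<open>2 * T\<close> explored vertices, so the maximal
  probability \<open>q\<close> times their number is affordable.\<close>

lemma sum_return_le:
  assumes adm: "admissible t' m x0 x fr" and x: "x \<in> V" and "S \<subseteq> V" "r \<ge> 0" "B \<ge> 0"
    and le: "\<And>w. w \<in> S \<Longrightarrow> m x w = 0 \<and> degree_in V m w \<noteq> 0 \<and> pot t (traverse m x w) \<le> B * r"
  shows "(\<Sum>w\<in>S. step_term t m x w) \<le> 2 * real T * q * (B * r)"
proof -
  have q: "q \<ge> 0" using q_nonneg x by auto
  have "(\<Sum>w\<in>S. step_term t m x w) \<le> (\<Sum>w\<in>S. q * (B * r))"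
  proof (rule sum_mono)
    fix w assume w: "w \<in> S"
    then have "w \<in> V" using assms by auto
    have "P x w * pot t (traverse m x w) \<le> q * (B * r)"
      using le[OF w] P_le[OF x \<open>w \<in> V\<close>] q pot_pos[of t] by (intro mult_mono) (auto intro: less_imp_le)
    then show "step_term t m x w \<le> q * (B * r)"
      using le[OF w] by (simp add: step_term_def mode_factor_def)
  qed
  also have "\<dots> = real (card S) * (q * (B * r))" by simp
  also have "\<dots> \<le> (2 * real T) * (q * (B * r))"
  proof (rule mult_right_mono)
    have "card S \<le> card {w \<in> V. degree_in V m w \<noteq> 0}"
      using le assms fin by (intro card_mono) auto
    also have "\<dots> \<le> 2 * T"
      using card_le_sum_degree[OF fin, of m] adm by (simp add: admissible_def)
    finally show "real (card S) \<le> 2 * real T" by linarith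
    show "0 \<le> q * (B * r)" using q assms by simp
  qed
  finally show ?thesis by (simp add: mult_ac)
qed

text \<open>Up to degree 2 there is no choice: one explored edge leads back, at most one leads on.
  From degree 3 on, the open edges share \<open>\<theta> / 2\<close> and the remaining ones are paid
  for by the elapsed time. The factor 2 occurs only if the edge to \<open>x0\<close> is unexplored,
  as may happen at the start of the second walk.\<close>

lemma sum_old_le:
  assumes sym: "\<And>u v. m u v = m v u" and x: "x \<in> V" "x0 \<in> V"
    and S: "S = {w \<in> V. w \<noteq> x \<and> w \<noteq> x0 \<and> m x w \<noteq> 0}"
  shows "(\<Sum>w\<in>S. step_term t m x w) \<le>
    (if m x x0 \<noteq> 0 then 1 else 2) * max \<theta> (\<theta> / 2 + (2 + 1 / \<mu>)) * pot (Suc t) m"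
proof -
  have fS: "finite S" "S \<subseteq> V" using S fin by auto
  have tm: "step_term t m x w = pot t (traverse m x w)" if "w \<in> S" for w
  proof -
    have "m w x \<noteq> 0" using that S sym[of w x] by auto
    then have "degree_in V m w \<noteq> 0" using degree_pos[OF fin x(1)] by auto
    then show ?thesis using that S by (simp add: step_term_def mode_factor_def)
  qed
  have le: "pot t m \<le> pot (Suc t) m"
    unfolding pot_def using \<mu>_pos \<theta>_pos by (intro potential_time'[OF fin x(1)]) auto
  show ?thesis
  proof (cases "degree_in V m x \<ge> 3")
    case False
    have "card S \<le> (if m x x0 \<noteq> 0 then 1 else 2)"
    proof (cases "m x x0 \<noteq> 0")
      case True
      have "insert x0 S \<subseteq> {w \<in> V. m x w \<noteq> 0}" using S x True by auto
      then have "card (insert x0 S) \<le> degree_in V m x"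
        unfolding degree_in_def using fin by (intro card_mono) auto
      then show ?thesis using False True S fS by simp
    next
      case xx: False
      have "card S \<le> degree_in V m x"
        unfolding degree_in_def using fin S by (intro card_mono) auto
      then show ?thesis using False xx by simp
    qed
    then have card: "real (card S) \<le> (if m x x0 \<noteq> 0 then 1 else 2)" by (auto split: if_splits)
    have "(\<Sum>w\<in>S. step_term t m x w) \<le> (\<Sum>w\<in>S. max \<theta> (\<theta> / 2 + (2 + 1 / \<mu>)) * pot (Suc t) m)"
    proof (rule sum_mono)
      fix w assume w: "w \<in> S"
      have "pot t (traverse m x w) \<le> pot t m * \<theta>"
      proof (cases "m x w = 1")
        case True
        then show ?thesis using pot_traverse_old(1)[of m w x t] w S sym x by auto
      next
        case False
        have "pot t m * 1 \<le> pot t m * \<theta>" using \<theta>_ge pot_pos[of t m] by (intro mult_left_mono) auto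
        then show ?thesis using pot_traverse_old(3)[of m w x t] w S sym x False by auto
      qed
      also have "\<dots> \<le> pot (Suc t) m * max \<theta> (\<theta> / 2 + (2 + 1 / \<mu>))"
        using le \<theta>_pos pot_pos[of "Suc t" m] by (intro mult_mono) auto
      finally show "step_term t m x w \<le> max \<theta> (\<theta> / 2 + (2 + 1 / \<mu>)) * pot (Suc t) m"
        using tm[OF w] by (simp add: mult.commute)
    qed
    also have "\<dots> = real (card S) * (max \<theta> (\<theta> / 2 + (2 + 1 / \<mu>)) * pot (Suc t) m)" by simp
    also have "\<dots> \<le> (if m x x0 \<noteq> 0 then 1 else 2) * (max \<theta> (\<theta> / 2 + (2 + 1 / \<mu>)) * pot (Suc t) m)"
      using card \<theta>_pos pot_pos[of "Suc t" m] by (intro mult_right_mono) auto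
    finally show ?thesis by (simp add: mult_ac)
  next
    case True
    define S1 where "S1 = {w \<in> S. m x w = 1}"
    define S2 where "S2 = {w \<in> S. m x w \<noteq> 1}"
    have "S = S1 \<union> S2" "S1 \<inter> S2 = {}" "finite S1" "finite S2"
      using fS by (auto simp: S1_def S2_def)
    then have split: "(\<Sum>w\<in>S. step_term t m x w) = (\<Sum>w\<in>S1. step_term t m x w) + (\<Sum>w\<in>S2. step_term t m x w)"
      by (simp add: sum.union_disjoint)
    have "(\<Sum>w\<in>S1. step_term t m x w) \<le> \<theta> / 2 * pot (Suc t) m"
    proof (cases "S1 = {}")
      case True
      then show ?thesis using \<theta>_pos pot_pos[of "Suc t" m] by simp
    next
      case False
      have cardle: "card S1 \<le> open_degree V m x"
        unfolding open_degree_def using fin S S1_def by (intro card_mono) auto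
      have "card S1 > 0" using False \<open>finite S1\<close> by (simp add: card_gt_0_iff)
      then have opos: "open_degree V m x > 0" using cardle by linarith
      have "(\<Sum>w\<in>S1. step_term t m x w) \<le> (\<Sum>w\<in>S1. pot t m * (\<theta> / (2 * real (open_degree V m x))))"
      proof (rule sum_mono)
        fix w assume w: "w \<in> S1"
        then have "pot t (traverse m x w) \<le> pot t m * (\<theta> / (2 * real (open_degree V m x)))"
          using True S S1_def sym x by (intro pot_traverse_old(2)) auto
        then show "step_term t m x w \<le> pot t m * (\<theta> / (2 * real (open_degree V m x)))"
          using tm[of w] w S1_def by auto
      qed
      also have "\<dots> = real (card S1) * (pot t m * (\<theta> / (2 * real (open_degree V m x))))" by simp
      also have "\<dots> \<le> real (open_degree V m x) * (pot t m * (\<theta> / (2 * real (open_degree V m x))))"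
        using cardle pot_pos[of t m] \<theta>_pos by (intro mult_right_mono) auto
      also have "\<dots> = \<theta> / 2 * pot t m" using opos by simp
      also have "\<dots> \<le> \<theta> / 2 * pot (Suc t) m" using le \<theta>_pos by (intro mult_left_mono) auto
      finally show ?thesis .
    qed
    moreover have "(\<Sum>w\<in>S2. step_term t m x w) \<le> (2 + 1 / \<mu>) * pot (Suc t) m"
    proof -
      have "(\<Sum>w\<in>S2. step_term t m x w) \<le> (\<Sum>w\<in>S2. pot t m)"
      proof (rule sum_mono)
        fix w assume w: "w \<in> S2"
        then have "pot t (traverse m x w) \<le> pot t m"
          using S S2_def sym x by (intro pot_traverse_old(3)) auto
        then show "step_term t m x w \<le> pot t m"
          using tm[of w] w S2_def by auto
      qed
      also have "\<dots> = real (card S2) * pot t m" by simp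
      also have "\<dots> \<le> (real (degree_in V m x - 2) + 2) *
          (pot (Suc t) m * exp (- \<mu> * real (degree_in V m x - 2)))"
      proof (rule mult_mono)
        have "card S2 \<le> degree_in V m x"
          unfolding degree_in_def using fin S S2_def by (intro card_mono) auto
        then show "real (card S2) \<le> real (degree_in V m x - 2) + 2" by linarith
        show "pot t m \<le> pot (Suc t) m * exp (- \<mu> * real (degree_in V m x - 2))"
          unfolding pot_def using \<mu>_pos \<theta>_pos by (intro potential_time[OF fin x(1)]) auto
      qed (use pot_pos[of t m] in auto)
      also have "\<dots> \<le> (2 + 1 / \<mu>) * pot (Suc t) m"
        using mult_exp_minus_le[OF \<mu>_pos, of "degree_in V m x - 2"] pot_pos[of "Suc t" m]
          mult_right_mono[of _ _ "pot (Suc t) m"] by (simp add: mult_ac)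
      finally show ?thesis .
    qed
    ultimately have "(\<Sum>w\<in>S. step_term t m x w) \<le> (\<theta> / 2 + (2 + 1 / \<mu>)) * pot (Suc t) m"
      unfolding split by (simp add: distrib_right)
    also have "\<dots> \<le> max \<theta> (\<theta> / 2 + (2 + 1 / \<mu>)) * pot (Suc t) m"
      using pot_pos[of "Suc t" m] by (intro mult_right_mono) auto
    also have "\<dots> \<le> (if m x x0 \<noteq> 0 then 1 else 2) * (max \<theta> (\<theta> / 2 + (2 + 1 / \<mu>)) * pot (Suc t) m)"
    proof -
      have "0 \<le> max \<theta> (\<theta> / 2 + (2 + 1 / \<mu>)) * pot (Suc t) m"
        using pot_pos[of "Suc t" m] \<theta>_pos by (intro mult_nonneg_nonneg) auto
      then show ?thesis by (cases "m x x0 = 0") (auto simp: mult_ac)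
    qed
    finally show ?thesis by (simp add: mult_ac)
  qed
qed

text \<open>The next vertex is new (\<open>F\<close>), explored but reached by a new edge
  (\<open>G\<close>), or reached by an explored edge (\<open>S\<close>). At the frontier
  \<open>S\<close> is empty, \<open>F\<close> gives the main term and \<open>G\<close> has to repay
  \<open>\<epsilon>\<close>. Away from the frontier \<open>S\<close> is the main term, and
  \<open>F\<close> and \<open>G\<close> together are an error of relative size
  \<open>\<delta>\<close>.\<close>

lemma step_sum_le:
  assumes adm: "admissible (Suc t) m x0 x fr" and x: "x \<in> V" "x0 \<in> V"
  shows "(\<Sum>w\<in>V - {x, x0}. step_term t m x w) \<le>
    (if fr \<or> m x x0 \<noteq> 0 then 1 else 2) * \<Lambda> * (mode_factor fr x * pot (Suc t) m)"
proof -
  have sym: "m u v = m v u" for u v using adm by (simp add: admissible_def)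
  have tT: "t \<le> T" using adm by (simp add: admissible_def)
  have le: "pot t m \<le> pot (Suc t) m"
    unfolding pot_def using \<mu>_pos \<theta>_pos by (intro potential_time'[OF fin x(1)]) auto
  have pp: "pot t m \<ge> 0" "pot (Suc t) m \<ge> 0" using pot_pos less_imp_le by blast+
  have RE: "R * Em \<ge> 0" using R_ge Em_ge1 by simp
  have q: "q \<ge> 0" using q_nonneg x by auto
  define F where "F = {w \<in> V - {x, x0}. m x w = 0 \<and> degree_in V m w = 0}"
  define G where "G = {w \<in> V - {x, x0}. m x w = 0 \<and> degree_in V m w \<noteq> 0}"
  define S where "S = {w \<in> V. w \<noteq> x \<and> w \<noteq> x0 \<and> m x w \<noteq> 0}"
  have split: "(\<Sum>w\<in>V - {x, x0}. step_term t m x w) =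
      (\<Sum>w\<in>F. step_term t m x w) + (\<Sum>w\<in>G. step_term t m x w) + (\<Sum>w\<in>S. step_term t m x w)"
  proof -
    have e: "V - {x, x0} = (F \<union> G) \<union> S" by (auto simp: F_def G_def S_def)
    have f: "finite F" "finite G" "finite S" using fin by (auto simp: F_def G_def S_def)
    have "(\<Sum>w\<in>V - {x, x0}. step_term t m x w) =
        (\<Sum>w\<in>F \<union> G. step_term t m x w) + (\<Sum>w\<in>S. step_term t m x w)"
      unfolding e using f by (intro sum.union_disjoint) (auto simp: F_def G_def S_def)
    also have "(\<Sum>w\<in>F \<union> G. step_term t m x w) = (\<Sum>w\<in>F. step_term t m x w) + (\<Sum>w\<in>G. step_term t m x w)"
      using f by (intro sum.union_disjoint) (auto simp: F_def G_def)
    finally show ?thesis .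
  qed
  show ?thesis
  proof (cases fr)
    case True
    then have none: "m x w = 0" if "w \<in> V" "w \<noteq> x0" for w
      using adm that unfolding admissible_def by blast
    have "{w \<in> V. m x w \<noteq> 0} \<subseteq> {x0}"
    proof
      fix w assume "w \<in> {w \<in> V. m x w \<noteq> 0}"
      then show "w \<in> {x0}" using none[of w] by (cases "w = x0") simp_all
    qed
    then have "degree_in V m x \<le> card {x0}"
      unfolding degree_in_def by (intro card_mono) auto
    then have d1: "degree_in V m x \<le> 1" by simp
    have "S \<subseteq> {}"
    proof
      fix w assume "w \<in> S"
      then show "w \<in> {}" using none[of w] by (simp add: S_def)
    qed
    then have "S = {}" by simp
    have "(\<Sum>w\<in>F. step_term t m x w) \<le> \<epsilon> * \<theta>\<^sup>2 * c x * (pot t m * (1 / \<theta>))"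
    proof (rule sum_fresh_le[OF x(1)])
      show "m x w = 0 \<and> degree_in V m w = 0 \<and> pot t (traverse m x w) \<le> pot t m * (1 / \<theta>)"
        if "w \<in> F" for w using that d1 x(1) tT pot_traverse_new(4)[OF adm x(1)] by (auto simp: F_def)
    qed (use pp \<theta>_pos in \<open>auto simp: F_def\<close>)
    also have "\<dots> = \<theta> * (\<epsilon> * c x * pot t m)" using \<theta>_pos by (simp add: power2_eq_square)
    finally have 1: "(\<Sum>w\<in>F. step_term t m x w) \<le> \<theta> * (\<epsilon> * c x * pot t m)" .
    have "(\<Sum>w\<in>G. step_term t m x w) \<le> 2 * real T * q * (pot t m * (R * Em / \<theta>))"
    proof (rule sum_return_le[OF adm x(1)])
      show "m x w = 0 \<and> degree_in V m w \<noteq> 0 \<and> pot t (traverse m x w) \<le> pot t m * (R * Em / \<theta>)"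
        if "w \<in> G" for w using that d1 x(1) tT pot_traverse_new(2)[OF adm x(1)] by (auto simp: G_def)
    qed (use pp RE \<theta>_pos in \<open>auto simp: G_def\<close>)
    also have "\<dots> = (2 * real T * q * (R * Em)) * (pot t m / \<theta>)" by simp
    also have "\<dots> \<le> (\<delta> * \<theta>\<^sup>2 * \<epsilon>) * (pot t m / \<theta>)"
      using small_return pp \<theta>_pos by (intro mult_right_mono) auto
    also have "\<dots> = \<delta> * \<theta> * (\<epsilon> * 1 * pot t m)" using \<theta>_pos by (simp add: power2_eq_square)
    also have "\<dots> \<le> \<delta> * \<theta> * (\<epsilon> * c x * pot t m)"
      using c_ge[OF x(1)] \<delta>_pos \<theta>_pos \<epsilon>_pos pp by (intro mult_left_mono mult_right_mono) auto
    finally have 2: "(\<Sum>w\<in>G. step_term t m x w) \<le> \<delta> * \<theta> * (\<epsilon> * c x * pot t m)" .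
    have "(\<Sum>w\<in>V - {x, x0}. step_term t m x w) \<le> (\<theta> + \<delta> * \<theta>) * (\<epsilon> * c x * pot t m)"
      unfolding split \<open>S = {}\<close> using 1 2 by (simp add: distrib_right)
    also have "\<dots> \<le> \<Lambda> * (\<epsilon> * c x * pot (Suc t) m)"
    proof (rule mult_mono[OF \<Lambda>1])
      show "\<epsilon> * c x * pot t m \<le> \<epsilon> * c x * pot (Suc t) m"
        using le \<epsilon>_pos c_ge[OF x(1)] by (intro mult_left_mono) auto
      show "0 \<le> \<Lambda>" using \<Lambda>1 \<theta>_pos \<delta>_pos mult_pos_pos[of \<delta> \<theta>] by linarith
      show "0 \<le> \<epsilon> * c x * pot t m"
        using pp \<epsilon>_pos c_ge[OF x(1)] by (intro mult_nonneg_nonneg) auto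
    qed
    finally show ?thesis using True by (simp add: mode_factor_def)
  next
    case False
    have "(\<Sum>w\<in>F. step_term t m x w) \<le> \<epsilon> * \<theta>\<^sup>2 * c x * (pot t m * (R * Em / \<theta>))"
    proof (rule sum_fresh_le[OF x(1)])
      show "m x w = 0 \<and> degree_in V m w = 0 \<and> pot t (traverse m x w) \<le> pot t m * (R * Em / \<theta>)"
        if "w \<in> F" for w using that x(1) tT pot_traverse_new(3)[OF adm x(1)] by (auto simp: F_def)
    qed (use pp RE \<theta>_pos in \<open>auto simp: F_def\<close>)
    also have "\<dots> = (\<epsilon> * c x * (R * Em)) * (\<theta> * pot t m)" using \<theta>_pos by (simp add: power2_eq_square)
    also have "\<dots> \<le> (\<delta> / 2) * (\<theta> * pot t m)"
    proof (rule mult_right_mono)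
      have "\<epsilon> * c x * (R * Em) \<le> \<epsilon> * cmax * (R * Em)"
        using c_le[OF x(1)] \<epsilon>_pos RE by (intro mult_right_mono mult_left_mono) auto
      then show "\<epsilon> * c x * (R * Em) \<le> \<delta> / 2" using small_departure by linarith
    qed (use \<theta>_pos pp in auto)
    finally have 1: "(\<Sum>w\<in>F. step_term t m x w) \<le> \<delta> / 2 * (\<theta> * pot t m)" .
    have "(\<Sum>w\<in>G. step_term t m x w) \<le> 2 * real T * q * (pot t m * ((R * Em)\<^sup>2 / \<theta>))"
    proof (rule sum_return_le[OF adm x(1)])
      show "m x w = 0 \<and> degree_in V m w \<noteq> 0 \<and> pot t (traverse m x w) \<le> pot t m * ((R * Em)\<^sup>2 / \<theta>)"
        if "w \<in> G" for w using that x(1) tT pot_traverse_new(1)[OF adm x(1)] by (auto simp: G_def)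
    qed (use pp RE \<theta>_pos in \<open>auto simp: G_def\<close>)
    also have "\<dots> = (2 * real T * q * (R * Em)\<^sup>2) * (pot t m / \<theta>)" by simp
    also have "\<dots> \<le> (\<delta> / 2 * \<theta>\<^sup>2) * (pot t m / \<theta>)"
      using small_excess pp \<theta>_pos by (intro mult_right_mono) auto
    also have "\<dots> = \<delta> / 2 * (\<theta> * pot t m)" using \<theta>_pos by (simp add: power2_eq_square)
    finally have 2: "(\<Sum>w\<in>G. step_term t m x w) \<le> \<delta> / 2 * (\<theta> * pot t m)" .
    let ?k = "if m x x0 \<noteq> 0 then 1 else 2 :: real"
    have "(\<Sum>w\<in>F. step_term t m x w) + (\<Sum>w\<in>G. step_term t m x w) \<le> \<delta> * \<theta> * pot t m"
      using 1 2 by (simp add: field_simps)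
    also have "\<dots> \<le> \<delta> * \<theta> * pot (Suc t) m" using le \<delta>_pos \<theta>_pos by (intro mult_left_mono) auto
    also have "\<dots> \<le> ?k * (\<delta> * \<theta> * pot (Suc t) m)"
      using \<delta>_pos \<theta>_pos pp by (auto intro!: mult_nonneg_nonneg)
    finally have 3: "(\<Sum>w\<in>F. step_term t m x w) + (\<Sum>w\<in>G. step_term t m x w) \<le> ?k * (\<delta> * \<theta> * pot (Suc t) m)" .
    have 4: "(\<Sum>w\<in>S. step_term t m x w) \<le> ?k * max \<theta> (\<theta> / 2 + (2 + 1 / \<mu>)) * pot (Suc t) m"
      by (rule sum_old_le[OF sym x S_def])
    have "(\<Sum>w\<in>V - {x, x0}. step_term t m x w) \<le>
        ?k * ((\<delta> * \<theta> + max \<theta> (\<theta> / 2 + (2 + 1 / \<mu>))) * pot (Suc t) m)"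
      unfolding split using 3 4 by (simp only: distrib_left distrib_right mult.assoc)
    also have "\<dots> \<le> ?k * (\<Lambda> * pot (Suc t) m)"
      using \<Lambda>1 \<Lambda>2 pp by (intro mult_left_mono mult_right_mono) auto
    finally show ?thesis using False by (simp add: mode_factor_def mult_ac)
  qed
qed

lemma admissible_step:
  assumes adm: "admissible (Suc t) m x0 x fr" and x: "x \<in> V" "w \<in> V" "x \<noteq> w"
  shows "admissible t (traverse m x w) x w (degree_in V m w = 0)" and "traverse m x w w x \<noteq> 0"
proof -
  have sym: "m u v = m v u" for u v using adm by (simp add: admissible_def)
  have "(\<Sum>u\<in>V. degree_in V (traverse m x w) u) \<le> (\<Sum>u\<in>V. degree_in V m u) + 2"
    using sum_degree_traverse[OF fin x(2,1,3)] .
  moreover have "traverse m x w w v = 0" if "degree_in V m w = 0" "v \<in> V" "v \<noteq> x" for v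
  proof -
    have "m w v = 0" using degree_pos[OF fin, of v m w] that by auto
    then show ?thesis using that x by (auto simp: traverse_def)
  qed
  moreover have "traverse m x w u v = traverse m x w v u" for u v
    by (rule traverse_sym) (rule sym)
  moreover have "(\<Sum>u\<in>V. degree_in V m u) + 2 * Suc t \<le> 2 * T"
    using adm unfolding admissible_def by blast
  ultimately show "admissible t (traverse m x w) x w (degree_in V m w = 0)"
    unfolding admissible_def by (intro conjI allI impI ballI) auto
  show "traverse m x w w x \<noteq> 0" by (simp add: traverse_def)
qed

text \<open>The weighted potential is a supermartingale up to \<open>\<Lambda>\<close> per step. The
  factor 2 does not accumulate, because after the first step the edge just used is always
  explored.\<close>

lemma walk_sum_le:
  assumes "admissible (t + l) m x0 x fr" "x \<in> V" "x0 \<in> V"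
  shows "(\<Sum>ws\<in>walks V l. walk_weight P m x0 x ws *
      (mode_factor (at_frontier V m fr x ws) (last (x # ws)) * pot t (traverse_walk m x ws)))
    \<le> (if fr \<or> m x x0 \<noteq> 0 then 1 else 2) * \<Lambda> ^ l * (mode_factor fr x * pot (t + l) m)"
  using assms
proof (induction l arbitrary: m x0 x fr)
  case 0
  have "0 \<le> mode_factor fr x * pot t m"
    using 0 \<epsilon>_pos c_ge[of x] pot_pos[of t m] by (auto simp: mode_factor_def)
  then show ?case using 0 by (cases fr) auto
next
  case (Suc l)
  have \<Lambda>: "\<Lambda> \<ge> 0" using \<Lambda>1 \<theta>_pos \<delta>_pos mult_pos_pos[of \<delta> \<theta>] by linarith
  have adm: "admissible (Suc (t + l)) m x0 x fr" using Suc.prems by simp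
  define inner where "inner w = (\<Sum>ws\<in>walks V l. walk_weight P (traverse m x w) x w ws *
      (mode_factor (at_frontier V (traverse m x w) (degree_in V m w = 0) w ws) (last (w # ws)) *
       pot t (traverse_walk (traverse m x w) w ws)))" for w
  have "(\<Sum>ws\<in>walks V (Suc l). walk_weight P m x0 x ws *
      (mode_factor (at_frontier V m fr x ws) (last (x # ws)) * pot t (traverse_walk m x ws)))
    = (\<Sum>w\<in>V. (if w = x0 \<or> w = x then 0 else if m x w = 0 then P x w else 1) * inner w)"
    unfolding sum_walks_Suc[OF fin] inner_def
    by (intro sum.cong refl, subst sum_distrib_left, intro sum.cong) auto
  also have "\<dots> = (\<Sum>w\<in>V - {x, x0}. (if w = x0 \<or> w = x then 0 else if m x w = 0 then P x w else 1) * inner w)"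
    by (rule sum.mono_neutral_right) (use fin in auto)
  also have "\<dots> = (\<Sum>w\<in>V - {x, x0}. (if m x w = 0 then P x w else 1) * inner w)"
    by (intro sum.cong) auto
  also have "\<dots> \<le> (\<Sum>w\<in>V - {x, x0}. (if m x w = 0 then P x w else 1) *
      (\<Lambda> ^ l * (mode_factor (degree_in V m w = 0) w * pot (t + l) (traverse m x w))))"
  proof (intro sum_mono mult_left_mono)
    fix w assume w: "w \<in> V - {x, x0}"
    then have w': "w \<in> V" "x \<noteq> w" by auto
    note step = admissible_step[OF adm Suc.prems(2) w']
    show "inner w \<le> \<Lambda> ^ l * (mode_factor (degree_in V m w = 0) w * pot (t + l) (traverse m x w))"
      using Suc.IH[OF step(1) w'(1) Suc.prems(2)] step(2) by (simp add: inner_def)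
    show "0 \<le> (if m x w = 0 then P x w else 1)"
      using P_nonneg[OF Suc.prems(2) w'(1)] by simp
  qed
  also have "\<dots> = \<Lambda> ^ l * (\<Sum>w\<in>V - {x, x0}. step_term (t + l) m x w)"
    unfolding step_term_def sum_distrib_left by (intro sum.cong) auto
  also have "\<dots> \<le> \<Lambda> ^ l * ((if fr \<or> m x x0 \<noteq> 0 then 1 else 2) * \<Lambda> * (mode_factor fr x * pot (Suc (t + l)) m))"
    using \<Lambda> by (intro mult_left_mono step_sum_le[OF adm Suc.prems(2,3)]) auto
  finally show ?case by (simp add: mult_ac)
qed

end

text \<open>The edge by which the last vertex was discovered has been traversed only once. Hence
  walks that leave no open edge end away from the frontier and owe no factor
  \<open>\<epsilon>\<close> at the end.\<close>

lemma at_frontier_open: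
  assumes "at_frontier V m fr x ws" "\<And>u v. m u v = m v u" "set ws \<subseteq> V" "x \<in> V" "finite V"
    "walk_weight P m x0 x ws \<noteq> 0" "fr \<Longrightarrow> \<exists>u\<in>V. m u x = 1"
  shows "\<exists>u\<in>V. \<exists>v\<in>V. traverse_walk m x ws u v = 1"
  using assms
proof (induction ws arbitrary: m fr x x0)
  case Nil
  then show ?case by auto
next
  case (Cons w ws)
  have wx: "w \<noteq> x" using Cons.prems by auto
  have "\<exists>u\<in>V. traverse m x w u w = 1" if "degree_in V m w = 0"
  proof
    have "m w x = 0" using degree_pos[of V x m w] Cons.prems that by auto
    then show "traverse m x w x w = 1" using Cons.prems(2)[of x w] by (simp add: traverse_def)
    show "x \<in> V" using Cons.prems by simp
  qed
  moreover have "at_frontier V (traverse m x w) (degree_in V m w = 0) w ws"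
    "walk_weight P (traverse m x w) x w ws \<noteq> 0"
    using Cons.prems by (auto split: if_splits)
  moreover have "traverse m x w u v = traverse m x w v u" for u v
    by (rule traverse_sym) (rule Cons.prems(2))
  ultimately have "\<exists>u\<in>V. \<exists>v\<in>V. traverse_walk (traverse m x w) w ws u v = 1"
    using Cons.prems(3,5) by (intro Cons.IH[where fr = "degree_in V m w = 0" and ?x0.0 = x]) auto
  then show ?case by simp
qed

section \<open>Pairs of walks\<close>

context walk_counting
begin

text \<open>The arguments \<open>y y\<close> are placeholders: with the flag \<open>False\<close>,
  admissibility does not depend on the position of the walk.\<close>

lemma admissible_walk:
  assumes "admissible (t + l) m x0 x fr" "x \<in> V" "ws \<in> walks V l" "walk_weight P m x0 x ws \<noteq> 0"
  shows "admissible t (traverse_walk m x ws) y y False"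
  using assms
proof (induction l arbitrary: m x0 x fr ws)
  case 0
  then show ?case unfolding admissible_def by (simp add: walks_def)
next
  case (Suc l)
  obtain w ws' where ws: "ws = w # ws'" "w \<in> V" "ws' \<in> walks V l"
    using Suc.prems(3) by (auto simp: walks_def length_Suc_conv)
  have adm: "admissible (Suc (t + l)) m x0 x fr" using Suc.prems by simp
  have "x \<noteq> w" using Suc.prems(4) ws by auto
  from Suc.IH[OF admissible_step(1)[OF adm Suc.prems(2) ws(2) this] ws(2,3)] Suc.prems(4) ws
  show ?case by (auto split: if_splits)
qed

lemma walk_weight_nonneg:
  assumes "x \<in> V" "set ws \<subseteq> V"
  shows "walk_weight P m x0 x ws \<ge> 0"
  using assms by (induction ws arbitrary: m x0 x) (auto intro!: mult_nonneg_nonneg P_nonneg)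

lemma second_walk_sum_le:
  assumes adm: "admissible l m y y False" and x: "x \<in> V" "y \<in> V"
  shows "(\<Sum>ys\<in>walks V l. walk_weight P m x y ys * of_bool (no_open_edge V (traverse_walk m y ys)))
    \<le> 2 * \<Lambda> ^ l * pot l m"
proof -
  have \<Lambda>: "\<Lambda> \<ge> 0" using \<Lambda>1 \<theta>_pos \<delta>_pos mult_pos_pos[of \<delta> \<theta>] by linarith
  have adm': "admissible (0 + l) m x y False" using adm by (simp add: admissible_def)
  have sym: "m u v = m v u" for u v using adm unfolding admissible_def by blast
  have "(\<Sum>ys\<in>walks V l. walk_weight P m x y ys * of_bool (no_open_edge V (traverse_walk m y ys)))
    \<le> (\<Sum>ys\<in>walks V l. walk_weight P m x y ys *
      (mode_factor (at_frontier V m False y ys) (last (y # ys)) * pot 0 (traverse_walk m y ys)))"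
  proof (rule sum_mono)
    fix ys assume ys: "ys \<in> walks V l"
    then have sub: "set ys \<subseteq> V" by (simp add: walks_def)
    define w where "w = walk_weight P m x y ys"
    define M where "M = traverse_walk m y ys"
    define b where "b = at_frontier V m False y ys"
    define z where "z = last (y # ys)"
    have z: "z \<in> V" using sub x by (auto simp: z_def)
    have w: "w \<ge> 0" unfolding w_def using walk_weight_nonneg[OF x(2) sub] .
    have mf: "mode_factor b z \<ge> 0" using c_ge[OF z] \<epsilon>_pos by (simp add: mode_factor_def)
    have pot0: "pot 0 M \<ge> 0" using pot_pos[of 0 M] by simp
    have "w * of_bool (no_open_edge V M) \<le> w * (mode_factor b z * pot 0 M)"
    proof (cases "w \<noteq> 0 \<and> no_open_edge V M")
      case False
      then have "w * of_bool (no_open_edge V M) = 0" by auto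
      moreover have "0 \<le> w * (mode_factor b z * pot 0 M)"
        using w mf pot0 by (intro mult_nonneg_nonneg)
      ultimately show ?thesis by (cases "no_open_edge V M") auto
    next
      case True
      have "\<exists>u\<in>V. \<exists>v\<in>V. M u v = 1" if b
        unfolding M_def
        by (rule at_frontier_open[OF that[unfolded b_def] sym sub x(2) fin]) (use True w_def in auto)
      then have "\<not> b" using True by (auto simp: no_open_edge_def)
      moreover have "open_degree V M u = 0" if "u \<in> V" for u
      proof -
        have e: "{v \<in> V. M u v = 1} = {}" using True that by (auto simp: no_open_edge_def)
        show ?thesis unfolding open_degree_def e by simp
      qed
      \<comment> \<open>At time 0 the base \<open>exp (\<mu> * 0)\<close> is 1, and without open
        edges every other factor is 1 too. So the indicator is dominated by the potential that
        \<open>walk_sum_le\<close> controls.\<close>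
      then have "pot 0 M = 1"
        unfolding pot_def potential_def by (intro prod.neutral ballI) (simp add: vertex_potential_def)
      ultimately show ?thesis using True by (simp add: mode_factor_def)
    qed
    then show "walk_weight P m x y ys * of_bool (no_open_edge V (traverse_walk m y ys))
        \<le> walk_weight P m x y ys *
          (mode_factor (at_frontier V m False y ys) (last (y # ys)) * pot 0 (traverse_walk m y ys))"
      by (simp only: w_def M_def b_def z_def)
  qed
  also have "\<dots> \<le> (if False \<or> m y x \<noteq> 0 then 1 else 2) * \<Lambda> ^ l * (mode_factor False y * pot (0 + l) m)"
    by (rule walk_sum_le[OF adm' x(2,1)])
  also have "\<dots> \<le> 2 * \<Lambda> ^ l * pot l m"
    using \<Lambda> pot_pos[of l m] by (auto simp: mode_factor_def)
  finally show ?thesis .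
qed

text \<open>
  For independent centred entries, only pairs of walks without an open edge have a nonzero
  expectation. The second walk resumes at \<open>y\<close> on the graph explored by the first one.
\<close>

theorem closed_walk_pair_sum_le:
  assumes x: "x \<in> V" "y \<in> V" and T: "T = 2 * l"
  shows "(\<Sum>xs\<in>walks V l. \<Sum>ys\<in>walks V l.
      walk_weight P (\<lambda>_ _. 0) x y xs *
      (walk_weight P (traverse_walk (\<lambda>_ _. 0) y xs) x y ys *
       of_bool (no_open_edge V (traverse_walk (traverse_walk (\<lambda>_ _. 0) y xs) y ys))))
    \<le> 2 * cmax * \<Lambda> ^ (2 * l)"
proof -
  define o0 :: "'v \<Rightarrow> 'v \<Rightarrow> nat" where "o0 = (\<lambda>_ _. 0)"
  have \<Lambda>: "\<Lambda> \<ge> 0" using \<Lambda>1 \<theta>_pos \<delta>_pos mult_pos_pos[of \<delta> \<theta>] by linarith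
  have adm0: "admissible (l + l) o0 x y True"
    unfolding admissible_def degree_in_def o0_def using T by simp
  have pot0: "pot t o0 = 1" for t
    by (simp add: o0_def pot_def potential_def vertex_potential_def degree_in_def open_degree_def)
  have K: "0 \<le> 2 * \<Lambda> ^ l / \<epsilon>"
    using \<Lambda> \<epsilon>_pos by (intro divide_nonneg_nonneg mult_nonneg_nonneg zero_le_power) auto
  define Z where "Z xs = walk_weight P o0 x y xs *
       (mode_factor (at_frontier V o0 True y xs) (last (y # xs)) * pot l (traverse_walk o0 y xs))" for xs
  have Z: "sum Z (walks V l) \<le> \<Lambda> ^ l * (\<epsilon> * c y)"
    using walk_sum_le[OF adm0 x(2,1)] by (simp add: Z_def mode_factor_def pot0)
  have "(\<Sum>xs\<in>walks V l. \<Sum>ys\<in>walks V l. walk_weight P o0 x y xs * (walk_weight P (traverse_walk o0 y xs) x y ys *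
       of_bool (no_open_edge V (traverse_walk (traverse_walk o0 y xs) y ys))))
    \<le> (\<Sum>xs\<in>walks V l. 2 * \<Lambda> ^ l / \<epsilon> * Z xs)"
  proof (rule sum_mono)
    fix xs assume xs: "xs \<in> walks V l"
    then have sub: "set xs \<subseteq> V" by (simp add: walks_def)
    define w where "w = walk_weight P o0 x y xs"
    define m where "m = traverse_walk o0 y xs"
    define f where "f = mode_factor (at_frontier V o0 True y xs) (last (y # xs))"
    have w: "w \<ge> 0" unfolding w_def using walk_weight_nonneg[OF x(2) sub] .
    have "last (y # xs) \<in> V" using sub x by auto
    then have "\<epsilon> * 1 \<le> \<epsilon> * c (last (y # xs))" using \<epsilon>_pos c_ge by (intro mult_left_mono) auto
    \<comment> \<open>The first walk may end at the frontier, so only \<open>\<epsilon>\<close> is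
      guaranteed. The resulting division by \<open>\<epsilon>\<close> is cancelled by the factor
      \<open>\<epsilon> * c y\<close> with which this walk starts.\<close>
    then have mf: "f \<ge> \<epsilon>"
      using \<epsilon>_le by (simp add: mode_factor_def f_def)
    have "(\<Sum>ys\<in>walks V l. w * (walk_weight P m x y ys * of_bool (no_open_edge V (traverse_walk m y ys))))
      \<le> 2 * \<Lambda> ^ l / \<epsilon> * (w * (f * pot l m))"
    proof (cases "w = 0")
      case True
      then show ?thesis by simp
    next
      case False
      have adm: "admissible l m y y False"
        unfolding m_def using admissible_walk[OF adm0 x(2) xs] False w_def by simp
      have "(\<Sum>ys\<in>walks V l. w * (walk_weight P m x y ys * of_bool (no_open_edge V (traverse_walk m y ys))))
          \<le> w * (2 * \<Lambda> ^ l * pot l m)"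
        unfolding sum_distrib_left[symmetric] by (rule mult_left_mono[OF second_walk_sum_le[OF adm x] w])
      also have "\<dots> = 2 * \<Lambda> ^ l / \<epsilon> * (w * (\<epsilon> * pot l m))" using \<epsilon>_pos by simp
      also have "\<dots> \<le> 2 * \<Lambda> ^ l / \<epsilon> * (w * (f * pot l m))"
        by (intro mult_left_mono mult_right_mono mf w K less_imp_le[OF pot_pos])
      finally show ?thesis .
    qed
    then show "(\<Sum>ys\<in>walks V l. walk_weight P o0 x y xs * (walk_weight P (traverse_walk o0 y xs) x y ys *
        of_bool (no_open_edge V (traverse_walk (traverse_walk o0 y xs) y ys)))) \<le> 2 * \<Lambda> ^ l / \<epsilon> * Z xs"
      by (simp only: Z_def w_def m_def f_def)
  qed
  also have "\<dots> = 2 * \<Lambda> ^ l / \<epsilon> * sum Z (walks V l)"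
    by (rule sum_distrib_left[symmetric])
  also have "\<dots> \<le> 2 * \<Lambda> ^ l / \<epsilon> * (\<Lambda> ^ l * (\<epsilon> * c y))"
    by (rule mult_left_mono[OF Z K])
  also have "\<dots> = 2 * c y * \<Lambda> ^ (2 * l)"
    unfolding mult_2[of l] power_add using \<epsilon>_pos by (simp add: field_simps)
  also have "\<dots> \<le> 2 * cmax * \<Lambda> ^ (2 * l)"
    using c_le[OF x(2)] \<Lambda> by (intro mult_right_mono) auto
  finally show ?thesis unfolding o0_def .
qed

end

section \<open>The quadratic form of a non-backtracking matrix\<close>

definition quad_form :: "'v set \<Rightarrow> ('v \<Rightarrow> 'v \<Rightarrow> real) \<Rightarrow> ('v \<Rightarrow> real) \<Rightarrow> real" where
  "quad_form V A z = (\<Sum>x\<in>V. \<Sum>y\<in>V. A x y * z x * z y)"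

lemma quad_form_cong: "(\<And>x. x \<in> V \<Longrightarrow> z x = z' x) \<Longrightarrow> quad_form V A z = quad_form V A z'"
  by (simp add: quad_form_def)

lemma quad_form_scale: "quad_form V A (\<lambda>x. r * z x) = r\<^sup>2 * quad_form V A z"
  by (simp add: quad_form_def sum_distrib_left power2_eq_square mult_ac)

lemma quad_form_add:
  assumes sym: "\<And>x y. A x y = A y x"
  shows "quad_form V A (\<lambda>x. z x + r * u x) =
    quad_form V A z + 2 * r * (\<Sum>x\<in>V. u x * (\<Sum>y\<in>V. A x y * z y)) + r\<^sup>2 * quad_form V A u"
proof -
  have e: "A x y * (z x + r * u x) * (z y + r * u y) =
     A x y * z x * z y + r * (u x * (A x y * z y)) + r * (u y * (A x y * z x)) + r\<^sup>2 * (A x y * u x * u y)"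
    for x y by (simp add: algebra_simps power2_eq_square)
  have s: "(\<Sum>x\<in>V. \<Sum>y\<in>V. u y * (A x y * z x)) = (\<Sum>x\<in>V. \<Sum>y\<in>V. u x * (A x y * z y))"
    by (subst sum.swap) (intro sum.cong refl, metis sym)
  have "quad_form V A (\<lambda>x. z x + r * u x) = quad_form V A z + r * (\<Sum>x\<in>V. \<Sum>y\<in>V. u x * (A x y * z y))
      + r * (\<Sum>x\<in>V. \<Sum>y\<in>V. u y * (A x y * z x)) + r\<^sup>2 * quad_form V A u"
    unfolding quad_form_def e sum.distrib by (simp only: sum_distrib_left)
  then show ?thesis unfolding s by (simp add: sum_distrib_left algebra_simps)
qed

lemma linear_coeff_zero:
  fixes b c :: real
  assumes "\<And>r. 0 \<le> 2 * r * b + r\<^sup>2 * c"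
  shows "b = 0"
proof (rule ccontr)
  assume b: "b \<noteq> 0"
  define d where "d = \<bar>c\<bar> + 1"
  have d: "d > 0" "c \<le> d" by (auto simp: d_def)
  have "0 \<le> 2 * (- b / d) * b + (- b / d)\<^sup>2 * c" by (rule assms)
  also have "\<dots> \<le> 2 * (- b / d) * b + (- b / d)\<^sup>2 * d"
    using d by (intro add_left_mono mult_left_mono) auto
  also have "\<dots> = - (b\<^sup>2 / d)" using d by (simp add: field_simps power2_eq_square)
  also have "\<dots> < 0" using b d by simp
  finally show False by simp
qed

text \<open>At a minimum of the form its first variation vanishes in every coordinate
  direction.\<close>

lemma psd_null_vector:
  assumes fin: "finite V" and sym: "\<And>x y. A x y = A y x"
    and psd: "\<And>z. 0 \<le> quad_form V A z" and z: "quad_form V A z \<le> 0" and x: "x \<in> V"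
  shows "(\<Sum>y\<in>V. A x y * z y) = 0"
proof (rule linear_coeff_zero)
  fix r :: real
  define u where "u = (\<lambda>y. if y = x then 1 else 0 :: real)"
  have "(\<Sum>y\<in>V. u y * (\<Sum>w\<in>V. A y w * z w)) = (\<Sum>w\<in>V. A x w * z w)"
    using fin x by (simp add: u_def if_distrib[of "\<lambda>c. c * _"] cong: if_cong)
  with quad_form_add[where A = A and V = V and z = z and r = r and u = u, OF sym] psd[of "\<lambda>y. z y + r * u y"] z
  show "0 \<le> 2 * r * (\<Sum>y\<in>V. A x y * z y) + r\<^sup>2 * quad_form V A u"
    by (simp only:)
qed

text \<open>Vectors are functions on the whole vertex type; requiring the value 0 outside
  \<open>V\<close> makes the sphere a closed subset of a product of compact intervals and
  points.\<close>

lemma compact_unit_sphere_fun: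
  fixes V :: "'v set"
  assumes fin: "finite V"
  shows "compact {z :: 'v \<Rightarrow> real. (\<forall>x. x \<notin> V \<longrightarrow> z x = 0) \<and> (\<Sum>x\<in>V. (z x)\<^sup>2) = 1}"
proof -
  let ?B = "PiE UNIV (\<lambda>x. if x \<in> V then {-1..1} else {0 :: real})"
  let ?S = "{z :: 'v \<Rightarrow> real. (\<forall>x. x \<notin> V \<longrightarrow> z x = 0) \<and> (\<Sum>x\<in>V. (z x)\<^sup>2) = 1}"
  have "compactin (product_topology (\<lambda>i. euclidean) UNIV) ?B"
    unfolding compactin_PiE by (auto simp: compactin_euclidean_iff)
  then have cB: "compact ?B"
    by (simp add: euclidean_product_topology compactin_euclidean_iff)
  have cont: "continuous_on UNIV (\<lambda>z :: 'v \<Rightarrow> real. \<Sum>x\<in>V. (z x)\<^sup>2)"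
    by (intro continuous_intros continuous_on_product_coordinates)
  have "closed {z :: 'v \<Rightarrow> real. (\<Sum>x\<in>V. (z x)\<^sup>2) = 1}"
    using continuous_closed_preimage_constant[OF cont closed_UNIV, of 1] by simp
  then have "compact (?B \<inter> {z. (\<Sum>x\<in>V. (z x)\<^sup>2) = 1})" using cB by (rule compact_Int_closed[rotated])
  moreover have "?B \<inter> {z. (\<Sum>x\<in>V. (z x)\<^sup>2) = 1} = ?S"
  proof (intro equalityI subsetI)
    fix z assume z: "z \<in> ?S"
    have "z x \<in> {-1..1}" if "x \<in> V" for x
    proof -
      have "(z x)\<^sup>2 \<le> (\<Sum>x\<in>V. (z x)\<^sup>2)" using fin that by (intro member_le_sum) auto
      then have "(z x)\<^sup>2 \<le> 1" using z by simp
      then have "\<bar>z x\<bar> \<le> 1" using abs_square_le_1 by blast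
      then show ?thesis by auto
    qed
    then show "z \<in> ?B \<inter> {z. (\<Sum>x\<in>V. (z x)\<^sup>2) = 1}" using z by (auto simp: PiE_def Pi_def)
  next
    fix z assume "z \<in> ?B \<inter> {z. (\<Sum>x\<in>V. (z x)\<^sup>2) = 1}"
    then show "z \<in> ?S" by (auto simp: PiE_def Pi_def split: if_splits)
  qed
  ultimately show ?thesis by simp
qed

lemma quad_form_nonneg_of_sphere:
  assumes fin: "finite V"
    and *: "\<And>z. (\<forall>x. x \<notin> V \<longrightarrow> z x = 0) \<Longrightarrow> (\<Sum>x\<in>V. (z x)\<^sup>2) = 1 \<Longrightarrow> 0 \<le> quad_form V A z"
  shows "0 \<le> quad_form V A z"
proof (cases "(\<Sum>x\<in>V. (z x)\<^sup>2) = 0")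
  case True
  then have "z x = 0" if "x \<in> V" for x
    using that fin by (subst (asm) sum_nonneg_eq_0_iff) auto
  then have "quad_form V A z = 0" by (simp add: quad_form_def)
  then show ?thesis by simp
next
  case False
  define r where "r = sqrt (\<Sum>x\<in>V. (z x)\<^sup>2)"
  have "(\<Sum>x\<in>V. (z x)\<^sup>2) \<ge> 0" by (intro sum_nonneg) auto
  then have r: "r > 0" "r\<^sup>2 = (\<Sum>x\<in>V. (z x)\<^sup>2)" using False by (auto simp: r_def)
  define u where "u x = (if x \<in> V then z x / r else 0)" for x
  have "(\<Sum>x\<in>V. (u x)\<^sup>2) = (\<Sum>x\<in>V. (z x)\<^sup>2) / r\<^sup>2"
    by (simp add: u_def power_divide sum_divide_distrib)
  also have "\<dots> = 1" unfolding r(2)[symmetric] using r(1) by simp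
  finally have "0 \<le> quad_form V A u" by (intro *) (auto simp: u_def)
  then have "0 \<le> quad_form V A (\<lambda>x. r * u x)" by (simp add: quad_form_scale)
  also have "\<dots> = quad_form V A z" using r by (intro quad_form_cong) (simp add: u_def)
  finally show ?thesis .
qed

text \<open>
  As the parameter decreases from \<open>b\<close>, positivity can only be lost at a parameter where the form
  has a null vector.
\<close>

lemma psd_of_no_null_vector:
  fixes A :: "real \<Rightarrow> 'v \<Rightarrow> 'v \<Rightarrow> real"
  assumes fin: "finite V" and sym: "\<And>l x y. A l x y = A l y x" and ab: "a \<le> b"
    and cont: "\<And>x y. continuous_on {a..b} (\<lambda>l. A l x y)"
    and pos: "\<And>z. (\<Sum>x\<in>V. (z x)\<^sup>2) = 1 \<Longrightarrow> 0 < quad_form V (A b) z"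
    and no_null: "\<And>l z. l \<in> {a..b} \<Longrightarrow> (\<And>x. x \<in> V \<Longrightarrow> (\<Sum>y\<in>V. A l x y * z y) = 0) \<Longrightarrow> \<forall>x\<in>V. z x = 0"
  shows "0 \<le> quad_form V (A a) z"
proof (rule ccontr)
  assume neg: "\<not> 0 \<le> quad_form V (A a) z"
  define S where "S = {z :: 'v \<Rightarrow> real. (\<forall>x. x \<notin> V \<longrightarrow> z x = 0) \<and> (\<Sum>x\<in>V. (z x)\<^sup>2) = 1}"
  define D where "D = {a..b} \<times> S"
  define K where "K = {p \<in> D. quad_form V (A (fst p)) (snd p) \<le> 0}"
  have cD: "compact D"
    unfolding D_def S_def by (intro compact_Times compact_unit_sphere_fun fin compact_Icc)
  have cA: "continuous_on D (\<lambda>p. A (fst p) x y)" for x y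
    by (rule continuous_on_compose2[OF cont[of x y]]) (auto simp: D_def intro!: continuous_intros)
  have cz: "continuous_on D (\<lambda>p. snd p x)" for x
    by (rule continuous_on_compose2[OF continuous_on_product_coordinates[of x]
        continuous_on_snd[OF continuous_on_id]]) simp
  have cq: "continuous_on D (\<lambda>p. quad_form V (A (fst p)) (snd p))"
    unfolding quad_form_def by (intro continuous_intros cA cz)
  have cK: "compact K"
  proof -
    have "closedin (top_of_set D) (D \<inter> (\<lambda>p. quad_form V (A (fst p)) (snd p)) -` {..0})"
      by (intro continuous_closedin_preimage cq) auto
    moreover have "D \<inter> (\<lambda>p. quad_form V (A (fst p)) (snd p)) -` {..0} = K"
      by (auto simp: K_def)
    ultimately show ?thesis using closedin_compact[OF cD] by simp
  qed
  have neK: "K \<noteq> {}"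
  proof
    assume "K = {}"
    then have "0 \<le> quad_form V (A a) u" if "(\<forall>x. x \<notin> V \<longrightarrow> u x = 0)" "(\<Sum>x\<in>V. (u x)\<^sup>2) = 1" for u
    proof -
      have "(a, u) \<in> D" using that ab by (simp add: D_def S_def)
      moreover have "(a, u) \<notin> K" using \<open>K = {}\<close> by simp
      ultimately show ?thesis by (simp add: K_def)
    qed
    then have "0 \<le> quad_form V (A a) z"
      by (rule quad_form_nonneg_of_sphere[OF fin])
    with neg show False ..
  qed
  \<comment> \<open>The largest parameter at which some unit vector gives a nonpositive value. Above
    it the form is nonnegative, hence by right-continuity also at it, and the vector found there is
    a null vector.\<close>
  obtain p where p: "p \<in> K" "\<And>q. q \<in> K \<Longrightarrow> fst q \<le> fst p"
    using continuous_attains_sup[OF cK neK continuous_on_fst[OF continuous_on_id]] by blast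
  obtain l u where lu: "p = (l, u)" by (cases p)
  have l: "l \<in> {a..b}" and u: "(\<Sum>x\<in>V. (u x)\<^sup>2) = 1" and qu: "quad_form V (A l) u \<le> 0"
    using p(1) lu by (auto simp: K_def D_def S_def)
  have "l \<noteq> b" using pos[OF u] qu by auto
  then have lb: "l < b" using l by auto
  have psd: "0 \<le> quad_form V (A l) w" for w
  proof (rule quad_form_nonneg_of_sphere[OF fin])
    fix w :: "'v \<Rightarrow> real" assume w: "\<forall>x. x \<notin> V \<longrightarrow> w x = 0" "(\<Sum>x\<in>V. (w x)\<^sup>2) = 1"
    have gt: "0 \<le> quad_form V (A t) w" if "l < t" "t \<le> b" for t
    proof (rule ccontr)
      assume "\<not> 0 \<le> quad_form V (A t) w"
      then have "(t, w) \<in> K" using that w l by (auto simp: K_def D_def S_def)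
      then show False using p(2)[of "(t, w)"] lu that by simp
    qed
    have "continuous_on {a..b} (\<lambda>t. quad_form V (A t) w)"
      unfolding quad_form_def by (intro continuous_intros cont)
    then have "continuous_on {l..b} (\<lambda>t. quad_form V (A t) w)"
      using l by (auto intro: continuous_on_subset)
    then have "((\<lambda>t. quad_form V (A t) w) \<longlongrightarrow> quad_form V (A l) w) (at_right l)"
      using lb by (rule continuous_on_Icc_at_rightD)
    moreover have "eventually (\<lambda>t. 0 \<le> quad_form V (A t) w) (at_right l)"
      using eventually_at_right_less[of l] eventually_at_right_real[OF lb]
      by eventually_elim (auto intro: gt)
    ultimately show "0 \<le> quad_form V (A l) w"
      by (rule tendsto_lowerbound) auto
  qed
  have "\<forall>x\<in>V. u x = 0"
    by (rule no_null[OF l], rule psd_null_vector[OF fin sym psd qu])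
  then show False using u by simp
qed

section \<open>Powers of the non-backtracking matrix\<close>

fun nb_weight :: "('v \<Rightarrow> 'v \<Rightarrow> real) \<Rightarrow> 'v \<Rightarrow> 'v \<Rightarrow> 'v list \<Rightarrow> real" where
  "nb_weight H x0 x [] = 1"
| "nb_weight H x0 x (w # ws) = (if w = x0 \<or> w = x then 0 else H x w * nb_weight H x w ws)"

fun last_edge :: "'v \<Rightarrow> 'v \<Rightarrow> 'v list \<Rightarrow> 'v \<times> 'v" where
  "last_edge x0 x [] = (x0, x)"
| "last_edge x0 x (w # ws) = last_edge x w ws"

text \<open>The squared Frobenius norm of the \<open>l\<close>-th power of the non-backtracking matrix of \<open>H\<close>.\<close>

definition nb_frobenius :: "'v set \<Rightarrow> ('v \<Rightarrow> 'v \<Rightarrow> real) \<Rightarrow> nat \<Rightarrow> real" where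
  "nb_frobenius V H l = (\<Sum>x\<in>V. \<Sum>y\<in>V. \<Sum>xs\<in>walks V l. \<Sum>ys\<in>walks V l.
     if last_edge x y xs = last_edge x y ys then nb_weight H x y xs * nb_weight H x y ys else 0)"

lemma last_edge_in: "x0 \<in> V \<Longrightarrow> x \<in> V \<Longrightarrow> set ws \<subseteq> V \<Longrightarrow> last_edge x0 x ws \<in> V \<times> V"
  by (induction ws arbitrary: x0 x) auto

lemma nb_eigenvector_iterate:
  assumes fin: "finite V" and diag: "\<And>x. H x x = 0"
    and ev: "\<And>x y. x \<in> V \<Longrightarrow> y \<in> V \<Longrightarrow> lam * e x y = (\<Sum>w\<in>V - {x}. H y w * e y w)"
    and "x \<in> V" "y \<in> V"
  shows "lam ^ l * e x y = (\<Sum>ws\<in>walks V l. nb_weight H x y ws * case_prod e (last_edge x y ws))"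
  using assms(4,5)
proof (induction l arbitrary: x y)
  case 0
  then show ?case by simp
next
  case (Suc l)
  have "lam ^ Suc l * e x y = lam ^ l * (\<Sum>w\<in>V - {x}. H y w * e y w)"
    unfolding power_Suc2 mult.assoc ev[OF Suc.prems] ..
  also have "\<dots> = (\<Sum>w\<in>V - {x}. H y w * (lam ^ l * e y w))"
    by (simp add: sum_distrib_left mult_ac)
  also have "\<dots> = (\<Sum>w\<in>V - {x}. \<Sum>ws\<in>walks V l. nb_weight H x y (w # ws) * case_prod e (last_edge x y (w # ws)))"
  proof (rule sum.cong[OF refl])
    fix w assume w: "w \<in> V - {x}"
    show "H y w * (lam ^ l * e y w) =
        (\<Sum>ws\<in>walks V l. nb_weight H x y (w # ws) * case_prod e (last_edge x y (w # ws)))"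
    proof (cases "w = y")
      case True
      then show ?thesis using diag by simp
    next
      case False
      have "lam ^ l * e y w = (\<Sum>ws\<in>walks V l. nb_weight H y w ws * case_prod e (last_edge y w ws))"
        using w Suc.prems by (intro Suc.IH) auto
      then show ?thesis using False w by (simp add: sum_distrib_left mult.assoc)
    qed
  qed
  also have "\<dots> = (\<Sum>w\<in>V. \<Sum>ws\<in>walks V l. nb_weight H x y (w # ws) * case_prod e (last_edge x y (w # ws)))"
    by (rule sum.mono_neutral_left) (use fin in auto)
  also have "\<dots> = (\<Sum>ws\<in>walks V (Suc l). nb_weight H x y ws * case_prod e (last_edge x y ws))"
    by (rule sum_walks_Suc[OF fin, symmetric])
  finally show ?case .
qed

lemma last_edge_in_walks:
  "x \<in> V \<Longrightarrow> y \<in> V \<Longrightarrow> ws \<in> walks V l \<Longrightarrow> last_edge x y ws \<in> V \<times> V"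
  using last_edge_in[of x V y ws] by (auto simp: walks_def)

text \<open>The entry of the \<open>l\<close>-th power of the non-backtracking matrix in row
  \<open>(x, y)\<close> and column \<open>f\<close>. All pairs of vertices serve as directed
  edges.\<close>

definition nb_entry :: "'v set \<Rightarrow> ('v \<Rightarrow> 'v \<Rightarrow> real) \<Rightarrow> nat \<Rightarrow> 'v \<Rightarrow> 'v \<Rightarrow> 'v \<times> 'v \<Rightarrow> real" where
  "nb_entry V H l x y f = (\<Sum>ws\<in>walks V l. if last_edge x y ws = f then nb_weight H x y ws else 0)"

lemma sum_nb_entry_sq:
  assumes fin: "finite V" and xy: "x \<in> V" "y \<in> V"
  shows "(\<Sum>f\<in>V \<times> V. (nb_entry V H l x y f)\<^sup>2) = (\<Sum>xs\<in>walks V l. \<Sum>ys\<in>walks V l.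
     if last_edge x y xs = last_edge x y ys then nb_weight H x y xs * nb_weight H x y ys else 0)"
proof -
  have finP: "finite (V \<times> V)" using fin by simp
  have "(\<Sum>f\<in>V \<times> V. (nb_entry V H l x y f)\<^sup>2) = (\<Sum>f\<in>V \<times> V. \<Sum>xs\<in>walks V l. \<Sum>ys\<in>walks V l.
    if last_edge x y ys = f then (if last_edge x y xs = f then nb_weight H x y xs * nb_weight H x y ys else 0) else 0)"
    unfolding nb_entry_def power2_eq_square sum_product
    by (rule sum.cong[OF refl], rule sum.cong[OF refl], rule sum.cong[OF refl]) simp
  also have "\<dots> = (\<Sum>xs\<in>walks V l. \<Sum>f\<in>V \<times> V. \<Sum>ys\<in>walks V l.
    if last_edge x y ys = f then (if last_edge x y xs = f then nb_weight H x y xs * nb_weight H x y ys else 0) else 0)"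
    by (rule sum.swap)
  also have "\<dots> = (\<Sum>xs\<in>walks V l. \<Sum>ys\<in>walks V l. \<Sum>f\<in>V \<times> V.
    if last_edge x y ys = f then (if last_edge x y xs = f then nb_weight H x y xs * nb_weight H x y ys else 0) else 0)"
    by (rule sum.cong[OF refl], rule sum.swap)
  also have "\<dots> = (\<Sum>xs\<in>walks V l. \<Sum>ys\<in>walks V l.
    if last_edge x y xs = last_edge x y ys then nb_weight H x y xs * nb_weight H x y ys else 0)"
    by (intro sum.cong refl) (simp only: sum.delta'[OF finP] last_edge_in_walks[OF xy] if_True)
  finally show ?thesis .
qed

lemma nb_frobenius_eq:
  assumes "finite V"
  shows "nb_frobenius V H l = (\<Sum>x\<in>V. \<Sum>y\<in>V. \<Sum>f\<in>V \<times> V. (nb_entry V H l x y f)\<^sup>2)"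
  unfolding nb_frobenius_def
  by (rule sum.cong[OF refl], rule sum.cong[OF refl], rule sum_nb_entry_sq[OF assms, symmetric])

lemma nb_frobenius_nonneg: "finite V \<Longrightarrow> 0 \<le> nb_frobenius V H l"
  unfolding nb_frobenius_eq by (intro sum_nonneg) auto

text \<open>Cauchy-Schwarz in each row of the \<open>l\<close>-th power, applied to a real
  eigenvector. This replaces a statement on the spectral radius: only real eigenvalues have to be
  excluded.\<close>

lemma nb_frobenius_ge:
  assumes fin: "finite V" and diag: "\<And>x. H x x = 0"
    and ev: "\<And>x y. x \<in> V \<Longrightarrow> y \<in> V \<Longrightarrow> lam * e x y = (\<Sum>w\<in>V - {x}. H y w * e y w)"
    and nz: "x0 \<in> V" "y0 \<in> V" "e x0 y0 \<noteq> 0"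
  shows "lam ^ (2 * l) \<le> nb_frobenius V H l"
proof -
  define E where "E = (\<Sum>f\<in>V \<times> V. (case_prod e f)\<^sup>2)"
  have finP: "finite (V \<times> V)" using fin by simp
  have it: "lam ^ l * e x y = (\<Sum>f\<in>V \<times> V. nb_entry V H l x y f * case_prod e f)" if xy: "x \<in> V" "y \<in> V" for x y
  proof -
    have "(\<Sum>f\<in>V \<times> V. nb_entry V H l x y f * case_prod e f) =
      (\<Sum>f\<in>V \<times> V. \<Sum>ws\<in>walks V l. if last_edge x y ws = f then nb_weight H x y ws * case_prod e f else 0)"
      unfolding nb_entry_def sum_distrib_right
      by (rule sum.cong[OF refl], rule sum.cong[OF refl]) (simp only: if_distrib[of "\<lambda>c. c * _"] mult_zero_left)
    also have "\<dots> = (\<Sum>ws\<in>walks V l. \<Sum>f\<in>V \<times> V. if last_edge x y ws = f then nb_weight H x y ws * case_prod e f else 0)"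
      by (rule sum.swap)
    also have "\<dots> = (\<Sum>ws\<in>walks V l. nb_weight H x y ws * case_prod e (last_edge x y ws))"
      by (intro sum.cong refl) (simp only: sum.delta'[OF finP] last_edge_in_walks[OF xy] if_True)
    also have "\<dots> = lam ^ l * e x y"
      by (rule nb_eigenvector_iterate[OF fin diag ev xy, symmetric])
    finally show ?thesis ..
  qed
  have "(e x0 y0)\<^sup>2 \<le> E"
    using member_le_sum[of "(x0, y0)" "V \<times> V" "\<lambda>f. (case_prod e f)\<^sup>2"] finP nz
    by (simp add: E_def)
  moreover have "0 < (e x0 y0)\<^sup>2" using nz by simp
  ultimately have E: "E > 0" by linarith
  have "lam ^ (2 * l) * E = (\<Sum>x\<in>V. \<Sum>y\<in>V. (lam ^ l * e x y)\<^sup>2)"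
  proof -
    have "E = (\<Sum>x\<in>V. \<Sum>y\<in>V. (e x y)\<^sup>2)"
      unfolding E_def sum.cartesian_product by (intro sum.cong refl) (simp add: case_prod_unfold)
    then show ?thesis
      unfolding power_mult_distrib sum_distrib_left[symmetric] power_even_eq by simp
  qed
  also have "\<dots> \<le> (\<Sum>x\<in>V. \<Sum>y\<in>V. (\<Sum>f\<in>V \<times> V. (nb_entry V H l x y f)\<^sup>2) * E)"
  proof (intro sum_mono)
    fix x y assume "x \<in> V" "y \<in> V"
    then show "(lam ^ l * e x y)\<^sup>2 \<le> (\<Sum>f\<in>V \<times> V. (nb_entry V H l x y f)\<^sup>2) * E"
      unfolding E_def it[OF \<open>x \<in> V\<close> \<open>y \<in> V\<close>] by (intro Cauchy_Schwarz_ineq_sum)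
  qed
  also have "\<dots> = nb_frobenius V H l * E"
    unfolding nb_frobenius_eq[OF fin] sum_distrib_right[symmetric] ..
  finally show ?thesis using E by (rule mult_right_le_imp_le)
qed

text \<open>If \<open>e\<close> is an eigenvector for \<open>l\<close> and \<open>S y\<close> the
  sum of \<open>H y w * e y w\<close> over \<open>w\<close>, then
  \<open>l * e x y + H x y * e y x = S y\<close>. Solving this equation and its mirror image for
  \<open>e\<close> and inserting the result into the definition of \<open>S\<close> gives the linear
  system with this matrix.\<close>

definition bass_form :: "'v set \<Rightarrow> ('v \<Rightarrow> 'v \<Rightarrow> real) \<Rightarrow> real \<Rightarrow> 'v \<Rightarrow> 'v \<Rightarrow> real" where
  "bass_form V H l x y = (if x = y then 1 + (\<Sum>w\<in>V. (H x w)\<^sup>2 / (l\<^sup>2 - (H x w)\<^sup>2)) else 0)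
     - l * H x y / (l\<^sup>2 - (H x y)\<^sup>2)"

lemma sq_less_of_abs_le_1:
  fixes h l :: real
  assumes "\<bar>h\<bar> \<le> 1" "1 < l"
  shows "h\<^sup>2 < l\<^sup>2"
proof -
  have "h\<^sup>2 \<le> 1" using assms(1) by (simp add: abs_square_le_1)
  also have "1 < l\<^sup>2" using assms(2) by (simp add: one_less_power)
  finally show ?thesis .
qed

text \<open>
  The Ihara--Bass correspondence: a null vector \<open>S\<close> of the form gives the eigenvector
  \<open>(r S y - H x y S x) / (r\<^sup>2 - (H x y)\<^sup>2)\<close> of the non-backtracking matrix.
\<close>

lemma nb_frobenius_ge_of_null_vector:
  assumes fin: "finite V" and sym: "\<And>x y. H x y = H y x" and diag: "\<And>x. H x x = 0"
    and bound: "\<And>x y. \<bar>H x y\<bar> \<le> 1" and r: "1 < r"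
    and null: "\<And>x. x \<in> V \<Longrightarrow> (\<Sum>y\<in>V. bass_form V H r x y * S y) = 0"
    and nz: "x0 \<in> V" "S x0 \<noteq> 0"
  shows "r ^ (2 * l) \<le> nb_frobenius V H l"
proof -
  define d where "d x y = r\<^sup>2 - (H x y)\<^sup>2" for x y
  define e where "e x y = (r * S y - H x y * S x) / d x y" for x y
  have d: "d x y > 0" for x y using sq_less_of_abs_le_1[OF bound r] by (simp add: d_def)
  have dsym: "d x y = d y x" for x y by (simp add: d_def sym[of x y])
  \<comment> \<open>The null equation solved for \<open>S y\<close>. It shows that \<open>e\<close>
    determines \<open>S\<close>, so \<open>e\<close> is nonzero, and that removing the backtracking
    term \<open>w = x\<close> from the sum leaves \<open>S y - H y x * e y x\<close>.\<close>
  have Hsum: "(\<Sum>w\<in>V. H y w * e y w) = S y" if y: "y \<in> V" for y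
  proof -
    have "(\<Sum>w\<in>V. bass_form V H r y w * S w) =
        (\<Sum>w\<in>V. (if w = y then (1 + (\<Sum>w\<in>V. (H y w)\<^sup>2 / d y w)) * S y else 0) - r * H y w / d y w * S w)"
      by (rule sum.cong[OF refl]) (simp add: bass_form_def d_def left_diff_distrib)
    also have "\<dots> = (1 + (\<Sum>w\<in>V. (H y w)\<^sup>2 / d y w)) * S y - (\<Sum>w\<in>V. r * H y w / d y w * S w)"
      using fin y by (simp add: sum_subtractf)
    finally have 1: "(\<Sum>w\<in>V. r * H y w / d y w * S w) = S y + (\<Sum>w\<in>V. (H y w)\<^sup>2 / d y w) * S y"
      using null[OF y] by (simp add: distrib_right)
    have "(\<Sum>w\<in>V. H y w * e y w) = (\<Sum>w\<in>V. r * H y w / d y w * S w - (H y w)\<^sup>2 / d y w * S y)"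
      by (rule sum.cong[OF refl]) (simp add: e_def diff_divide_distrib right_diff_distrib power2_eq_square mult_ac)
    also have "\<dots> = S y" unfolding sum_subtractf 1 by (simp add: sum_distrib_right)
    finally show ?thesis .
  qed
  have ev: "r * e x y = (\<Sum>w\<in>V - {x}. H y w * e y w)" if "x \<in> V" "y \<in> V" for x y
  proof -
    have "(\<Sum>w\<in>V - {x}. H y w * e y w) = S y - H y x * e y x"
      using sum.remove[OF fin \<open>x \<in> V\<close>, of "\<lambda>w. H y w * e y w"] Hsum[OF \<open>y \<in> V\<close>] by simp
    also have "\<dots> = r * e x y"
    proof -
      have dd: "d x y \<noteq> 0" using d[of x y] by simp
      have "(S y - H y x * e y x) * d x y = S y * d x y - H x y * (r * S x - H x y * S y)"
        unfolding e_def dsym[of y x] sym[of y x] using dd by (simp add: left_diff_distrib)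
      also have "\<dots> = r * (r * S y - H x y * S x)"
        by (simp add: d_def algebra_simps power2_eq_square)
      also have "\<dots> = (r * e x y) * d x y" using dd by (simp add: e_def)
      finally show ?thesis using dd by simp
    qed
    finally show ?thesis ..
  qed
  have "\<exists>w\<in>V. e x0 w \<noteq> 0"
  proof (rule ccontr)
    assume "\<not> (\<exists>w\<in>V. e x0 w \<noteq> 0)"
    then have "(\<Sum>w\<in>V. H x0 w * e x0 w) = 0" by (intro sum.neutral) simp
    then show False using Hsum[OF nz(1)] nz(2) by simp
  qed
  then obtain w where w: "w \<in> V" "e x0 w \<noteq> 0" by blast
  show ?thesis by (rule nb_frobenius_ge[OF fin diag ev nz(1) w])
qed

text \<open>A null vector at a parameter \<open>t \<ge> r\<close> would force
  \<open>t ^ (2 * l) \<le> nb_frobenius V H l < r ^ (2 * l)\<close>. So positivity at a large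
  parameter persists down to \<open>r\<close>.\<close>

lemma bass_form_psd:
  assumes fin: "finite V" and sym: "\<And>x y. H x y = H y x" and diag: "\<And>x. H x x = 0"
    and bound: "\<And>x y. \<bar>H x y\<bar> \<le> 1" and r: "1 < r"
    and frob: "nb_frobenius V H l < r ^ (2 * l)"
  shows "0 \<le> quad_form V (bass_form V H r) z"
proof -
  \<comment> \<open>Large enough for diagonal dominance: the diagonal is at least 1, all other
    contributions are at most \<open>\<tau> = b / (b^2 - 1)\<close> in absolute value, and
    \<open>\<tau> * card V < 1\<close>.\<close>
  define b where "b = r + real (card V) + 2"
  have b: "r \<le> b" "1 < b" using r by (auto simp: b_def)
  have den: "t\<^sup>2 - (H x y)\<^sup>2 > 0" if "1 < t" for t x y
    using sq_less_of_abs_le_1[OF bound that] by simp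
  show ?thesis
  proof (rule psd_of_no_null_vector[OF fin _ b(1)])
    show "bass_form V H t x y = bass_form V H t y x" for t x y
      by (cases "x = y") (simp_all add: bass_form_def sym[of x y])
    show "continuous_on {r..b} (\<lambda>t. bass_form V H t x y)" for x y
    proof -
      have nz: "t\<^sup>2 - (H u w)\<^sup>2 \<noteq> 0" if "t \<in> {r..b}" for t u w
        using den[of t u w] that r by auto
      have "continuous_on {r..b} (\<lambda>t. (if x = y then 1 + (\<Sum>w\<in>V. (H x w)\<^sup>2 / (t\<^sup>2 - (H x w)\<^sup>2)) else 0))"
      proof (cases "x = y")
        case True
        show ?thesis unfolding if_P[OF True]
          by (intro continuous_on_add continuous_on_sum continuous_on_divide continuous_on_diff
              continuous_on_power continuous_on_id continuous_on_const ballI nz)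
      next
        case False
        show ?thesis unfolding if_not_P[OF False] by (rule continuous_on_const)
      qed
      moreover have "continuous_on {r..b} (\<lambda>t. t * H x y / (t\<^sup>2 - (H x y)\<^sup>2))"
        by (intro continuous_on_divide continuous_on_mult continuous_on_diff
              continuous_on_power continuous_on_id continuous_on_const ballI nz)
      ultimately show ?thesis unfolding bass_form_def by (rule continuous_on_diff)
    qed
    show "\<forall>x\<in>V. S x = 0" if t: "t \<in> {r..b}" and null: "\<And>x. x \<in> V \<Longrightarrow> (\<Sum>y\<in>V. bass_form V H t x y * S y) = 0" for t S
    proof (rule ccontr)
      assume "\<not> (\<forall>x\<in>V. S x = 0)"
      then obtain x0 where x0: "x0 \<in> V" "S x0 \<noteq> 0" by blast
      have "1 < t" using t r by simp
      then have "t ^ (2 * l) \<le> nb_frobenius V H l"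
        by (rule nb_frobenius_ge_of_null_vector[OF fin sym diag bound _ null x0])
      moreover have "r ^ (2 * l) \<le> t ^ (2 * l)" using t r by (intro power_mono) auto
      ultimately show False using frob by linarith
    qed
    show "0 < quad_form V (bass_form V H b) z" if z: "(\<Sum>x\<in>V. (z x)\<^sup>2) = 1" for z
    proof -
      define \<tau> where "\<tau> = b / (b\<^sup>2 - 1)"
      have b1: "b\<^sup>2 - 1 > 0" using b by (simp add: one_less_power)
      have \<tau>: "\<tau> \<ge> 0" using b b1 by (simp add: \<tau>_def)
      have t: "\<bar>b * H x y / (b\<^sup>2 - (H x y)\<^sup>2)\<bar> \<le> \<tau>" for x y
      proof -
        have "(H x y)\<^sup>2 \<le> 1" using bound by (simp add: abs_square_le_1)
        have "\<bar>b * H x y / (b\<^sup>2 - (H x y)\<^sup>2)\<bar> = b * \<bar>H x y\<bar> / (b\<^sup>2 - (H x y)\<^sup>2)"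
          using b den[OF b(2), of x y] by (simp add: abs_mult)
        also have "\<dots> \<le> b * 1 / (b\<^sup>2 - 1)"
          using b b1 bound[of x y] \<open>(H x y)\<^sup>2 \<le> 1\<close> by (intro frac_le mult_left_mono) auto
        finally show ?thesis by (simp add: \<tau>_def)
      qed
      have lower: "(if x = y then (z x)\<^sup>2 else 0) - \<tau> * ((z x)\<^sup>2 + (z y)\<^sup>2) / 2 \<le> bass_form V H b x y * z x * z y" for x y
      proof -
        have "\<bar>b * H x y / (b\<^sup>2 - (H x y)\<^sup>2) * (z x * z y)\<bar> \<le> \<tau> * (((z x)\<^sup>2 + (z y)\<^sup>2) / 2)"
        proof -
          have "\<bar>z x * z y\<bar> \<le> ((z x)\<^sup>2 + (z y)\<^sup>2) / 2"
            using sum_squares_bound[of "\<bar>z x\<bar>" "\<bar>z y\<bar>"] by (simp add: abs_mult)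
          then show ?thesis unfolding abs_mult[of "b * H x y / (b\<^sup>2 - (H x y)\<^sup>2)"] using t[of x y]
            by (intro mult_mono \<tau>) auto
        qed
        then have *: "- (\<tau> * ((z x)\<^sup>2 + (z y)\<^sup>2) / 2) \<le> - (b * H x y / (b\<^sup>2 - (H x y)\<^sup>2) * (z x * z y))"
          by linarith
        have "0 \<le> (\<Sum>w\<in>V. (H x w)\<^sup>2 / (b\<^sup>2 - (H x w)\<^sup>2))"
          using den[OF b(2)] by (intro sum_nonneg divide_nonneg_pos) auto
        then have "(z x)\<^sup>2 * 1 \<le> (z x)\<^sup>2 * (1 + (\<Sum>w\<in>V. (H x w)\<^sup>2 / (b\<^sup>2 - (H x w)\<^sup>2)))"
          by (intro mult_left_mono) auto
        with * show ?thesis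
          by (auto simp: bass_form_def left_diff_distrib power2_eq_square mult.assoc mult.commute[of "1 + _"])
      qed
      have "(\<Sum>x\<in>V. \<Sum>y\<in>V. (if x = y then (z x)\<^sup>2 else 0) - \<tau> * ((z x)\<^sup>2 + (z y)\<^sup>2) / 2)
          \<le> quad_form V (bass_form V H b) z"
        unfolding quad_form_def by (intro sum_mono lower)
      moreover have "(\<Sum>x\<in>V. \<Sum>y\<in>V. (if x = y then (z x)\<^sup>2 else 0) - \<tau> * ((z x)\<^sup>2 + (z y)\<^sup>2) / 2)
          = 1 - \<tau> * real (card V)"
      proof -
        have "(\<Sum>y\<in>V. (if x = y then (z x)\<^sup>2 else 0) - \<tau> * ((z x)\<^sup>2 + (z y)\<^sup>2) / 2) =
            (z x)\<^sup>2 - \<tau> / 2 * (real (card V) * (z x)\<^sup>2 + 1)" if "x \<in> V" for x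
        proof -
          have "(\<Sum>y\<in>V. \<tau> * ((z x)\<^sup>2 + (z y)\<^sup>2) / 2) = (\<Sum>y\<in>V. \<tau> / 2 * ((z x)\<^sup>2 + (z y)\<^sup>2))"
            by simp
          also have "\<dots> = \<tau> / 2 * (real (card V) * (z x)\<^sup>2 + 1)"
            unfolding sum_distrib_left[symmetric] sum.distrib z by simp
          finally show ?thesis using fin that by (simp add: sum_subtractf)
        qed
        then have "(\<Sum>x\<in>V. \<Sum>y\<in>V. (if x = y then (z x)\<^sup>2 else 0) - \<tau> * ((z x)\<^sup>2 + (z y)\<^sup>2) / 2) =
            (\<Sum>x\<in>V. (z x)\<^sup>2 - \<tau> / 2 * (real (card V) * (z x)\<^sup>2 + 1))"
          by (intro sum.cong refl)
        also have "\<dots> = 1 - \<tau> / 2 * (real (card V) * 1 + real (card V))"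
          unfolding sum_subtractf sum_distrib_left[symmetric] sum.distrib z by simp
        finally show ?thesis by simp
      qed
      moreover have "\<tau> * real (card V) < 1"
      proof -
        have "1 < 2 * (b - real (card V))" using r by (simp add: b_def)
        also have "\<dots> \<le> b * (b - real (card V))"
          using r by (intro mult_right_mono) (auto simp: b_def)
        finally have "b * real (card V) < b\<^sup>2 - 1" by (simp add: algebra_simps power2_eq_square)
        then show ?thesis using b1 by (simp add: \<tau>_def)
      qed
      ultimately show ?thesis by linarith
    qed
  qed
qed

section \<open>Bipartite weights\<close>

fun bipartite_weight :: "('a \<Rightarrow> 'b \<Rightarrow> real) \<Rightarrow> 'a + 'b \<Rightarrow> 'a + 'b \<Rightarrow> real" where
  "bipartite_weight X (Inl i) (Inr j) = X i j"
| "bipartite_weight X (Inr j) (Inl i) = X i j"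
| "bipartite_weight X _ _ = 0"

lemma bipartite_weight_sym: "bipartite_weight X u v = bipartite_weight X v u"
  by (cases u; cases v) simp_all

lemma bipartite_weight_diag: "bipartite_weight X u u = 0"
  by (cases u) simp_all

lemma quad_form_bipartite:
  assumes fin: "finite I" "finite J"
  shows "quad_form (I <+> J) (bass_form (I <+> J) (bipartite_weight X) r) (case_sum u v) =
    (\<Sum>i\<in>I. (1 + (\<Sum>j\<in>J. (X i j)\<^sup>2 / (r\<^sup>2 - (X i j)\<^sup>2))) * (u i)\<^sup>2)
    + (\<Sum>j\<in>J. (1 + (\<Sum>i\<in>I. (X i j)\<^sup>2 / (r\<^sup>2 - (X i j)\<^sup>2))) * (v j)\<^sup>2)
    - 2 * (\<Sum>i\<in>I. \<Sum>j\<in>J. r * X i j / (r\<^sup>2 - (X i j)\<^sup>2) * u i * v j)"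
proof -
  let ?B = "bass_form (I <+> J) (bipartite_weight X) r"
  have LL: "?B (Inl i) (Inl k) = (if i = k then 1 + (\<Sum>j\<in>J. (X i j)\<^sup>2 / (r\<^sup>2 - (X i j)\<^sup>2)) else 0)" for i k
    using fin by (simp add: bass_form_def sum.Plus)
  have RR: "?B (Inr j) (Inr k) = (if j = k then 1 + (\<Sum>i\<in>I. (X i j)\<^sup>2 / (r\<^sup>2 - (X i j)\<^sup>2)) else 0)" for j k
    using fin by (simp add: bass_form_def sum.Plus)
  have LR: "?B (Inl i) (Inr j) = - (r * X i j / (r\<^sup>2 - (X i j)\<^sup>2))"
    "?B (Inr j) (Inl i) = - (r * X i j / (r\<^sup>2 - (X i j)\<^sup>2))" for i j
    by (simp_all add: bass_form_def)
  have 1: "(\<Sum>i\<in>I. \<Sum>k\<in>I. ?B (Inl i) (Inl k) * u i * u k) =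
      (\<Sum>i\<in>I. (1 + (\<Sum>j\<in>J. (X i j)\<^sup>2 / (r\<^sup>2 - (X i j)\<^sup>2))) * (u i)\<^sup>2)"
    using fin by (intro sum.cong refl)
      (simp add: LL if_distrib[of "\<lambda>c. c * _"] power2_eq_square mult.assoc cong: if_cong)
  have 2: "(\<Sum>j\<in>J. \<Sum>k\<in>J. ?B (Inr j) (Inr k) * v j * v k) =
      (\<Sum>j\<in>J. (1 + (\<Sum>i\<in>I. (X i j)\<^sup>2 / (r\<^sup>2 - (X i j)\<^sup>2))) * (v j)\<^sup>2)"
    using fin by (intro sum.cong refl)
      (simp add: RR if_distrib[of "\<lambda>c. c * _"] power2_eq_square mult.assoc cong: if_cong)
  have 3: "(\<Sum>j\<in>J. \<Sum>i\<in>I. ?B (Inr j) (Inl i) * v j * u i) =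
      (\<Sum>i\<in>I. \<Sum>j\<in>J. ?B (Inl i) (Inr j) * u i * v j)"
    by (subst sum.swap) (intro sum.cong refl, simp add: LR)
  have 4: "(\<Sum>i\<in>I. \<Sum>j\<in>J. ?B (Inl i) (Inr j) * u i * v j) =
      - (\<Sum>i\<in>I. \<Sum>j\<in>J. r * X i j / (r\<^sup>2 - (X i j)\<^sup>2) * u i * v j)"
    by (simp add: LR sum_negf)
  have "quad_form (I <+> J) ?B (case_sum u v) =
     (\<Sum>i\<in>I. (\<Sum>k\<in>I. ?B (Inl i) (Inl k) * u i * u k) + (\<Sum>j\<in>J. ?B (Inl i) (Inr j) * u i * v j))
     + (\<Sum>j\<in>J. (\<Sum>i\<in>I. ?B (Inr j) (Inl i) * v j * u i) + (\<Sum>k\<in>J. ?B (Inr j) (Inr k) * v j * v k))"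
    unfolding quad_form_def using fin by (simp add: sum.Plus)
  then show ?thesis unfolding sum.distrib 1 2 3 4 by simp
qed

text \<open>Equality of the two terms on the right is reached at
  \<open>c = sqrt (\<beta> * B / (\<alpha> * A))\<close>.\<close>

lemma bilinear_le_of_scaled:
  fixes S \<alpha> \<beta> A B :: real
  assumes "\<alpha> > 0" "\<beta> > 0" "A > 0" "B > 0"
    and *: "\<And>c. c > 0 \<Longrightarrow> 2 * S \<le> \<alpha> * c * A + \<beta> / c * B"
  shows "S \<le> sqrt (\<alpha> * \<beta>) * (sqrt A * sqrt B)"
proof -
  define p where "p = sqrt (\<alpha> * A)"
  define q where "q = sqrt (\<beta> * B)"
  have pq: "p > 0" "q > 0" "p * p = \<alpha> * A" "q * q = \<beta> * B" using assms by (auto simp: p_def q_def)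
  have "2 * S \<le> \<alpha> * (q / p) * A + \<beta> / (q / p) * B" using pq by (intro *) simp
  also have "\<dots> = (\<alpha> * A) * q / p + (\<beta> * B) * p / q" by (simp add: mult_ac)
  also have "\<dots> = 2 * (p * q)" unfolding pq(3,4)[symmetric] using pq(1,2) by simp
  finally show ?thesis by (simp add: p_def q_def real_sqrt_mult mult_ac)
qed

text \<open>With \<open>L = sqrt (a * b)\<close> and \<open>r^2 = 1 + L\<close>, the summand 1 keeps
  all denominators \<open>r^2 - (X i j)^2\<close> at least \<open>L\<close>. Then
  \<open>\<alpha> * \<beta> = (sqrt a + sqrt b)^2 / L\<close>. Of the final 2, one unit comes from
  \<open>sqrt ((1 + L) / L)\<close>, the other from replacing the entries of the form by those of
  \<open>X\<close>.\<close>

theorem bipartite_operator_norm_le: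
  fixes X :: "'a \<Rightarrow> 'b \<Rightarrow> real"
  assumes fin: "finite I" "finite J" and bound: "\<And>i j. \<bar>X i j\<bar> \<le> 1"
    and ab: "1 \<le> a" "1 \<le> b"
    and row: "\<And>i. i \<in> I \<Longrightarrow> (\<Sum>j\<in>J. (X i j)\<^sup>2) \<le> a"
    and col: "\<And>j. j \<in> J \<Longrightarrow> (\<Sum>i\<in>I. (X i j)\<^sup>2) \<le> b"
    and frob: "nb_frobenius (I <+> J) (bipartite_weight X) l < (1 + sqrt (a * b)) ^ l"
  shows "(\<Sum>i\<in>I. (\<Sum>j\<in>J. X i j * v j)\<^sup>2) \<le> (sqrt a + sqrt b + 2)\<^sup>2 * (\<Sum>j\<in>J. (v j)\<^sup>2)"
proof -
  define L where "L = sqrt (a * b)"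
  define r where "r = sqrt (1 + L)"
  have "1 * 1 \<le> a * b" using ab by (intro mult_mono) auto
  then have L1: "L \<ge> 1" by (simp add: L_def)
  have r2: "r\<^sup>2 = 1 + L" using L1 by (simp add: r_def)
  have r: "1 < r" using L1 by (simp add: r_def)
  have rr: "r ^ (2 * l) = (1 + sqrt (a * b)) ^ l" by (simp add: power_mult r2 L_def)
  define \<alpha> where "\<alpha> = 1 + a / L"
  define \<beta> where "\<beta> = 1 + b / L"
  have ab_pos: "\<alpha> > 0" "\<beta> > 0" using L1 ab by (auto simp: \<alpha>_def \<beta>_def intro!: add_pos_nonneg)
  define t where "t i j = r * X i j / (r\<^sup>2 - (X i j)\<^sup>2)" for i j
  \<comment> \<open>The form controls \<open>t\<close>, and \<open>X = r * t - Z\<close>. Since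
    \<open>Z\<close> is cubic in \<open>X\<close>, it is at most \<open>X^2 / L\<close> in absolute
    value, with row sums at most \<open>a / L\<close> and column sums at most \<open>b / L\<close>.
    Schur's test bounds its norm by \<open>sqrt (a / L * (b / L)) = 1\<close>.\<close>
  define Z where "Z i j = X i j ^ 3 / (r\<^sup>2 - (X i j)\<^sup>2)" for i j
  have x1: "(X i j)\<^sup>2 \<le> 1" for i j using bound[of i j] by (simp add: abs_square_le_1)
  have den: "r\<^sup>2 - (X i j)\<^sup>2 \<ge> L" for i j using x1[of i j] by (simp add: r2)
  have denp: "r\<^sup>2 - (X i j)\<^sup>2 > 0" for i j using den[of i j] L1 by linarith
  have s_le: "(X i j)\<^sup>2 / (r\<^sup>2 - (X i j)\<^sup>2) \<le> (X i j)\<^sup>2 / L" for i j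
    using den[of i j] L1 by (intro divide_left_mono) (auto intro!: mult_pos_pos denp)
  have X_eq: "X i j = r * t i j - Z i j" for i j
  proof -
    have "r * t i j - Z i j = (r\<^sup>2 * X i j - X i j ^ 3) / (r\<^sup>2 - (X i j)\<^sup>2)"
      by (simp add: t_def Z_def diff_divide_distrib power2_eq_square mult.assoc)
    also have "\<dots> = X i j * (r\<^sup>2 - (X i j)\<^sup>2) / (r\<^sup>2 - (X i j)\<^sup>2)"
      by (simp add: power2_eq_square power3_eq_cube algebra_simps)
    also have "\<dots> = X i j" using denp[of i j] by simp
    finally show ?thesis ..
  qed
  have Z_le: "\<bar>Z i j\<bar> \<le> (X i j)\<^sup>2 / L" for i j
  proof -
    have "\<bar>Z i j\<bar> = \<bar>X i j\<bar> * ((X i j)\<^sup>2 / (r\<^sup>2 - (X i j)\<^sup>2))"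
      using denp[of i j] by (simp add: Z_def abs_mult power3_eq_cube power2_eq_square mult.assoc)
    also have "\<dots> \<le> 1 * ((X i j)\<^sup>2 / L)"
      using bound[of i j] s_le[of i j] denp[of i j] by (intro mult_mono) auto
    finally show ?thesis by simp
  qed
  have main: "2 * (\<Sum>i\<in>I. \<Sum>j\<in>J. t i j * u i * v j) \<le> \<alpha> * (\<Sum>i\<in>I. (u i)\<^sup>2) + \<beta> * (\<Sum>j\<in>J. (v j)\<^sup>2)" for u v
  proof -
    have finV: "finite (I <+> J)" using fin by simp
    have bw: "\<bar>bipartite_weight X x y\<bar> \<le> 1" for x y
      using bound by (cases x; cases y) auto
    have "0 \<le> quad_form (I <+> J) (bass_form (I <+> J) (bipartite_weight X) r) (case_sum u v)"
      by (rule bass_form_psd[where l = l, OF finV bipartite_weight_sym bipartite_weight_diag bw r])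
         (use frob rr in simp)
    then have "2 * (\<Sum>i\<in>I. \<Sum>j\<in>J. t i j * u i * v j) \<le>
        (\<Sum>i\<in>I. (1 + (\<Sum>j\<in>J. (X i j)\<^sup>2 / (r\<^sup>2 - (X i j)\<^sup>2))) * (u i)\<^sup>2)
        + (\<Sum>j\<in>J. (1 + (\<Sum>i\<in>I. (X i j)\<^sup>2 / (r\<^sup>2 - (X i j)\<^sup>2))) * (v j)\<^sup>2)"
      unfolding quad_form_bipartite[OF fin] t_def by linarith
    also have "\<dots> \<le> (\<Sum>i\<in>I. \<alpha> * (u i)\<^sup>2) + (\<Sum>j\<in>J. \<beta> * (v j)\<^sup>2)"
    proof (intro add_mono sum_mono mult_right_mono)
      fix i assume "i \<in> I"
      have "(\<Sum>j\<in>J. (X i j)\<^sup>2 / (r\<^sup>2 - (X i j)\<^sup>2)) \<le> (\<Sum>j\<in>J. (X i j)\<^sup>2 / L)"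
        by (intro sum_mono s_le)
      also have "\<dots> \<le> a / L"
        unfolding sum_divide_distrib[symmetric] using row[OF \<open>i \<in> I\<close>] L1 by (intro divide_right_mono) auto
      finally show "1 + (\<Sum>j\<in>J. (X i j)\<^sup>2 / (r\<^sup>2 - (X i j)\<^sup>2)) \<le> \<alpha>" by (simp add: \<alpha>_def)
    next
      fix j assume "j \<in> J"
      have "(\<Sum>i\<in>I. (X i j)\<^sup>2 / (r\<^sup>2 - (X i j)\<^sup>2)) \<le> (\<Sum>i\<in>I. (X i j)\<^sup>2 / L)"
        by (intro sum_mono s_le)
      also have "\<dots> \<le> b / L"
        unfolding sum_divide_distrib[symmetric] using col[OF \<open>j \<in> J\<close>] L1 by (intro divide_right_mono) auto
      finally show "1 + (\<Sum>i\<in>I. (X i j)\<^sup>2 / (r\<^sup>2 - (X i j)\<^sup>2)) \<le> \<beta>" by (simp add: \<beta>_def)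
    qed auto
    finally show ?thesis by (simp add: sum_distrib_left)
  qed
  \<comment> \<open>Testing the bilinear form of \<open>X\<close> at \<open>w\<close> and
    \<open>v\<close> yields exactly \<open>A\<close>, the squared length of the image of
    \<open>v\<close>.\<close>
  define w where "w i = (\<Sum>j\<in>J. X i j * v j)" for i
  define A where "A = (\<Sum>i\<in>I. (w i)\<^sup>2)"
  define B where "B = (\<Sum>j\<in>J. (v j)\<^sup>2)"
  have AB0: "A \<ge> 0" "B \<ge> 0" by (auto simp: A_def B_def intro!: sum_nonneg)
  show ?thesis
  proof (cases "A = 0 \<or> B = 0")
    case True
    moreover have "A = 0" if "B = 0"
    proof -
      have "v j = 0" if "j \<in> J" for j
        using \<open>B = 0\<close> that fin unfolding B_def by (subst (asm) sum_nonneg_eq_0_iff) auto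
      then show ?thesis by (simp add: A_def w_def)
    qed
    ultimately have "A = 0" by blast
    then have "A \<le> (sqrt a + sqrt b + 2)\<^sup>2 * B" using AB0 by simp
    then show ?thesis by (simp add: A_def B_def w_def)
  next
    case False
    then have AB: "A > 0" "B > 0" using AB0 by auto
    have sc1: "2 * (\<Sum>i\<in>I. \<Sum>j\<in>J. t i j * w i * v j) \<le> \<alpha> * c * A + \<beta> / c * B" if c: "c > 0" for c
    proof -
      have "2 * (\<Sum>i\<in>I. \<Sum>j\<in>J. t i j * (c * w i) * v j) \<le> \<alpha> * (\<Sum>i\<in>I. (c * w i)\<^sup>2) + \<beta> * B"
        unfolding B_def by (rule main)
      also have "(\<Sum>i\<in>I. \<Sum>j\<in>J. t i j * (c * w i) * v j) = c * (\<Sum>i\<in>I. \<Sum>j\<in>J. t i j * w i * v j)"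
        by (simp add: sum_distrib_left mult_ac)
      also have "(\<Sum>i\<in>I. (c * w i)\<^sup>2) = c\<^sup>2 * A"
        by (simp add: A_def sum_distrib_left power_mult_distrib)
      finally show ?thesis using c by (simp add: field_simps power2_eq_square)
    qed
    have sc2: "2 * (\<Sum>i\<in>I. \<Sum>j\<in>J. - Z i j * w i * v j) \<le> a / L * c * A + (b / L) / c * B" if c: "c > 0" for c
    proof -
      have pt: "2 * (- Z i j * w i * v j) \<le> (X i j)\<^sup>2 * (c * (w i)\<^sup>2 / L) + (X i j)\<^sup>2 * ((v j)\<^sup>2 / c / L)" for i j
      proof -
        have "2 * (\<bar>w i\<bar> * \<bar>v j\<bar>) \<le> c * (w i)\<^sup>2 + (v j)\<^sup>2 / c"
        proof -
          have expand: "(c * W - U)\<^sup>2 / c = c * W\<^sup>2 + U\<^sup>2 / c - 2 * (W * U)" for W U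
            using c by (simp add: power2_eq_square field_simps)
          have "0 \<le> (c * \<bar>w i\<bar> - \<bar>v j\<bar>)\<^sup>2 / c" using c by simp
          then show ?thesis unfolding expand by simp
        qed
        have "2 * (- Z i j * w i * v j) \<le> \<bar>Z i j\<bar> * (2 * (\<bar>w i\<bar> * \<bar>v j\<bar>))"
          using abs_ge_self[of "- Z i j * w i * v j"] by (simp add: abs_mult mult_ac)
        also have "\<dots> \<le> (X i j)\<^sup>2 / L * (c * (w i)\<^sup>2 + (v j)\<^sup>2 / c)"
          using Z_le[of i j] \<open>2 * (\<bar>w i\<bar> * \<bar>v j\<bar>) \<le> _\<close> L1 by (intro mult_mono) auto
        finally show ?thesis by (simp add: distrib_left mult_ac)
      qed
      have "2 * (\<Sum>i\<in>I. \<Sum>j\<in>J. - Z i j * w i * v j) = (\<Sum>i\<in>I. \<Sum>j\<in>J. 2 * (- Z i j * w i * v j))"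
        by (simp only: sum_distrib_left)
      also have "\<dots> \<le> (\<Sum>i\<in>I. \<Sum>j\<in>J. (X i j)\<^sup>2 * (c * (w i)\<^sup>2 / L) + (X i j)\<^sup>2 * ((v j)\<^sup>2 / c / L))"
        by (intro sum_mono pt)
      also have "\<dots> = (\<Sum>i\<in>I. (\<Sum>j\<in>J. (X i j)\<^sup>2) * (c * (w i)\<^sup>2 / L)) + (\<Sum>j\<in>J. (\<Sum>i\<in>I. (X i j)\<^sup>2) * ((v j)\<^sup>2 / c / L))"
        unfolding sum.distrib sum_distrib_right[symmetric]
        by (simp only: sum.swap[of "\<lambda>i j. (X i j)\<^sup>2 * ((v j)\<^sup>2 / c / L)" J I] sum_distrib_right[symmetric])
      also have "\<dots> \<le> (\<Sum>i\<in>I. a * (c * (w i)\<^sup>2 / L)) + (\<Sum>j\<in>J. b * ((v j)\<^sup>2 / c / L))"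
        using row col c L1 by (intro add_mono sum_mono mult_right_mono) auto
      also have "\<dots> = a / L * c * A + (b / L) / c * B"
        by (simp add: A_def B_def sum_distrib_left sum_divide_distrib mult_ac)
      finally show ?thesis .
    qed
    have "A = (\<Sum>i\<in>I. \<Sum>j\<in>J. X i j * w i * v j)"
      by (simp add: A_def power2_eq_square w_def sum_distrib_left sum_distrib_right mult_ac)
    also have "\<dots> = (\<Sum>i\<in>I. \<Sum>j\<in>J. r * (t i j * w i * v j) + - Z i j * w i * v j)"
      by (subst X_eq) (simp add: algebra_simps)
    also have "\<dots> = r * (\<Sum>i\<in>I. \<Sum>j\<in>J. t i j * w i * v j) + (\<Sum>i\<in>I. \<Sum>j\<in>J. - Z i j * w i * v j)"
      by (simp only: sum.distrib sum_distrib_left)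
    also have "\<dots> \<le> r * (sqrt (\<alpha> * \<beta>) * (sqrt A * sqrt B)) + sqrt (a / L * (b / L)) * (sqrt A * sqrt B)"
      using r L1 ab AB ab_pos
      by (intro add_mono mult_left_mono bilinear_le_of_scaled sc1 sc2) auto
    also have "\<dots> = (r * sqrt (\<alpha> * \<beta>) + 1) * (sqrt A * sqrt B)"
    proof -
      have "L * L = a * b" using ab by (simp add: L_def)
      then have e: "a / L * (b / L) = 1" using ab by simp
      show ?thesis unfolding e by (simp add: algebra_simps)
    qed
    also have "\<dots> \<le> (sqrt a + sqrt b + 2) * (sqrt A * sqrt B)"
    proof (intro mult_right_mono)
      have La: "L = sqrt a * sqrt b" by (simp add: L_def real_sqrt_mult)
      have sa: "sqrt a * sqrt a = a" "sqrt b * sqrt b = b" "sqrt a \<ge> 1" "sqrt b \<ge> 1" using ab by auto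
      have LL: "L * L = a * b" using ab by (simp add: L_def)
      have "\<alpha> * \<beta> = (sqrt a + sqrt b)\<^sup>2 / L"
      proof -
        have "\<alpha> * \<beta> * L = (L + a) * (L + b) / L" using L1 by (simp add: \<alpha>_def \<beta>_def field_simps)
        also have "(L + a) * (L + b) = L * (a + b + 2 * L)" using LL by (simp add: algebra_simps)
        also have "\<dots> / L = a + b + 2 * L" using L1 by simp
        also have "\<dots> = (sqrt a + sqrt b)\<^sup>2" unfolding power2_sum La using ab by simp
        finally show ?thesis using L1 by (simp add: field_simps)
      qed
      then have "sqrt (\<alpha> * \<beta>) = (sqrt a + sqrt b) / sqrt L"
        using sa by (simp add: real_sqrt_divide)
      then have "r * sqrt (\<alpha> * \<beta>) = (sqrt a + sqrt b) * sqrt ((1 + L) / L)"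
        by (simp add: r_def real_sqrt_divide)
      also have "\<dots> \<le> (sqrt a + sqrt b) * (1 + 1 / (2 * L))"
      proof (intro mult_left_mono)
        have "(1 + L) / L = 1 + 1 / L" using L1 by (simp add: field_simps)
        also have "\<dots> \<le> (1 + 1 / (2 * L))\<^sup>2" using L1 by (simp add: power2_sum)
        finally show "sqrt ((1 + L) / L) \<le> 1 + 1 / (2 * L)"
          using L1 by (intro real_le_lsqrt) auto
      qed (use sa in auto)
      also have "\<dots> = sqrt a + sqrt b + (1 / sqrt b + 1 / sqrt a) / 2"
        using sa(3,4) unfolding La by (simp add: field_simps)
      also have "\<dots> \<le> sqrt a + sqrt b + (1 + 1) / 2"
        using sa(3,4) by (intro add_left_mono divide_right_mono add_mono) auto
      finally show "r * sqrt (\<alpha> * \<beta>) + 1 \<le> sqrt a + sqrt b + 2" by simp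
    qed (use AB in auto)
    finally have "sqrt A * sqrt A \<le> ((sqrt a + sqrt b + 2) * sqrt B) * sqrt A" using AB by (simp add: mult_ac)
    then have "sqrt A \<le> (sqrt a + sqrt b + 2) * sqrt B"
      by (rule mult_right_le_imp_le) (use AB in simp)
    then have "(sqrt A)\<^sup>2 \<le> ((sqrt a + sqrt b + 2) * sqrt B)\<^sup>2" using AB by (intro power_mono) auto
    then have "A \<le> (sqrt a + sqrt b + 2)\<^sup>2 * B" using AB by (simp add: power_mult_distrib)
    then show ?thesis by (simp add: A_def B_def w_def)
  qed
qed

section \<open>Independent entries\<close>

lemma finite_set_Pi_pmf:
  assumes "finite A" "\<And>x. x \<in> A \<Longrightarrow> finite (set_pmf (p x))"
  shows "finite (set_pmf (Pi_pmf A d p))"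
  unfolding set_Pi_pmf[OF assms(1)] using assms by (intro finite_PiE_dflt) auto

lemma expectation_prod_Pi_pmf_finite:
  fixes f :: "'a \<Rightarrow> 'b \<Rightarrow> real"
  assumes fin: "finite A" and fs: "\<And>x. x \<in> A \<Longrightarrow> finite (set_pmf (p x))"
  shows "measure_pmf.expectation (Pi_pmf A d p) (\<lambda>y. \<Prod>x\<in>A. f x (y x)) =
    (\<Prod>x\<in>A. measure_pmf.expectation (p x) (f x))"
proof -
  let ?M = "measure_pmf (Pi_pmf A d p)"
  have ind: "prob_space.indep_vars ?M (\<lambda>_. borel) (\<lambda>x y. f x (y x)) A"
    by (rule prob_space.indep_vars_compose2[OF prob_space_measure_pmf indep_vars_Pi_pmf[OF fin]]) auto
  have int: "integrable ?M (\<lambda>y. f x (y x))" for x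
    using finite_set_Pi_pmf[OF fin fs] by (intro integrable_measure_pmf_finite)
  have "measure_pmf.expectation (Pi_pmf A d p) (\<lambda>y. \<Prod>x\<in>A. f x (y x)) =
      (\<Prod>x\<in>A. measure_pmf.expectation (Pi_pmf A d p) (\<lambda>y. f x (y x)))"
    by (rule prob_space.indep_vars_lebesgue_integral[OF prob_space_measure_pmf fin ind int])
  also have "\<dots> = (\<Prod>x\<in>A. measure_pmf.expectation (p x) (f x))"
  proof (rule prod.cong[OF refl])
    fix x assume x: "x \<in> A"
    have "measure_pmf.expectation (Pi_pmf A d p) (\<lambda>y. f x (y x)) =
        measure_pmf.expectation (map_pmf (\<lambda>y. y x) (Pi_pmf A d p)) (f x)" by simp
    then show "measure_pmf.expectation (Pi_pmf A d p) (\<lambda>y. f x (y x)) = measure_pmf.expectation (p x) (f x)"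
      unfolding Pi_pmf_component[OF fin] using x by simp
  qed
  finally show ?thesis .
qed

lemma markov_finite_pmf:
  fixes g :: "'a \<Rightarrow> real"
  assumes fin: "finite (set_pmf M)" and nonneg: "\<And>x. 0 \<le> g x" and c: "0 < c"
  shows "measure_pmf.prob M {x. c \<le> g x} \<le> measure_pmf.expectation M g / c"
proof -
  have int: "integrable (measure_pmf M) h" for h :: "'a \<Rightarrow> real"
    using fin by (rule integrable_measure_pmf_finite)
  have "measure_pmf.prob M {x. c \<le> g x} = measure_pmf.expectation M (indicator {x. c \<le> g x})"
    by simp
  also have "\<dots> \<le> measure_pmf.expectation M (\<lambda>x. g x / c)"
    using nonneg c by (intro integral_mono int) (auto simp: indicator_def field_simps)
  finally show ?thesis by simp
qed

text \<open>The vanishing first moment removes all pairs of walks with an open edge. For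
  \<open>k \<ge> 2\<close> the two outcomes contribute at most \<open>(1 - p) * p\<close> and
  \<open>p * p\<close>.\<close>

lemma centered_bernoulli_moment_le:
  assumes p: "0 \<le> p" "p \<le> 1"
  shows "\<bar>measure_pmf.expectation (bernoulli_pmf p) (\<lambda>b. (of_bool b - p) ^ k)\<bar>
    \<le> (if k = 0 then 1 else if k = 1 then 0 else p)"
proof -
  have e: "measure_pmf.expectation (bernoulli_pmf p) (\<lambda>b. (of_bool b - p) ^ k) =
    (1 - p) ^ k * p + (- p) ^ k * (1 - p)"
    using p by simp
  consider "k = 0" | "k = 1" | l where "k = Suc (Suc l)" by (metis One_nat_def not0_implies_Suc)
  then show ?thesis
  proof cases
    case 3
    have q: "0 \<le> 1 - p" "1 - p \<le> 1" using p by auto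
    have "\<bar>(1 - p) ^ k * p + (- p) ^ k * (1 - p)\<bar> \<le> \<bar>(1 - p) ^ k * p\<bar> + \<bar>(- p) ^ k * (1 - p)\<bar>"
      by (rule abs_triangle_ineq)
    also have "\<dots> = (1 - p) ^ k * p + p ^ k * (1 - p)"
      using p by (simp add: abs_mult power_abs)
    also have "\<dots> \<le> (1 - p) ^ 1 * p + p ^ 1 * (1 - (1 - p))"
    proof -
      have "(1 - p) ^ k \<le> (1 - p) ^ 1" using q 3 by (intro power_decreasing) auto
      then have 1: "(1 - p) ^ k * p \<le> (1 - p) ^ 1 * p" using p by (intro mult_right_mono) auto
      have "p ^ l \<le> 1" using p by (intro power_le_one)
      then have "p ^ l * (p * p * (1 - p)) \<le> 1 * (p * p * 1)" using p by (intro mult_mono) auto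
      then have "p ^ k * (1 - p) \<le> p ^ 1 * (1 - (1 - p))" using 3 by (simp add: mult_ac)
      with 1 show ?thesis by linarith
    qed
    also have "\<dots> = p" by (simp add: algebra_simps)
    finally show ?thesis using e 3 by simp
  qed (use e p in \<open>auto simp: algebra_simps\<close>)
qed

text \<open>Chernoff's bound with a free parameter \<open>s\<close>; edges outside \<open>S\<close>
  contribute factors 1 so that independence can be used over all of \<open>A\<close>.\<close>

lemma bernoulli_sum_tail:
  fixes p :: "'a \<Rightarrow> real"
  assumes fin: "finite A" and S: "S \<subseteq> A" and p: "\<And>x. x \<in> A \<Longrightarrow> 0 \<le> p x \<and> p x \<le> 1"
    and a: "(\<Sum>x\<in>S. p x) \<le> a" and s: "0 \<le> s"
  shows "measure_pmf.prob (Pi_pmf A False (\<lambda>x. bernoulli_pmf (p x))) {f. T \<le> (\<Sum>x\<in>S. of_bool (f x))}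
    \<le> exp (a * (exp s - 1) - s * T)"
proof -
  let ?M = "Pi_pmf A False (\<lambda>x. bernoulli_pmf (p x))"
  have finM: "finite (set_pmf ?M)" using fin by (intro finite_set_Pi_pmf) auto
  have prod_eq: "exp (s * (\<Sum>x\<in>S. of_bool (f x))) = (\<Prod>x\<in>A. if x \<in> S then exp (s * of_bool (f x)) else 1)" for f
  proof -
    have "(\<Prod>x\<in>A. if x \<in> S then exp (s * of_bool (f x)) else 1) = (\<Prod>x\<in>S. exp (s * of_bool (f x)))"
      using fin S by (subst prod.inter_restrict[symmetric]) (auto simp: Int_absorb1)
    moreover have "finite S" using fin S by (rule finite_subset[rotated])
    ultimately show ?thesis by (simp only: sum_distrib_left exp_sum)
  qed
  have "measure_pmf.prob ?M {f. T \<le> (\<Sum>x\<in>S. of_bool (f x))} \<le>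
      measure_pmf.prob ?M {f. exp (s * T) \<le> exp (s * (\<Sum>x\<in>S. of_bool (f x)))}"
    using s by (intro measure_pmf.finite_measure_mono) (auto intro: mult_left_mono)
  also have "\<dots> \<le> measure_pmf.expectation ?M (\<lambda>f. exp (s * (\<Sum>x\<in>S. of_bool (f x)))) / exp (s * T)"
    by (rule markov_finite_pmf[OF finM]) auto
  also have "measure_pmf.expectation ?M (\<lambda>f. exp (s * (\<Sum>x\<in>S. of_bool (f x)))) =
      (\<Prod>x\<in>A. measure_pmf.expectation (bernoulli_pmf (p x)) (\<lambda>b. if x \<in> S then exp (s * of_bool b) else 1))"
    unfolding prod_eq using fin by (intro expectation_prod_Pi_pmf_finite) auto
  also have "\<dots> \<le> (\<Prod>x\<in>A. if x \<in> S then exp (p x * (exp s - 1)) else 1)"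
  proof (rule prod_mono)
    fix x assume x: "x \<in> A"
    have "exp s * p x + (1 - p x) = 1 + p x * (exp s - 1)" by (simp add: algebra_simps)
    also have "\<dots> \<le> exp (p x * (exp s - 1))" by (rule exp_ge_add_one_self)
    finally have "exp s * p x + (1 - p x) \<le> exp (p x * (exp s - 1))" .
    moreover have "0 \<le> exp s * p x + (1 - p x)" using p[OF x] by (intro add_nonneg_nonneg) auto
    ultimately show "0 \<le> measure_pmf.expectation (bernoulli_pmf (p x)) (\<lambda>b. if x \<in> S then exp (s * of_bool b) else 1)
      \<and> measure_pmf.expectation (bernoulli_pmf (p x)) (\<lambda>b. if x \<in> S then exp (s * of_bool b) else 1)
        \<le> (if x \<in> S then exp (p x * (exp s - 1)) else 1)"
      using p[OF x] by auto
  qed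
  also have "\<dots> = exp ((\<Sum>x\<in>S. p x) * (exp s - 1))"
  proof -
    have "(\<Prod>x\<in>A. if x \<in> S then exp (p x * (exp s - 1)) else 1) = (\<Prod>x\<in>S. exp (p x * (exp s - 1)))"
      using fin S by (subst prod.inter_restrict[symmetric]) (auto simp: Int_absorb1)
    then show ?thesis using fin S by (simp add: sum_distrib_right exp_sum finite_subset)
  qed
  also have "\<dots> \<le> exp (a * (exp s - 1))" using a s by (simp add: mult_right_mono)
  finally show ?thesis by (simp add: exp_diff divide_right_mono)
qed

text \<open>Non-backtracking walks that change sides at every step, the only ones with nonzero
  weight in the block matrix.\<close>

fun alternating :: "'a + 'b \<Rightarrow> 'a + 'b \<Rightarrow> ('a + 'b) list \<Rightarrow> bool" where
  "alternating x0 x [] \<longleftrightarrow> True"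
| "alternating x0 x (w # ws) \<longleftrightarrow> w \<noteq> x0 \<and> isl w \<noteq> isl x \<and> alternating x w ws"

lemma nb_weight_not_alternating:
  "\<not> alternating x0 x ws \<Longrightarrow> nb_weight (bipartite_weight X) x0 x ws = 0"
proof (induction ws arbitrary: x0 x)
  case (Cons w ws)
  have "bipartite_weight X x w = 0" if "isl w = isl x"
    using that by (cases x; cases w) auto
  then show ?case using Cons by auto
qed simp

text \<open>The weights of walks depend only on the final traversal counts. With powers of the
  entries as \<open>g\<close> this is the matrix weight, in a form to which independence applies;
  with \<open>p\<close> charged once per used edge it is \<open>walk_weight\<close>.\<close>

definition edge_prod :: "'a set \<Rightarrow> 'b set \<Rightarrow> ('a \<Rightarrow> 'b \<Rightarrow> nat \<Rightarrow> real) \<Rightarrow> ('a + 'b \<Rightarrow> 'a + 'b \<Rightarrow> nat) \<Rightarrow> real" where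
  "edge_prod I J g m = (\<Prod>(i, j)\<in>I \<times> J. g i j (m (Inl i) (Inr j)))"

lemma edge_prod_traverse:
  assumes fin: "finite I" "finite J" and i: "i \<in> I" "j \<in> J"
    and g: "g i j (Suc (m (Inl i) (Inr j))) = c * g i j (m (Inl i) (Inr j))"
  shows "edge_prod I J g (traverse m (Inl i) (Inr j)) = c * edge_prod I J g m"
proof -
  let ?m = "traverse m (Inl i) (Inr j)"
  have split: "edge_prod I J g m = g i j (m (Inl i) (Inr j)) *
      (\<Prod>e\<in>I \<times> J - {(i, j)}. case e of (a, b) \<Rightarrow> g a b (m (Inl a) (Inr b)))" for m
    unfolding edge_prod_def using fin i by (subst prod.remove[of _ "(i, j)"]) auto
  have rest: "(\<Prod>e\<in>I \<times> J - {(i, j)}. case e of (a, b) \<Rightarrow> g a b (?m (Inl a) (Inr b))) =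
      (\<Prod>e\<in>I \<times> J - {(i, j)}. case e of (a, b) \<Rightarrow> g a b (m (Inl a) (Inr b)))"
    by (rule prod.cong[OF refl]) (auto simp: traverse_def split: if_splits)
  have new: "?m (Inl i) (Inr j) = Suc (m (Inl i) (Inr j))" by (simp add: traverse_def)
  show ?thesis unfolding split[of ?m] rest new g split[of m] by (simp add: mult.assoc)
qed

lemma edge_prod_traverse_step:
  assumes fin: "finite I" "finite J" and V: "x \<in> I <+> J" "w \<in> I <+> J" and ne: "isl w \<noteq> isl x"
    and sym: "m x w = m w x"
    and g: "\<And>i j. (x = Inl i \<and> w = Inr j) \<or> (x = Inr j \<and> w = Inl i) \<Longrightarrow>
      g i j (Suc (m x w)) = c * g i j (m x w)"
  shows "edge_prod I J g (traverse m x w) = c * edge_prod I J g m"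
proof (cases x)
  case (Inl i)
  then obtain j where j: "w = Inr j" using ne by (cases w) auto
  show ?thesis unfolding Inl j
    by (rule edge_prod_traverse[OF fin]) (use V g[of i j] Inl j in auto)
next
  case (Inr j)
  then obtain i where i: "w = Inl i" using ne by (cases w) auto
  show ?thesis unfolding Inr i traverse_commute[of m "Inr j"]
    by (rule edge_prod_traverse[OF fin]) (use V g[of i j] sym Inr i in auto)
qed

lemma edge_prod_nb_weight:
  assumes fin: "finite I" "finite J"
  shows "alternating x0 x ws \<Longrightarrow> x \<in> I <+> J \<Longrightarrow> set ws \<subseteq> I <+> J \<Longrightarrow> (\<And>u v. m u v = m v u) \<Longrightarrow>
    edge_prod I J (\<lambda>i j k. X i j ^ k) (traverse_walk m x ws) =
      nb_weight (bipartite_weight X) x0 x ws * edge_prod I J (\<lambda>i j k. X i j ^ k) m"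
proof (induction ws arbitrary: m x0 x)
  case (Cons w ws)
  have w: "w \<in> I <+> J" "w \<noteq> x0" "isl w \<noteq> isl x" "w \<noteq> x" "alternating x w ws" "set ws \<subseteq> I <+> J"
    using Cons.prems by auto
  have "edge_prod I J (\<lambda>i j k. X i j ^ k) (traverse m x w) =
      bipartite_weight X x w * edge_prod I J (\<lambda>i j k. X i j ^ k) m"
    by (rule edge_prod_traverse_step[OF fin Cons.prems(2) w(1,3) Cons.prems(4)]) auto
  moreover have "edge_prod I J (\<lambda>i j k. X i j ^ k) (traverse_walk (traverse m x w) w ws) =
      nb_weight (bipartite_weight X) x w ws * edge_prod I J (\<lambda>i j k. X i j ^ k) (traverse m x w)"
    by (rule Cons.IH[OF w(5,1,6)]) (rule traverse_sym, rule Cons.prems(4))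
  ultimately show ?case using w by simp
qed simp

lemma edge_prod_walk_weight:
  assumes fin: "finite I" "finite J"
  shows "alternating x0 x ws \<Longrightarrow> x \<in> I <+> J \<Longrightarrow> set ws \<subseteq> I <+> J \<Longrightarrow> (\<And>u v. m u v = m v u) \<Longrightarrow>
    edge_prod I J (\<lambda>i j k. if k = 0 then 1 else p i j) (traverse_walk m x ws) =
      walk_weight (bipartite_weight p) m x0 x ws * edge_prod I J (\<lambda>i j k. if k = 0 then 1 else p i j) m"
proof (induction ws arbitrary: m x0 x)
  case (Cons w ws)
  let ?g = "\<lambda>i j k. if k = 0 then 1 else p i j"
  have w: "w \<in> I <+> J" "w \<noteq> x0" "isl w \<noteq> isl x" "w \<noteq> x" "alternating x w ws" "set ws \<subseteq> I <+> J"
    using Cons.prems by auto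
  have "edge_prod I J ?g (traverse m x w) =
      (if m x w = 0 then bipartite_weight p x w else 1) * edge_prod I J ?g m"
    by (rule edge_prod_traverse_step[OF fin Cons.prems(2) w(1,3) Cons.prems(4)]) auto
  moreover have "edge_prod I J ?g (traverse_walk (traverse m x w) w ws) =
      walk_weight (bipartite_weight p) (traverse m x w) x w ws * edge_prod I J ?g (traverse m x w)"
    by (rule Cons.IH[OF w(5,1,6)]) (rule traverse_sym, rule Cons.prems(4))
  ultimately show ?case using w by simp
qed simp

lemma traverse_walk_sym:
  assumes "\<And>u v. m u v = m v u"
  shows "traverse_walk m x ws u v = traverse_walk m x ws v u"
  using assms
proof (induction ws arbitrary: m x)
  case (Cons w ws)
  have "traverse m x w a b = traverse m x w b a" for a b
    by (rule traverse_sym, rule Cons.prems)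
  then show ?case unfolding traverse_walk.simps by (rule Cons.IH)
qed simp

text \<open>Independence only speaks of pairs in \<open>I \<times> J\<close>, whereas
  \<open>no_open_edge\<close> quantifies over all pairs of vertices; this settles the pairs on one
  side.\<close>

lemma traverse_walk_same_side:
  assumes "alternating x0 x ws" "\<And>u v. isl u = isl v \<Longrightarrow> m u v = 0" "isl u = isl v"
  shows "traverse_walk m x ws u v = 0"
  using assms(1,2)
proof (induction ws arbitrary: m x0 x)
  case Nil
  then show ?case using assms(3) by simp
next
  case (Cons w ws)
  have "traverse m x w a b = 0" if "isl a = isl b" for a b
    using Cons.prems that by (auto simp: traverse_def)
  then show ?case unfolding traverse_walk.simps using Cons.prems(1)
    by (intro Cons.IH[where ?x0.0 = x]) auto
qed

definition edge_pmf :: "'a set \<Rightarrow> 'b set \<Rightarrow> ('a \<Rightarrow> 'b \<Rightarrow> real) \<Rightarrow> ('a \<times> 'b \<Rightarrow> bool) pmf" where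
  "edge_pmf I J p = Pi_pmf (I \<times> J) False (\<lambda>(i, j). bernoulli_pmf (p i j))"

text \<open>The value 0 outside \<open>I \<times> J\<close> makes the entries bounded by 1 for all
  indices, as \<open>bipartite_operator_norm_le\<close> demands.\<close>

definition centered_entry :: "'a set \<Rightarrow> 'b set \<Rightarrow> ('a \<Rightarrow> 'b \<Rightarrow> real) \<Rightarrow> ('a \<times> 'b \<Rightarrow> bool) \<Rightarrow> 'a \<Rightarrow> 'b \<Rightarrow> real" where
  "centered_entry I J p f i j = (if i \<in> I \<and> j \<in> J then of_bool (f (i, j)) - p i j else 0)"

lemma finite_edge_pmf: "finite I \<Longrightarrow> finite J \<Longrightarrow> finite (set_pmf (edge_pmf I J p))"
  unfolding edge_pmf_def by (intro finite_set_Pi_pmf) auto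

lemma expectation_edge_prod_le:
  assumes fin: "finite I" "finite J"
    and p: "\<And>i j. i \<in> I \<Longrightarrow> j \<in> J \<Longrightarrow> 0 \<le> p i j \<and> p i j \<le> 1"
  shows "measure_pmf.expectation (edge_pmf I J p)
      (\<lambda>f. edge_prod I J (\<lambda>i j k. centered_entry I J p f i j ^ k) m)
    \<le> edge_prod I J (\<lambda>i j k. if k = 0 then 1 else p i j) m *
       of_bool (\<forall>i\<in>I. \<forall>j\<in>J. m (Inl i) (Inr j) \<noteq> 1)"
proof -
  let ?M = "edge_pmf I J p"
  let ?k = "\<lambda>e. m (Inl (fst e)) (Inr (snd e))"
  let ?B = "\<lambda>e. measure_pmf.expectation (bernoulli_pmf (p (fst e) (snd e)))
    (\<lambda>b. (of_bool b - p (fst e) (snd e)) ^ ?k e)"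
  let ?b = "\<lambda>e. if ?k e = 0 then 1 else if ?k e = 1 then 0 else p (fst e) (snd e)"
  have "measure_pmf.expectation ?M (\<lambda>f. edge_prod I J (\<lambda>i j k. centered_entry I J p f i j ^ k) m) =
      measure_pmf.expectation ?M (\<lambda>f. \<Prod>e\<in>I \<times> J. (of_bool (f e) - p (fst e) (snd e)) ^ ?k e)"
    unfolding edge_prod_def
    by (rule Bochner_Integration.integral_cong[OF refl], rule prod.cong[OF refl])
       (auto simp: centered_entry_def)
  also have "\<dots> = (\<Prod>e\<in>I \<times> J. ?B e)"
    unfolding edge_pmf_def case_prod_unfold using fin by (intro expectation_prod_Pi_pmf_finite) auto
  also have "\<dots> \<le> \<bar>\<Prod>e\<in>I \<times> J. ?B e\<bar>" by (rule abs_ge_self)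
  also have "\<dots> = (\<Prod>e\<in>I \<times> J. \<bar>?B e\<bar>)" by (rule abs_prod)
  also have "\<dots> \<le> (\<Prod>e\<in>I \<times> J. ?b e)"
  proof (rule prod_mono)
    fix e assume "e \<in> I \<times> J"
    then have "0 \<le> p (fst e) (snd e) \<and> p (fst e) (snd e) \<le> 1" using p by auto
    then show "0 \<le> \<bar>?B e\<bar> \<and> \<bar>?B e\<bar> \<le> ?b e"
      by (intro conjI abs_ge_zero centered_bernoulli_moment_le) auto
  qed
  also have "\<dots> \<le> edge_prod I J (\<lambda>i j k. if k = 0 then 1 else p i j) m *
       of_bool (\<forall>i\<in>I. \<forall>j\<in>J. m (Inl i) (Inr j) \<noteq> 1)"
  proof (cases "\<forall>i\<in>I. \<forall>j\<in>J. m (Inl i) (Inr j) \<noteq> 1")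
    case True
    have "(\<Prod>e\<in>I \<times> J. ?b e) = edge_prod I J (\<lambda>i j k. if k = 0 then 1 else p i j) m"
      unfolding edge_prod_def using True by (intro prod.cong refl) auto
    then show ?thesis using True by simp
  next
    case False
    then obtain i j where ij: "(i, j) \<in> I \<times> J" "m (Inl i) (Inr j) = 1" by auto
    have "(\<Prod>e\<in>I \<times> J. ?b e) = 0"
      using fin by (intro prod_zero bexI[OF _ ij(1)]) (simp_all add: ij(2))
    then show ?thesis using False by (simp only: of_bool_eq mult_zero_right order_refl)
  qed
  finally show ?thesis .
qed

text \<open>For alternating walks both sides are edge products of the counts left by the pair;
  otherwise the left-hand side is 0.\<close>

lemma expectation_nb_pair_le:
  assumes fin: "finite I" "finite J"
    and p: "\<And>i j. i \<in> I \<Longrightarrow> j \<in> J \<Longrightarrow> 0 \<le> p i j \<and> p i j \<le> 1"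
    and y: "y \<in> I <+> J" and xs: "set xs \<subseteq> I <+> J" and ys: "set ys \<subseteq> I <+> J"
  shows "measure_pmf.expectation (edge_pmf I J p)
      (\<lambda>f. nb_weight (bipartite_weight (centered_entry I J p f)) x y xs *
           nb_weight (bipartite_weight (centered_entry I J p f)) x y ys)
    \<le> walk_weight (bipartite_weight p) (\<lambda>_ _. 0) x y xs *
      (walk_weight (bipartite_weight p) (traverse_walk (\<lambda>_ _. 0) y xs) x y ys *
       of_bool (no_open_edge (I <+> J) (traverse_walk (traverse_walk (\<lambda>_ _. 0) y xs) y ys)))"
proof -
  define o0 :: "'a + 'b \<Rightarrow> 'a + 'b \<Rightarrow> nat" where "o0 = (\<lambda>_ _. 0)"
  define m1 where "m1 = traverse_walk o0 y xs"
  define m2 where "m2 = traverse_walk m1 y ys"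
  let ?H = "\<lambda>f. bipartite_weight (centered_entry I J p f)"
  have bp: "0 \<le> bipartite_weight p u v" if "u \<in> I <+> J" "v \<in> I <+> J" for u v
    using p that by (cases u; cases v) auto
  have ww: "0 \<le> walk_weight (bipartite_weight p) m x y ws" if "set ws \<subseteq> I <+> J" for m ws
    using that y by (induction ws arbitrary: m x y) (auto intro!: mult_nonneg_nonneg bp)
  have rhs: "0 \<le> walk_weight (bipartite_weight p) o0 x y xs *
      (walk_weight (bipartite_weight p) m1 x y ys * of_bool (no_open_edge (I <+> J) m2))"
    by (intro mult_nonneg_nonneg ww xs ys) simp
  have "measure_pmf.expectation (edge_pmf I J p) (\<lambda>f. nb_weight (?H f) x y xs * nb_weight (?H f) x y ys)
    \<le> walk_weight (bipartite_weight p) o0 x y xs *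
      (walk_weight (bipartite_weight p) m1 x y ys * of_bool (no_open_edge (I <+> J) m2))"
  proof (cases "alternating x y xs \<and> alternating x y ys")
    case False
    then have e: "(\<lambda>f. nb_weight (?H f) x y xs * nb_weight (?H f) x y ys) = (\<lambda>f. 0)"
      by (auto simp: nb_weight_not_alternating)
    show ?thesis unfolding e using rhs by (simp only: integral_zero)
  next
    case True
    then have alt: "alternating x y xs" "alternating x y ys" by auto
    have sym0: "o0 u v = o0 v u" for u v by (simp add: o0_def)
    have sym1: "m1 u v = m1 v u" for u v unfolding m1_def by (rule traverse_walk_sym, rule sym0)
    have sym2: "m2 u v = m2 v u" for u v unfolding m2_def by (rule traverse_walk_sym, rule sym1)
    have one: "edge_prod I J g o0 = 1" if "\<And>i j. g i j 0 = 1" for g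
      using that by (simp add: edge_prod_def o0_def)
    have G: "nb_weight (?H f) x y xs * nb_weight (?H f) x y ys =
        edge_prod I J (\<lambda>i j k. centered_entry I J p f i j ^ k) m2" for f
      unfolding m2_def edge_prod_nb_weight[OF fin alt(2) y ys sym1]
      unfolding m1_def edge_prod_nb_weight[OF fin alt(1) y xs sym0]
      by (simp add: one mult.commute)
    have W: "edge_prod I J (\<lambda>i j k. if k = 0 then 1 else p i j) m2 =
        walk_weight (bipartite_weight p) o0 x y xs * walk_weight (bipartite_weight p) m1 x y ys"
      unfolding m2_def edge_prod_walk_weight[OF fin alt(2) y ys sym1]
      unfolding m1_def edge_prod_walk_weight[OF fin alt(1) y xs sym0]
      by (simp add: one mult.commute)
    have same1: "m1 u v = 0" if "isl u = isl v" for u v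
      unfolding m1_def by (rule traverse_walk_same_side[OF alt(1) _ that]) (simp add: o0_def)
    have same2: "m2 u v = 0" if "isl u = isl v" for u v
      unfolding m2_def by (rule traverse_walk_same_side[OF alt(2) same1 that])
    have "no_open_edge (I <+> J) m2" if *: "\<forall>i\<in>I. \<forall>j\<in>J. m2 (Inl i) (Inr j) \<noteq> 1"
      unfolding no_open_edge_def
    proof (intro ballI)
      fix u v assume uv: "u \<in> I <+> J" "v \<in> I <+> J"
      show "m2 u v \<noteq> 1"
      proof (cases "isl u = isl v")
        case True
        then show ?thesis using same2 by simp
      next
        case False
        then show ?thesis using uv * sym2[of u v] by (cases u; cases v) auto
      qed
    qed
    then have "of_bool (\<forall>i\<in>I. \<forall>j\<in>J. m2 (Inl i) (Inr j) \<noteq> 1) \<le> (of_bool (no_open_edge (I <+> J) m2) :: real)"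
      by auto
    then have "edge_prod I J (\<lambda>i j k. if k = 0 then 1 else p i j) m2 *
        of_bool (\<forall>i\<in>I. \<forall>j\<in>J. m2 (Inl i) (Inr j) \<noteq> 1)
      \<le> edge_prod I J (\<lambda>i j k. if k = 0 then 1 else p i j) m2 * of_bool (no_open_edge (I <+> J) m2)"
      unfolding W by (rule mult_left_mono) (intro mult_nonneg_nonneg ww xs ys)
    moreover have "measure_pmf.expectation (edge_pmf I J p)
        (\<lambda>f. edge_prod I J (\<lambda>i j k. centered_entry I J p f i j ^ k) m2)
      \<le> edge_prod I J (\<lambda>i j k. if k = 0 then 1 else p i j) m2 *
        of_bool (\<forall>i\<in>I. \<forall>j\<in>J. m2 (Inl i) (Inr j) \<noteq> 1)"
      by (rule expectation_edge_prod_le[OF fin]) (rule p)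
    ultimately have "measure_pmf.expectation (edge_pmf I J p)
        (\<lambda>f. edge_prod I J (\<lambda>i j k. centered_entry I J p f i j ^ k) m2)
      \<le> edge_prod I J (\<lambda>i j k. if k = 0 then 1 else p i j) m2 * of_bool (no_open_edge (I <+> J) m2)"
      by (rule order_trans[rotated])
    then show ?thesis unfolding G W by (simp only: mult.assoc)
  qed
  then show ?thesis by (simp only: m2_def m1_def o0_def)
qed

theorem expectation_nb_frobenius_le:
  fixes I :: "'a set" and J :: "'b set"
  assumes fin: "finite I" "finite J"
    and p: "\<And>i j. i \<in> I \<Longrightarrow> j \<in> J \<Longrightarrow> 0 \<le> p i j \<and> p i j \<le> 1"
    and wc: "walk_counting (I <+> J) (bipartite_weight p) c \<theta> \<mu> \<epsilon> \<delta> q R cmax \<Lambda> Em (2 * l)"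
  shows "measure_pmf.expectation (edge_pmf I J p)
      (\<lambda>f. nb_frobenius (I <+> J) (bipartite_weight (centered_entry I J p f)) l)
    \<le> (real (card I + card J))\<^sup>2 * (2 * cmax * \<Lambda> ^ (2 * l))"
proof -
  let ?M = "edge_pmf I J p" and ?V = "I <+> J"
  let ?H = "\<lambda>f. bipartite_weight (centered_entry I J p f)"
  have int: "integrable (measure_pmf ?M) h" for h :: "_ \<Rightarrow> real"
    using finite_edge_pmf[OF fin] by (rule integrable_measure_pmf_finite)
  have finV: "finite ?V" using fin by simp
  have "measure_pmf.expectation ?M (\<lambda>f. nb_frobenius ?V (?H f) l) =
    (\<Sum>x\<in>?V. \<Sum>y\<in>?V. \<Sum>xs\<in>walks ?V l. \<Sum>ys\<in>walks ?V l. measure_pmf.expectation ?M (\<lambda>f.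
     if last_edge x y xs = last_edge x y ys then nb_weight (?H f) x y xs * nb_weight (?H f) x y ys else 0))"
    unfolding nb_frobenius_def by (simp add: Bochner_Integration.integral_sum int)
  also have "\<dots> \<le> (\<Sum>x\<in>?V. \<Sum>y\<in>?V. 2 * cmax * \<Lambda> ^ (2 * l))"
  proof (intro sum_mono)
    fix x y assume x: "x \<in> ?V" and y: "y \<in> ?V"
    have "(\<Sum>xs\<in>walks ?V l. \<Sum>ys\<in>walks ?V l. measure_pmf.expectation ?M (\<lambda>f.
       if last_edge x y xs = last_edge x y ys then nb_weight (?H f) x y xs * nb_weight (?H f) x y ys else 0))
      \<le> (\<Sum>xs\<in>walks ?V l. \<Sum>ys\<in>walks ?V l.
        walk_weight (bipartite_weight p) (\<lambda>_ _. 0) x y xs *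
        (walk_weight (bipartite_weight p) (traverse_walk (\<lambda>_ _. 0) y xs) x y ys *
         of_bool (no_open_edge ?V (traverse_walk (traverse_walk (\<lambda>_ _. 0) y xs) y ys))))"
    proof (intro sum_mono)
      fix xs ys assume xs: "xs \<in> walks ?V l" and ys: "ys \<in> walks ?V l"
      then have sub: "set xs \<subseteq> ?V" "set ys \<subseteq> ?V" by (auto simp: walks_def)
      have nn: "0 \<le> walk_weight (bipartite_weight p) m x y ws" if "set ws \<subseteq> ?V" for m ws
        by (rule walk_counting.walk_weight_nonneg[OF wc y that])
      show "measure_pmf.expectation ?M (\<lambda>f.
         if last_edge x y xs = last_edge x y ys then nb_weight (?H f) x y xs * nb_weight (?H f) x y ys else 0)
        \<le> walk_weight (bipartite_weight p) (\<lambda>_ _. 0) x y xs *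
        (walk_weight (bipartite_weight p) (traverse_walk (\<lambda>_ _. 0) y xs) x y ys *
         of_bool (no_open_edge ?V (traverse_walk (traverse_walk (\<lambda>_ _. 0) y xs) y ys)))"
      \<comment> \<open>The condition of a common last edge is given up here. It is safe because the
        bounds for the excluded pairs are nonnegative.\<close>
      proof (cases "last_edge x y xs = last_edge x y ys")
        case True
        have "measure_pmf.expectation ?M (\<lambda>f. nb_weight (?H f) x y xs * nb_weight (?H f) x y ys)
          \<le> walk_weight (bipartite_weight p) (\<lambda>_ _. 0) x y xs *
          (walk_weight (bipartite_weight p) (traverse_walk (\<lambda>_ _. 0) y xs) x y ys *
           of_bool (no_open_edge ?V (traverse_walk (traverse_walk (\<lambda>_ _. 0) y xs) y ys)))"
          by (rule expectation_nb_pair_le[OF fin _ y sub]) (rule p)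
        then show ?thesis using True by (simp only: if_True simp_thms)
      next
        case False
        have "0 \<le> walk_weight (bipartite_weight p) (\<lambda>_ _. 0) x y xs *
          (walk_weight (bipartite_weight p) (traverse_walk (\<lambda>_ _. 0) y xs) x y ys *
           of_bool (no_open_edge ?V (traverse_walk (traverse_walk (\<lambda>_ _. 0) y xs) y ys)))"
          by (intro mult_nonneg_nonneg nn sub) simp
        then show ?thesis using False by (simp only: if_False integral_zero)
      qed
    qed
    also have "\<dots> \<le> 2 * cmax * \<Lambda> ^ (2 * l)"
      by (rule walk_counting.closed_walk_pair_sum_le[OF wc x y refl])
    finally show "(\<Sum>xs\<in>walks ?V l. \<Sum>ys\<in>walks ?V l. measure_pmf.expectation ?M (\<lambda>f.
       if last_edge x y xs = last_edge x y ys then nb_weight (?H f) x y xs * nb_weight (?H f) x y ys else 0))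
      \<le> 2 * cmax * \<Lambda> ^ (2 * l)" .
  qed
  also have "\<dots> = (real (card I + card J))\<^sup>2 * (2 * cmax * \<Lambda> ^ (2 * l))"
    using fin by (simp add: card_Plus power2_eq_square)
  finally show ?thesis .
qed

text \<open>\<open>\<delta> = 1 / l\<close> keeps the accumulated error bounded over
  \<open>2 * l\<close> steps. \<open>R = 48 * l\<close> covers both lower bounds on \<open>R\<close>
  for \<open>T = 2 * l\<close>, and \<open>\<epsilon>\<close> gives equality in the condition on
  departures. The condition on returns then becomes \<open>sparse\<close>, with
  \<open>18432 = 192 * 96\<close>; the one on excess edges needs the same constant, but only
  \<open>l ^ 4\<close>.\<close>

lemma walk_countingI:
  fixes P :: "'v \<Rightarrow> 'v \<Rightarrow> real"
  assumes fin: "finite V"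
    and P: "\<And>x y. x \<in> V \<Longrightarrow> y \<in> V \<Longrightarrow> 0 \<le> P x y \<and> P x y \<le> q"
    and c: "\<And>x. x \<in> V \<Longrightarrow> 1 \<le> c x \<and> c x \<le> cmax" and cmax: "1 \<le> cmax"
    and Pc: "\<And>x. x \<in> V \<Longrightarrow> (\<Sum>y\<in>V. P x y * c y) \<le> \<theta>\<^sup>2 * c x"
    and \<theta>: "1 \<le> \<theta>" and \<mu>: "0 < \<mu>" and l: "1 \<le> l" and q: "0 \<le> q"
    and Em: "exp (\<mu> * real (2 * l)) \<le> Em"
    and \<Lambda>1: "\<theta> + \<theta> / real l \<le> \<Lambda>" and \<Lambda>2: "\<theta> / 2 + (2 + 1 / \<mu>) + \<theta> / real l \<le> \<Lambda>"
    and sparse: "18432 * cmax * real l ^ 5 * Em\<^sup>2 * q \<le> \<theta>\<^sup>2"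
  shows "walk_counting V P c \<theta> \<mu> (1 / (96 * (real l)\<^sup>2 * cmax * Em)) (1 / real l) q (48 * real l) cmax \<Lambda> Em (2 * l)"
proof (rule walk_counting.intro)
  have l': "real l \<ge> 1" "real l > 0" using l by auto
  have "1 \<le> exp (\<mu> * real (2 * l))" using \<mu> by simp
  with Em have Em1: "1 \<le> Em" by linarith
  have "1 * 1 * 1 \<le> (real l)\<^sup>2 * cmax * Em" using l' cmax Em1 by (intro mult_mono) auto
  then have "1 \<le> 96 * ((real l)\<^sup>2 * cmax * Em)" by linarith
  then have D: "1 \<le> 96 * (real l)\<^sup>2 * cmax * Em" by (simp only: mult.assoc)
  then have D': "0 < 96 * (real l)\<^sup>2 * cmax * Em" by linarith
  show "0 < 1 / (96 * (real l)\<^sup>2 * cmax * Em)" "1 / (96 * (real l)\<^sup>2 * cmax * Em) \<le> 1" using D D' by auto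
  show "1 / (96 * (real l)\<^sup>2 * cmax * Em) * cmax * (48 * real l * Em) \<le> 1 / real l / 2"
    using l' cmax Em1 by (simp add: power2_eq_square)
  show "2 * real (2 * l) * q * (48 * real l * Em)\<^sup>2 \<le> 1 / real l / 2 * \<theta>\<^sup>2"
  proof -
    have "2 * real (2 * l) * q * (48 * real l * Em)\<^sup>2 * (2 * real l) = 18432 * 1 * real l ^ 4 * Em\<^sup>2 * q"
      by (simp add: power2_eq_square power4_eq_xxxx)
    also have "\<dots> \<le> 18432 * cmax * real l ^ 5 * Em\<^sup>2 * q"
      using l' cmax q by (intro mult_right_mono mult_mono power_increasing) auto
    also note sparse
    finally show ?thesis using l' by (simp add: field_simps)
  qed
  show "2 * real (2 * l) * q * (48 * real l * Em) \<le> 1 / real l * \<theta>\<^sup>2 * (1 / (96 * (real l)\<^sup>2 * cmax * Em))"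
  proof -
    have "2 * real (2 * l) * q * (48 * real l * Em) * (real l * (96 * (real l)\<^sup>2 * cmax * Em)) =
        18432 * cmax * real l ^ 5 * Em\<^sup>2 * q"
      by (simp add: power2_eq_square eval_nat_numeral)
    also note sparse
    finally have "2 * real (2 * l) * q * (48 * real l * Em) * (real l * (96 * (real l)\<^sup>2 * cmax * Em)) \<le> \<theta>\<^sup>2" .
    then have "2 * real (2 * l) * q * (48 * real l * Em) \<le> \<theta>\<^sup>2 / (real l * (96 * (real l)\<^sup>2 * cmax * Em))"
      using l' D' by (subst pos_le_divide_eq) auto
    then show ?thesis by simp
  qed
qed (use assms in auto)

section \<open>From moments to a norm bound\<close>

lemma sum_singleton_Times:
  "(\<Sum>e\<in>{i} \<times> J. g e) = (\<Sum>j\<in>J. g (i, j))" "(\<Sum>e\<in>I \<times> {j}. g e) = (\<Sum>i\<in>I. g (i, j))"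
proof -
  have "{i} \<times> J = Pair i ` J" "I \<times> {j} = (\<lambda>i. (i, j)) ` I" by auto
  then show "(\<Sum>e\<in>{i} \<times> J. g e) = (\<Sum>j\<in>J. g (i, j))" "(\<Sum>e\<in>I \<times> {j}. g e) = (\<Sum>i\<in>I. g (i, j))"
    by (simp_all add: sum.reindex inj_on_def)
qed

text \<open>A union bound over three kinds of failure: a row of high degree, a column of high
  degree, and a large Frobenius norm, the last by Markov's inequality. The parameters stay free
  because the dense and the sparse case choose them differently.\<close>

lemma high_probability_general:
  fixes I :: "'a set" and J :: "'b set"
  assumes fin: "finite I" "finite J"
    and p: "\<And>i j. i \<in> I \<Longrightarrow> j \<in> J \<Longrightarrow> 0 \<le> p i j \<and> p i j \<le> 1 \<and> p i j \<le> q"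
    and row: "\<And>i. i \<in> I \<Longrightarrow> (\<Sum>j\<in>J. p i j) \<le> a" and col: "\<And>j. j \<in> J \<Longrightarrow> (\<Sum>i\<in>I. p i j) \<le> b"
    and q: "0 \<le> q" "q * a \<le> 1" "q * b \<le> 1" and s: "0 \<le> s" and a': "1 \<le> a'" and b': "1 \<le> b'"
    and wc: "walk_counting (I <+> J) (bipartite_weight p) c \<theta> \<mu> \<epsilon> \<delta> q' R cmax \<Lambda> Em (2 * l)"
  shows "measure_pmf.prob (edge_pmf I J p) {f. \<forall>v. (\<Sum>i\<in>I. (\<Sum>j\<in>J. centered_entry I J p f i j * v j)\<^sup>2)
        \<le> (sqrt a' + sqrt b' + 2)\<^sup>2 * (\<Sum>j\<in>J. (v j)\<^sup>2)}
    \<ge> 1 - (real (card I) * exp (a * (exp s - 1) - s * (a' - 1)) + real (card J) * exp (b * (exp s - 1) - s * (b' - 1))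
        + (real (card I + card J))\<^sup>2 * (2 * cmax * \<Lambda> ^ (2 * l)) / (1 + sqrt (a' * b')) ^ l)"
proof -
  let ?M = "edge_pmf I J p"
  let ?X = "centered_entry I J p"
  define good where "good = {f. \<forall>v. (\<Sum>i\<in>I. (\<Sum>j\<in>J. ?X f i j * v j)\<^sup>2)
        \<le> (sqrt a' + sqrt b' + 2)\<^sup>2 * (\<Sum>j\<in>J. (v j)\<^sup>2)}"
  define rowbad where "rowbad i = {f :: 'a \<times> 'b \<Rightarrow> bool. a' - 1 \<le> (\<Sum>e\<in>{i} \<times> J. of_bool (f e))}" for i
  define colbad where "colbad j = {f :: 'a \<times> 'b \<Rightarrow> bool. b' - 1 \<le> (\<Sum>e\<in>I \<times> {j}. of_bool (f e))}" for j
  define frobbad where "frobbad = {f. (1 + sqrt (a' * b')) ^ l \<le> nb_frobenius (I <+> J) (bipartite_weight (?X f)) l}"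
  have p01: "0 \<le> p i j \<and> p i j \<le> 1" if "i \<in> I" "j \<in> J" for i j using p that by blast
  have bnd: "\<bar>?X f i j\<bar> \<le> 1" for f i j
    using p01[of i j] by (auto simp: centered_entry_def)
  \<comment> \<open>Squared entries exceed the edge indicators by at most \<open>q * p i j\<close>,
    in total at most 1 per row or column. This is why the degrees are compared with
    \<open>a' - 1\<close> and \<open>b' - 1\<close>.\<close>
  have sq: "(?X f i j)\<^sup>2 \<le> of_bool (f (i, j)) + q * p i j" if "i \<in> I" "j \<in> J" for f i j
  proof -
    have pp: "p i j * p i j \<le> q * p i j" using p[OF that] by (intro mult_right_mono) auto
    then show ?thesis using that p[OF that]
      by (cases "f (i, j)") (auto simp: centered_entry_def power2_eq_square algebra_simps)
  qed
  have "- good \<subseteq> (\<Union>i\<in>I. rowbad i) \<union> (\<Union>j\<in>J. colbad j) \<union> frobbad"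
  proof (rule ccontr)
    assume "\<not> - good \<subseteq> (\<Union>i\<in>I. rowbad i) \<union> (\<Union>j\<in>J. colbad j) \<union> frobbad"
    then obtain f where f: "f \<notin> good" "\<And>i. i \<in> I \<Longrightarrow> f \<notin> rowbad i" "\<And>j. j \<in> J \<Longrightarrow> f \<notin> colbad j" "f \<notin> frobbad"
      by blast
    have R: "(\<Sum>j\<in>J. (?X f i j)\<^sup>2) \<le> a'" if i: "i \<in> I" for i
    proof -
      have "(\<Sum>j\<in>J. (?X f i j)\<^sup>2) \<le> (\<Sum>j\<in>J. of_bool (f (i, j)) + q * p i j)"
        by (intro sum_mono sq i)
      also have "\<dots> = (\<Sum>e\<in>{i} \<times> J. of_bool (f e)) + q * (\<Sum>j\<in>J. p i j)"
        by (simp only: sum.distrib sum_distrib_left sum_singleton_Times)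
      also have "\<dots> \<le> (a' - 1) + q * a"
        using f(2)[OF i] row[OF i] q by (intro add_mono mult_left_mono) (auto simp: rowbad_def)
      finally show ?thesis using q by linarith
    qed
    have C: "(\<Sum>i\<in>I. (?X f i j)\<^sup>2) \<le> b'" if j: "j \<in> J" for j
    proof -
      have "(\<Sum>i\<in>I. (?X f i j)\<^sup>2) \<le> (\<Sum>i\<in>I. of_bool (f (i, j)) + q * p i j)"
        by (intro sum_mono sq j)
      also have "\<dots> = (\<Sum>e\<in>I \<times> {j}. of_bool (f e)) + q * (\<Sum>i\<in>I. p i j)"
        by (simp only: sum.distrib sum_distrib_left sum_singleton_Times)
      also have "\<dots> \<le> (b' - 1) + q * b"
        using f(3)[OF j] col[OF j] q by (intro add_mono mult_left_mono) (auto simp: colbad_def)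
      finally show ?thesis using q by linarith
    qed
    have "nb_frobenius (I <+> J) (bipartite_weight (?X f)) l < (1 + sqrt (a' * b')) ^ l"
      using f(4) by (simp add: frobbad_def)
    then have "f \<in> good"
      unfolding good_def using bipartite_operator_norm_le[OF fin bnd a' b' R C] by blast
    with f(1) show False ..
  qed
  then have "measure_pmf.prob ?M (- good) \<le>
      measure_pmf.prob ?M ((\<Union>i\<in>I. rowbad i) \<union> (\<Union>j\<in>J. colbad j) \<union> frobbad)"
    by (intro measure_pmf.finite_measure_mono) auto
  also have "\<dots> \<le> measure_pmf.prob ?M ((\<Union>i\<in>I. rowbad i) \<union> (\<Union>j\<in>J. colbad j)) + measure_pmf.prob ?M frobbad"
    by (intro measure_Un_le) auto
  also have "\<dots> \<le> measure_pmf.prob ?M (\<Union>i\<in>I. rowbad i) + measure_pmf.prob ?M (\<Union>j\<in>J. colbad j)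
      + measure_pmf.prob ?M frobbad"
    by (intro add_right_mono measure_Un_le) auto
  also have "\<dots> \<le> (\<Sum>i\<in>I. measure_pmf.prob ?M (rowbad i)) + (\<Sum>j\<in>J. measure_pmf.prob ?M (colbad j))
      + measure_pmf.prob ?M frobbad"
    using fin by (intro add_mono order_refl measure_UNION_le) auto
  also have "\<dots> \<le> (\<Sum>i\<in>I. exp (a * (exp s - 1) - s * (a' - 1))) + (\<Sum>j\<in>J. exp (b * (exp s - 1) - s * (b' - 1)))
      + (real (card I + card J))\<^sup>2 * (2 * cmax * \<Lambda> ^ (2 * l)) / (1 + sqrt (a' * b')) ^ l"
  proof (intro add_mono sum_mono)
    fix i assume i: "i \<in> I"
    show "measure_pmf.prob ?M (rowbad i) \<le> exp (a * (exp s - 1) - s * (a' - 1))"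
      unfolding edge_pmf_def rowbad_def case_prod_unfold
      by (rule bernoulli_sum_tail) (use fin i p01 row[OF i] s in \<open>auto simp: sum_singleton_Times\<close>)
  next
    fix j assume j: "j \<in> J"
    show "measure_pmf.prob ?M (colbad j) \<le> exp (b * (exp s - 1) - s * (b' - 1))"
      unfolding edge_pmf_def colbad_def case_prod_unfold
      by (rule bernoulli_sum_tail) (use fin j p01 col[OF j] s in \<open>auto simp: sum_singleton_Times\<close>)
  next
    have pos: "0 < (1 + sqrt (a' * b')) ^ l" using a' b' by (intro zero_less_power add_pos_nonneg) auto
    have nn: "0 \<le> nb_frobenius (I <+> J) H l" for H using fin by (intro nb_frobenius_nonneg) simp
    have "measure_pmf.prob ?M frobbad \<le>
        measure_pmf.expectation ?M (\<lambda>f. nb_frobenius (I <+> J) (bipartite_weight (?X f)) l) / (1 + sqrt (a' * b')) ^ l"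
      unfolding frobbad_def using finite_edge_pmf[OF fin] nn pos by (intro markov_finite_pmf)
    also have "\<dots> \<le> (real (card I + card J))\<^sup>2 * (2 * cmax * \<Lambda> ^ (2 * l)) / (1 + sqrt (a' * b')) ^ l"
      using pos by (intro divide_right_mono expectation_nb_frobenius_le[OF fin p01 wc]) auto
    finally show "measure_pmf.prob ?M frobbad \<le>
        (real (card I + card J))\<^sup>2 * (2 * cmax * \<Lambda> ^ (2 * l)) / (1 + sqrt (a' * b')) ^ l" .
  qed
  finally have "measure_pmf.prob ?M (- good) \<le>
      real (card I) * exp (a * (exp s - 1) - s * (a' - 1)) + real (card J) * exp (b * (exp s - 1) - s * (b' - 1))
      + (real (card I + card J))\<^sup>2 * (2 * cmax * \<Lambda> ^ (2 * l)) / (1 + sqrt (a' * b')) ^ l"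
    by simp
  moreover have "measure_pmf.prob ?M (- good) = 1 - measure_pmf.prob ?M good"
    using measure_pmf.prob_compl[of good ?M] by (simp add: Compl_eq_Diff_UNIV)
  ultimately show ?thesis unfolding good_def by linarith
qed

section \<open>Dense and sparse graphs\<close>

text \<open>For \<open>t \<ge> 0\<close>, the event that the operator norm of the centred matrix is
  at most \<open>t\<close>.\<close>

definition norm_le_event :: "'a set \<Rightarrow> 'b set \<Rightarrow> ('a \<Rightarrow> 'b \<Rightarrow> real) \<Rightarrow> real \<Rightarrow> ('a \<times> 'b \<Rightarrow> bool) set" where
  "norm_le_event I J p t = {f. \<forall>v. (\<Sum>i\<in>I. (\<Sum>j\<in>J. centered_entry I J p f i j * v j)\<^sup>2)
        \<le> t\<^sup>2 * (\<Sum>j\<in>J. (v j)\<^sup>2)}"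

lemma norm_le_event_mono:
  assumes "0 \<le> s" "s \<le> t"
  shows "norm_le_event I J p s \<subseteq> norm_le_event I J p t"
proof
  fix f assume f: "f \<in> norm_le_event I J p s"
  have "s\<^sup>2 \<le> t\<^sup>2" using assms by (intro power_mono)
  then have "s\<^sup>2 * (\<Sum>j\<in>J. (v j)\<^sup>2) \<le> t\<^sup>2 * (\<Sum>j\<in>J. (v j)\<^sup>2)" for v
    by (intro mult_right_mono sum_nonneg) auto
  with f show "f \<in> norm_le_event I J p t"
    unfolding norm_le_event_def mem_Collect_eq by (blast intro: order_trans)
qed

text \<open>Constant values on the two sides suffice for the supersolution. The two conditions hold
  with equality for \<open>c1 : c2 = sqrt a : sqrt b\<close> and \<open>t = sqrt (a * b)\<close>,
  which is how \<open>\<theta>\<close> becomes the fourth root of \<open>a * b\<close>.\<close>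

lemma sum_bipartite_weight_le:
  assumes fin: "finite I" "finite J"
    and row: "\<And>i. i \<in> I \<Longrightarrow> (\<Sum>j\<in>J. p i j) \<le> a" and col: "\<And>j. j \<in> J \<Longrightarrow> (\<Sum>i\<in>I. p i j) \<le> b"
    and c: "0 \<le> c1" "0 \<le> c2" "a * c2 \<le> t * c1" "b * c1 \<le> t * c2" and x: "x \<in> I <+> J"
  shows "(\<Sum>y\<in>I <+> J. bipartite_weight p x y * case_sum (\<lambda>_. c1) (\<lambda>_. c2) y) \<le> t * case_sum (\<lambda>_. c1) (\<lambda>_. c2) x"
proof (cases x)
  case (Inl i)
  have "(\<Sum>y\<in>I <+> J. bipartite_weight p x y * case_sum (\<lambda>_. c1) (\<lambda>_. c2) y) = (\<Sum>j\<in>J. p i j) * c2"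
    using fin by (simp add: sum.Plus Inl sum_distrib_right)
  also have "\<dots> \<le> a * c2" using row[of i] x Inl c by (intro mult_right_mono) auto
  finally show ?thesis using c Inl by simp
next
  case (Inr j)
  have "(\<Sum>y\<in>I <+> J. bipartite_weight p x y * case_sum (\<lambda>_. c1) (\<lambda>_. c2) y) = (\<Sum>i\<in>I. p i j) * c1"
    using fin by (simp add: sum.Plus Inr sum_distrib_right)
  also have "\<dots> \<le> b * c1" using col[of j] x Inr c by (intro mult_right_mono) auto
  finally show ?thesis using c Inr by simp
qed

lemma bipartite_weight_bounds:
  assumes "\<And>i j. i \<in> I \<Longrightarrow> j \<in> J \<Longrightarrow> 0 \<le> p i j \<and> p i j \<le> 1 \<and> p i j \<le> q" "0 \<le> q"
    and "x \<in> I <+> J" "y \<in> I <+> J"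
  shows "0 \<le> bipartite_weight p x y \<and> bipartite_weight p x y \<le> q"
  using assms by (cases x; cases y) auto

lemma sqrt_add_le:
  assumes "0 < a" "0 \<le> x"
  shows "sqrt (a + x) \<le> sqrt a + x / (2 * sqrt a)"
proof (rule real_le_lsqrt)
  have "(sqrt a + x / (2 * sqrt a))\<^sup>2 = a + x + (x / (2 * sqrt a))\<^sup>2"
    using assms by (simp add: power2_sum)
  then show "a + x \<le> (sqrt a + x / (2 * sqrt a))\<^sup>2" by simp
qed (use assms in auto)

text \<open>The sparsity condition contains \<open>l ^ 5\<close> with \<open>l\<close> of order
  \<open>sqrt (d * ln N)\<close>, so the power \<open>5 / 2\<close> of \<open>d\<close> has to be
  absorbed by the hypothesis on \<open>q\<close>.\<close>

lemma sqrt_pow5_le_powr: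
  assumes "1 \<le> (d::real)"
  shows "sqrt d ^ 5 \<le> d powr (7 / 2)" "1 \<le> d powr (7 / 2)" "d \<le> d powr (7 / 2)"
proof -
  have "sqrt d ^ 5 = sqrt d powr 5" using assms by simp
  also have "\<dots> = d powr (5 / 2)" using assms by (simp add: powr_half_sqrt[symmetric] powr_powr)
  also have "\<dots> \<le> d powr (7 / 2)" using assms by (intro powr_mono) auto
  finally show "sqrt d ^ 5 \<le> d powr (7 / 2)" .
  show "1 \<le> d powr (7 / 2)" using assms by (intro ge_one_powr_ge_zero) auto
  have "d powr 1 \<le> d powr (7 / 2)" using assms by (intro powr_mono) auto
  then show "d \<le> d powr (7 / 2)" using assms by simp
qed

lemma exp_minus_ln:
  fixes N :: real
  assumes "0 < N"
  shows "exp (- k * ln N) = N powr (- k)"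
  using assms by (simp add: powr_def)

lemma mult_powr_minus:
  fixes N :: real
  assumes N: "0 < N"
  shows "N * N powr (- 4) = N powr (- 3)" "N\<^sup>2 * N powr (- 5) = N powr (- 3)"
proof -
  have "N powr 1 * N powr (- 4) = N powr (- 3)" by (simp only: powr_add[symmetric]) simp
  then show "N * N powr (- 4) = N powr (- 3)" using N by simp
  have "N powr 2 * N powr (- 5) = N powr (- 3)" by (simp only: powr_add[symmetric]) simp
  then show "N\<^sup>2 * N powr (- 5) = N powr (- 3)" using N by simp
qed

text \<open>
  For \<open>\<eta> \<le> 1\<close>, walks of length \<open>l\<close> about \<open>5 ln N / \<eta>\<close> are long enough that raising the degree bounds
  by the factor \<open>exp \<eta>\<close> gains \<open>N\<^sup>5\<close>, which absorbs the polynomial losses of the moment bound.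
\<close>

lemma norm_bound_dense:
  fixes I :: "'a set" and J :: "'b set" and N :: real
  assumes fin: "finite I" "finite J" and card: "real (card I) \<le> N" "real (card J) \<le> N" and N: "0 < N"
    and p: "\<And>i j. i \<in> I \<Longrightarrow> j \<in> J \<Longrightarrow> 0 \<le> p i j \<and> p i j \<le> 1 \<and> p i j \<le> q"
    and row: "\<And>i. i \<in> I \<Longrightarrow> (\<Sum>j\<in>J. p i j) \<le> a" and col: "\<And>j. j \<in> J \<Longrightarrow> (\<Sum>i\<in>I. p i j) \<le> b"
    and q: "0 \<le> q" "d powr (7 / 2) * q \<le> N powr (- 1 / 10)" and N10: "N powr (- 1 / 10) \<le> 1"
    and g: "0 < g" "g \<le> 1" and a: "g * d \<le> a" "a \<le> d" and b: "g * d \<le> b" "b \<le> d" and d: "1 \<le> d"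
    and L: "1 \<le> ln N" "64 / g \<le> ln N" "ln N \<le> d"
    and large: "18432 * (1 / sqrt g) * (10 ^ 5 * sqrt (ln N) ^ 5) * exp (160 * sqrt (ln N / g)) * N powr (- 1 / 10) \<le> g"
  shows "measure_pmf.prob (edge_pmf I J p) (norm_le_event I J p (sqrt a + sqrt b + (6 / sqrt g + 2) * sqrt (ln N)))
    \<ge> 1 - (2 + 8 * exp 2 / sqrt g) * N powr (- 3)"
proof -
  define L where "L = ln N"
  have L': "1 \<le> L" "64 / g \<le> L" "L \<le> d" using L by (auto simp: L_def)
  define \<eta> where "\<eta> = sqrt (L / d)"
  have \<eta>: "0 < \<eta>" "\<eta> \<le> 1" using L' d by (auto simp: \<eta>_def)
  have \<eta>2: "\<eta>\<^sup>2 * d = L" using L' d by (simp add: \<eta>_def)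
  define x where "x = sqrt (L * d)"
  have \<eta>x: "\<eta> * x = L" "\<eta> * d = x"
  proof -
    have "\<eta> * x = sqrt (L / d * (L * d))" by (simp only: \<eta>_def x_def real_sqrt_mult)
    also have "L / d * (L * d) = L\<^sup>2" using d by (simp add: power2_eq_square)
    finally show "\<eta> * x = L" using L' by simp
    have "\<eta> * d = sqrt (L / d) * sqrt (d\<^sup>2)" using d by (simp add: \<eta>_def)
    also have "\<dots> = sqrt (L / d * d\<^sup>2)" by (simp only: real_sqrt_mult)
    also have "L / d * d\<^sup>2 = L * d" using d by (simp add: power2_eq_square)
    finally show "\<eta> * d = x" by (simp add: x_def)
  qed
  have "1 * 1 \<le> L * d" using L' d by (intro mult_mono) auto
  then have x1: "1 \<le> x" by (simp add: x_def)
  define l where "l = nat \<lceil>5 * x\<rceil>"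
  have l: "5 * x \<le> real l" "real l \<le> 10 * x" "1 \<le> l"
  proof -
    have "real l = of_int \<lceil>5 * x\<rceil>" using x1 by (simp add: l_def)
    then show "5 * x \<le> real l" "real l \<le> 10 * x" using x1 by linarith+
    then have "1 \<le> real l" using x1 by linarith
    then show "1 \<le> l" by simp
  qed
  define \<theta> where "\<theta> = sqrt (sqrt (a * b))"
  have gd: "0 < g * d" using g d by simp
  have ab: "0 < a" "0 < b" using a b gd by linarith+
  have \<theta>2: "\<theta>\<^sup>2 = sqrt (a * b)" using ab by (simp add: \<theta>_def)
  have \<theta>2_ge: "g * d \<le> \<theta>\<^sup>2"
  proof -
    have "(g * d) * (g * d) \<le> a * b" using a b gd by (intro mult_mono) auto
    then have "sqrt ((g * d) * (g * d)) \<le> sqrt (a * b)" by (rule real_sqrt_le_mono)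
    moreover have "sqrt ((g * d) * (g * d)) = g * d" using gd by simp
    ultimately show ?thesis unfolding \<theta>2 by linarith
  qed
  have \<theta>_ge: "sqrt (g * d) \<le> \<theta>"
  proof -
    have "0 \<le> \<theta>" using ab by (simp add: \<theta>_def)
    then show ?thesis using \<theta>2_ge by (intro real_le_lsqrt) auto
  qed
  have "64 \<le> g * L" using L'(2) g by (simp add: field_simps)
  also have "\<dots> \<le> g * d" using L' g by (intro mult_left_mono) auto
  finally have gd64: "64 \<le> g * d" .
  then have "8 \<le> sqrt (g * d)" by (intro real_le_rsqrt) simp
  then have \<theta>8: "8 \<le> \<theta>" using \<theta>_ge by linarith
  \<comment> \<open>Chosen so that
    \<open>2 + 1 / \<mu> = 2 + \<theta> / 4 \<le> \<theta> / 2\<close>, which needs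
    \<open>\<theta> \<ge> 8\<close>; the hypothesis \<open>64 / g \<le> ln N\<close> provides this.
    Branching vertices then cost no more than others.\<close>
  define \<mu> where "\<mu> = 4 / \<theta>"
  define cmax where "cmax = 1 / sqrt g"
  \<comment> \<open>The exponent is the bound \<open>8 * (10 * x) / sqrt (g * d)\<close> for
    \<open>\<mu> * (2 * l)\<close>. Growing only like \<open>exp (k * sqrt (ln N))\<close>, this
    loses against a power of \<open>N\<close>.\<close>
  define Em where "Em = exp (80 * sqrt (L / g))"
  define \<Lambda> where "\<Lambda> = \<theta> + \<theta> / real l"
  \<comment> \<open>The division by \<open>g * d\<close> normalises both values into the interval
    from 1 to \<open>1 / sqrt g\<close>.\<close>
  define c1 where "c1 = sqrt (a / (g * d))"
  define c2 where "c2 = sqrt (b / (g * d))"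
  have cm: "1 \<le> cmax" using g by (simp add: cmax_def)
  have c12: "1 \<le> c1" "c1 \<le> cmax" "1 \<le> c2" "c2 \<le> cmax"
  proof -
    have "1 \<le> a / (g * d)" "1 \<le> b / (g * d)" using a b gd by auto
    then show "1 \<le> c1" "1 \<le> c2" by (auto simp: c1_def c2_def)
    have dg: "d / (g * d) = 1 / g" using d by simp
    have "a / (g * d) \<le> d / (g * d)" "b / (g * d) \<le> d / (g * d)"
      using gd by (intro divide_right_mono a b; simp)+
    then have "a / (g * d) \<le> 1 / g" "b / (g * d) \<le> 1 / g" unfolding dg .
    moreover have "cmax = sqrt (1 / g)" by (simp add: cmax_def real_sqrt_divide)
    ultimately show "c1 \<le> cmax" "c2 \<le> cmax" unfolding c1_def c2_def by (simp_all only: real_sqrt_le_iff)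
  qed
  have N10': "0 < N powr (- 1 / 10)" using N by simp
  have wc: "walk_counting (I <+> J) (bipartite_weight p) (case_sum (\<lambda>_. c1) (\<lambda>_. c2)) \<theta> \<mu>
    (1 / (96 * (real l)\<^sup>2 * cmax * Em)) (1 / real l) q (48 * real l) cmax \<Lambda> Em (2 * l)"
  proof (rule walk_countingI)
    show "finite (I <+> J)" using fin by simp
    show "0 \<le> bipartite_weight p u v \<and> bipartite_weight p u v \<le> q" if "u \<in> I <+> J" "v \<in> I <+> J" for u v
      by (rule bipartite_weight_bounds[OF p q(1) that])
    show "1 \<le> case_sum (\<lambda>_. c1) (\<lambda>_. c2) u \<and> case_sum (\<lambda>_. c1) (\<lambda>_. c2) u \<le> cmax" for u
      using c12 by (cases u) auto
    show "(\<Sum>y\<in>I <+> J. bipartite_weight p u y * case_sum (\<lambda>_. c1) (\<lambda>_. c2) y) \<le> \<theta>\<^sup>2 * case_sum (\<lambda>_. c1) (\<lambda>_. c2) u"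
      if "u \<in> I <+> J" for u
    proof (rule sum_bipartite_weight_le[OF fin row col _ _ _ _ that])
      have sa: "sqrt a * sqrt a = a" "sqrt b * sqrt b = b" using ab by auto
      have key: "u * u * (v / w) = u * v * (u / w)" for u v w :: real by simp
      have "a * c2 = sqrt a * sqrt a * (sqrt b / sqrt (g * d))" unfolding c2_def real_sqrt_divide sa ..
      also have "\<dots> = \<theta>\<^sup>2 * c1" unfolding \<theta>2 c1_def real_sqrt_divide real_sqrt_mult[of a b] by (rule key)
      finally show "a * c2 \<le> \<theta>\<^sup>2 * c1" by simp
      have "b * c1 = sqrt b * sqrt b * (sqrt a / sqrt (g * d))" unfolding c1_def real_sqrt_divide sa ..
      also have "\<dots> = \<theta>\<^sup>2 * c2"
        unfolding \<theta>2 c2_def real_sqrt_divide real_sqrt_mult[of a b] mult.commute[of "sqrt a" "sqrt b"] by (rule key)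
      finally show "b * c1 \<le> \<theta>\<^sup>2 * c2" by simp
    qed (use c12 in auto)
    have "\<mu> * real (2 * l) = 8 * real l / \<theta>" by (simp add: \<mu>_def)
    also have "\<dots> \<le> 8 * (10 * x) / sqrt (g * d)"
      using l \<theta>_ge \<theta>8 gd x1 by (intro frac_le) auto
    also have "\<dots> = 80 * sqrt (L / g)"
    proof -
      have "x / sqrt (g * d) = sqrt (L * d / (g * d))" by (simp only: x_def real_sqrt_divide)
      also have "L * d / (g * d) = L / g" using d by simp
      finally have "8 * (10 * (x / sqrt (g * d))) = 80 * sqrt (L / g)" by simp
      then show ?thesis by simp
    qed
    finally show "exp (\<mu> * real (2 * l)) \<le> Em" by (simp add: Em_def)
    show "\<theta> / 2 + (2 + 1 / \<mu>) + \<theta> / real l \<le> \<Lambda>" using \<theta>8 by (simp add: \<Lambda>_def \<mu>_def)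
    show "18432 * cmax * real l ^ 5 * Em\<^sup>2 * q \<le> \<theta>\<^sup>2"
    proof -
      have "real l ^ 5 \<le> (10 * x) ^ 5" using l by (intro power_mono) auto
      also have "\<dots> = 10 ^ 5 * (sqrt L ^ 5 * sqrt d ^ 5)"
        by (simp add: x_def real_sqrt_mult power_mult_distrib)
      finally have l5: "real l ^ 5 \<le> 10 ^ 5 * (sqrt L ^ 5 * sqrt d ^ 5)" .
      have Em2: "Em\<^sup>2 = exp (160 * sqrt (L / g))" by (simp add: Em_def exp_double[symmetric])
      have dq: "sqrt d ^ 5 * q \<le> N powr (- 1 / 10)"
        using mult_right_mono[OF sqrt_pow5_le_powr(1)[OF d] q(1)] q(2) by linarith
      have "18432 * cmax * real l ^ 5 * Em\<^sup>2 * q \<le> 18432 * cmax * (10 ^ 5 * (sqrt L ^ 5 * sqrt d ^ 5)) * Em\<^sup>2 * q"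
        using l5 cm q by (intro mult_right_mono mult_left_mono) auto
      also have "\<dots> = (18432 * cmax * (10 ^ 5 * sqrt L ^ 5) * Em\<^sup>2) * (sqrt d ^ 5 * q)" by (simp add: mult_ac)
      also have "\<dots> \<le> (18432 * cmax * (10 ^ 5 * sqrt L ^ 5) * Em\<^sup>2) * N powr (- 1 / 10)"
        using dq cm L' by (intro mult_left_mono) auto
      also have "\<dots> \<le> g" using large by (simp add: Em2 cmax_def L_def)
      also have "g \<le> g * d" using g d by simp
      also have "\<dots> \<le> \<theta>\<^sup>2" by (rule \<theta>2_ge)
      finally show ?thesis .
    qed
  qed (use cm \<theta>8 l q \<Lambda>_def \<mu>_def in auto)
  have qd: "q * d \<le> 1"
    using mult_right_mono[OF sqrt_pow5_le_powr(3)[OF d] q(1)] q(2) N10 by (simp add: mult.commute)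
  have qa: "q * a \<le> 1" "q * b \<le> 1"
    using mult_left_mono[OF a(2) q(1)] mult_left_mono[OF b(2) q(1)] qd by auto
  \<comment> \<open>With Chernoff parameter \<open>\<eta>\<close>, the excess \<open>5 * x\<close>
    gives an exponent of at most \<open>L - 5 * L\<close>, as \<open>\<eta> * x = L\<close>. It also
    exceeds the \<open>2 * x\<close> needed for \<open>a * exp \<eta> \<le> a'\<close>. The summand
    1 is the room for the squared means.\<close>
  define a' where "a' = a + 5 * x + 1"
  define b' where "b' = b + 5 * x + 1"
  have ab': "1 \<le> a'" "1 \<le> b'" using ab x1 by (auto simp: a'_def b'_def)
  have e\<eta>: "exp \<eta> \<le> 1 + \<eta> + \<eta>\<^sup>2" using exp_bound[of \<eta>] \<eta> by simp
  have tail: "exp (u * (exp \<eta> - 1) - \<eta> * (u + 5 * x + 1 - 1)) \<le> N powr (- 4)" if u: "0 \<le> u" "u \<le> d" for u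
  proof -
    have "u * (exp \<eta> - 1 - \<eta>) \<le> u * \<eta>\<^sup>2" using e\<eta> u by (intro mult_left_mono) auto
    also have "\<dots> \<le> d * \<eta>\<^sup>2" using u by (intro mult_right_mono) auto
    finally have "u * (exp \<eta> - 1 - \<eta>) \<le> L" using \<eta>2 by (simp add: mult.commute)
    moreover have "u * (exp \<eta> - 1) - \<eta> * (u + 5 * x + 1 - 1) = u * (exp \<eta> - 1 - \<eta>) - 5 * (\<eta> * x)"
      by (simp add: algebra_simps)
    ultimately have "u * (exp \<eta> - 1) - \<eta> * (u + 5 * x + 1 - 1) \<le> - 4 * ln N"
      using \<eta>x(1) by (simp add: L_def)
    then have "exp (u * (exp \<eta> - 1) - \<eta> * (u + 5 * x + 1 - 1)) \<le> exp (- 4 * ln N)" by simp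
    then show ?thesis unfolding exp_minus_ln[OF N] .
  qed
  note NN = mult_powr_minus[OF N]
  have t1: "real (card I) * exp (a * (exp \<eta> - 1) - \<eta> * (a' - 1)) \<le> N powr (- 3)"
    unfolding NN(1)[symmetric] a'_def using card N ab a by (intro mult_mono tail) auto
  have t2: "real (card J) * exp (b * (exp \<eta> - 1) - \<eta> * (b' - 1)) \<le> N powr (- 3)"
    unfolding NN(1)[symmetric] b'_def using card N ab b by (intro mult_mono tail) auto
  have t3: "(real (card I + card J))\<^sup>2 * (2 * cmax * \<Lambda> ^ (2 * l)) / (1 + sqrt (a' * b')) ^ l \<le> 8 * exp 2 / sqrt g * N powr (- 3)"
  proof -
    have "(1 + 1 / real l) ^ l \<le> exp (1 / real l) ^ l"
      using l by (intro power_mono exp_ge_add_one_self) auto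
    also have "\<dots> = exp 1" using l by (simp add: exp_of_nat_mult[symmetric])
    finally have e1: "(1 + 1 / real l) ^ l \<le> exp 1" .
    have "\<Lambda> = \<theta> * (1 + 1 / real l)" by (simp add: \<Lambda>_def distrib_left)
    then have "\<Lambda> ^ (2 * l) = (\<theta>\<^sup>2) ^ l * ((1 + 1 / real l) ^ l)\<^sup>2"
      by (simp add: power_mult_distrib power_mult[symmetric] mult.commute)
    also have "\<dots> \<le> (\<theta>\<^sup>2) ^ l * (exp 1)\<^sup>2"
      using e1 by (intro mult_left_mono power_mono) auto
    also have "(exp 1)\<^sup>2 = exp (2 :: real)" by (simp add: exp_double[symmetric])
    finally have \<Lambda>2l: "\<Lambda> ^ (2 * l) \<le> (\<theta>\<^sup>2) ^ l * exp 2" .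
    have growth: "u * exp \<eta> \<le> u + 5 * x + 1" if u: "0 \<le> u" "u \<le> d" for u
    proof -
      have "\<eta> * \<eta> \<le> \<eta> * 1" using \<eta> by (intro mult_left_mono) auto
      then have "exp \<eta> \<le> 1 + 2 * \<eta>" using e\<eta> unfolding power2_eq_square by linarith
      then have "u * exp \<eta> \<le> u * (1 + 2 * \<eta>)" using u by (intro mult_left_mono)
      also have "\<dots> = u + 2 * (\<eta> * u)" by (simp add: algebra_simps)
      also have "\<eta> * u \<le> \<eta> * d" using u \<eta> by (intro mult_left_mono) auto
      finally show ?thesis using x1 \<eta>x(2) by simp
    qed
    have "\<theta>\<^sup>2 * exp \<eta> = sqrt ((a * exp \<eta>) * (b * exp \<eta>))"
      unfolding \<theta>2 by (simp add: real_sqrt_mult)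
    also have "\<dots> \<le> sqrt (a' * b')"
      unfolding a'_def b'_def using ab a b x1 by (intro real_sqrt_le_mono mult_mono growth) auto
    finally have "\<theta>\<^sup>2 * exp \<eta> \<le> 1 + sqrt (a' * b')" by simp
    then have "(\<theta>\<^sup>2 * exp \<eta>) ^ l \<le> (1 + sqrt (a' * b')) ^ l" by (intro power_mono) auto
    moreover have "N powr 5 \<le> exp \<eta> ^ l"
    proof -
      have "5 * (\<eta> * x) \<le> real l * \<eta>"
        using mult_left_mono[OF l(1), of \<eta>] \<eta>(1) by (simp add: mult_ac)
      then have "5 * L \<le> real l * \<eta>" unfolding \<eta>x(1) .
      then have "exp (5 * L) \<le> exp \<eta> ^ l" by (simp add: exp_of_nat_mult[symmetric])
      then show ?thesis using N by (simp add: powr_def L_def)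
    qed
    then have "(\<theta>\<^sup>2) ^ l * N powr 5 \<le> (\<theta>\<^sup>2) ^ l * exp \<eta> ^ l" by (intro mult_left_mono) auto
    ultimately have den: "(\<theta>\<^sup>2) ^ l * N powr 5 \<le> (1 + sqrt (a' * b')) ^ l"
      unfolding power_mult_distrib[of "\<theta>\<^sup>2" "exp \<eta>" l] by (rule order_trans[rotated])
    have pos: "0 < (\<theta>\<^sup>2) ^ l * N powr 5" using \<theta>8 N by simp
    have "(real (card I + card J))\<^sup>2 \<le> (2 * N)\<^sup>2" using card by (intro power_mono) auto
    then have "(real (card I + card J))\<^sup>2 * (2 * cmax * \<Lambda> ^ (2 * l)) \<le> (2 * N)\<^sup>2 * (2 * cmax * ((\<theta>\<^sup>2) ^ l * exp 2))"
      using cm \<Lambda>2l by (intro mult_mono mult_left_mono) (auto simp: power_mult)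
    then have "(real (card I + card J))\<^sup>2 * (2 * cmax * \<Lambda> ^ (2 * l)) / (1 + sqrt (a' * b')) ^ l
        \<le> (2 * N)\<^sup>2 * (2 * cmax * ((\<theta>\<^sup>2) ^ l * exp 2)) / ((\<theta>\<^sup>2) ^ l * N powr 5)"
      using den pos cm by (intro frac_le) auto
    also have "\<dots> = 8 * cmax * exp 2 * (N\<^sup>2 * N powr (- 5))"
      using \<theta>8 N by (simp add: powr_minus field_simps power_mult_distrib)
    finally show ?thesis unfolding NN(2) by (simp add: cmax_def)
  qed
  have "1 - (2 + 8 * exp 2 / sqrt g) * N powr (- 3) \<le>
      measure_pmf.prob (edge_pmf I J p) (norm_le_event I J p (sqrt a' + sqrt b' + 2))"
    using high_probability_general[OF fin p row col q(1) qa less_imp_le[OF \<eta>(1)] ab' wc] t1 t2 t3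
    unfolding norm_le_event_def by (simp add: distrib_right)
  also have "\<dots> \<le> measure_pmf.prob (edge_pmf I J p)
      (norm_le_event I J p (sqrt a + sqrt b + (6 / sqrt g + 2) * sqrt (ln N)))"
  proof (intro measure_pmf.finite_measure_mono norm_le_event_mono)
    show "0 \<le> sqrt a' + sqrt b' + 2" using ab' by simp
    have sL: "1 \<le> sqrt L" using L' by simp
    have root: "sqrt (u + 5 * x + 1) \<le> sqrt u + 3 / sqrt g * sqrt L" if u: "g * d \<le> u" for u
    proof -
      have u0: "0 < u" using u gd by linarith
      have "sqrt (u + (5 * x + 1)) \<le> sqrt u + (5 * x + 1) / (2 * sqrt u)"
        using u0 x1 by (intro sqrt_add_le) auto
      also have "(5 * x + 1) / (2 * sqrt u) \<le> (6 * x) / (2 * sqrt (g * d))"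
        using u gd x1 by (intro frac_le) auto
      also have "\<dots> = 3 / sqrt g * sqrt L"
        using d g by (simp add: x_def real_sqrt_mult)
      finally show ?thesis by (simp add: add.assoc)
    qed
    show "sqrt a' + sqrt b' + 2 \<le> sqrt a + sqrt b + (6 / sqrt g + 2) * sqrt (ln N)"
    proof -
      have e: "(6 / sqrt g + 2) * sqrt L = 2 * (3 / sqrt g * sqrt L) + 2 * sqrt L"
        by (simp add: distrib_right)
      show ?thesis
        unfolding a'_def b'_def L_def[symmetric] e
        using root[OF a(1)] root[OF b(1)] sL by linarith
    qed
  qed auto
  finally show ?thesis .
qed

text \<open>Here \<open>\<eta> \<ge> 1\<close>, and \<open>d \<le> ln N / s\<close> with
  \<open>s = max 1 (ln \<eta>)\<close>. Only the order of the bound matters, so \<open>d\<close> is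
  used for rows and columns alike and \<open>c\<close> is constant.\<close>

lemma norm_bound_sparse:
  fixes I :: "'a set" and J :: "'b set" and N :: real
  assumes fin: "finite I" "finite J" and card: "real (card I) \<le> N" "real (card J) \<le> N" and N: "0 < N"
    and p: "\<And>i j. i \<in> I \<Longrightarrow> j \<in> J \<Longrightarrow> 0 \<le> p i j \<and> p i j \<le> 1 \<and> p i j \<le> q"
    and row: "\<And>i. i \<in> I \<Longrightarrow> (\<Sum>j\<in>J. p i j) \<le> d" and col: "\<And>j. j \<in> J \<Longrightarrow> (\<Sum>i\<in>I. p i j) \<le> d"
    and q: "0 \<le> q" "d powr (7 / 2) * q \<le> N powr (- 1 / 10)" and N10: "N powr (- 1 / 10) \<le> 1"
    and d: "1 \<le> d" and L: "1 \<le> ln N" "d \<le> ln N"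
    and large: "18432 * (10 * ln N) ^ 5 * exp (ln N / 20) * N powr (- 1 / 10) \<le> 1"
  shows "measure_pmf.prob (edge_pmf I J p) (norm_le_event I J p
      ((2 * sqrt 3000000 + 2) * sqrt (ln N / max 1 (ln (sqrt (ln N / d))))))
    \<ge> 1 - 10 * N powr (- 3)"
proof -
  define L where "L = ln N"
  have L': "1 \<le> L" "d \<le> L" using L by (auto simp: L_def)
  define \<eta> where "\<eta> = sqrt (L / d)"
  have \<eta>: "1 \<le> \<eta>" using L' d by (simp add: \<eta>_def)
  have \<eta>2: "\<eta>\<^sup>2 * d = L" using L' d by (simp add: \<eta>_def)
  \<comment> \<open>The Chernoff parameter: \<open>exp s\<close> is at most
    \<open>3 * \<eta>\<close>, so \<open>d * exp s\<close> is still at most \<open>3 * L\<close>,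
    while a degree threshold of order \<open>L / s\<close> already gains a multiple of
    \<open>L\<close>. The logarithm in the final bound comes from here.\<close>
  define s where "s = max 1 (ln \<eta>)"
  have s1: "1 \<le> s" by (simp add: s_def)
  have "\<eta> * 1 \<le> \<eta> * \<eta>" using \<eta> by (intro mult_left_mono) auto
  then have "\<eta> \<le> \<eta>\<^sup>2" by (simp add: power2_eq_square)
  moreover have "s \<le> \<eta>" using \<eta> ln_le_minus_one[of \<eta>] by (simp add: s_def)
  ultimately have "s \<le> \<eta>\<^sup>2" by (rule order_trans[rotated])
  then have "s * d \<le> \<eta>\<^sup>2 * d" using d by (intro mult_right_mono) auto
  then have sd: "s * d \<le> L" using \<eta>2 by simp
  have dL: "d \<le> L / s" using sd s1 by (simp add: field_simps)
  have "s * 1 \<le> s * d" using d s1 by (intro mult_left_mono) auto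
  then have sL: "s \<le> L" using sd by linarith
  define l where "l = nat \<lceil>5 * L\<rceil>"
  have l: "5 * L \<le> real l" "real l \<le> 10 * L" "1 \<le> l"
  proof -
    have "real l = of_int \<lceil>5 * L\<rceil>" using L' by (simp add: l_def)
    then show "5 * L \<le> real l" "real l \<le> 10 * L" using L' by linarith+
    then have "1 \<le> real l" using L' by linarith
    then show "1 \<le> l" by simp
  qed
  define \<theta> where "\<theta> = sqrt d"
  have \<theta>: "1 \<le> \<theta>" "\<theta>\<^sup>2 = d" using d by (auto simp: \<theta>_def)
  define Em where "Em = exp (L / 40)"
  \<comment> \<open>For \<open>\<mu> = 1 / 800\<close> the growth is at most
    \<open>802 + 3 * \<theta> / 2\<close>, below \<open>1000 * \<theta>\<close> because
    \<open>\<theta> \<ge> 1\<close>. This small \<open>\<mu>\<close> keeps \<open>Em^2\<close> at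
    \<open>exp (L / 20)\<close>, the square root of the gain from sparsity.\<close>
  define \<Lambda> where "\<Lambda> = 1000 * \<theta>"
  have wc: "walk_counting (I <+> J) (bipartite_weight p) (case_sum (\<lambda>_. 1) (\<lambda>_. 1)) \<theta> (1 / 800)
    (1 / (96 * (real l)\<^sup>2 * 1 * Em)) (1 / real l) q (48 * real l) 1 \<Lambda> Em (2 * l)"
  proof (rule walk_countingI)
    show "finite (I <+> J)" using fin by simp
    show "0 \<le> bipartite_weight p u v \<and> bipartite_weight p u v \<le> q" if "u \<in> I <+> J" "v \<in> I <+> J" for u v
      by (rule bipartite_weight_bounds[OF p q(1) that])
    show "1 \<le> (case_sum (\<lambda>_. 1) (\<lambda>_. 1) u :: real) \<and> case_sum (\<lambda>_. 1) (\<lambda>_. 1) u \<le> (1 :: real)" for u :: "'a + 'b"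
      by (cases u) auto
    show "(\<Sum>y\<in>I <+> J. bipartite_weight p u y * case_sum (\<lambda>_. 1) (\<lambda>_. 1) y) \<le> \<theta>\<^sup>2 * case_sum (\<lambda>_. 1) (\<lambda>_. 1) u"
      if "u \<in> I <+> J" for u
      by (rule sum_bipartite_weight_le[OF fin row col _ _ _ _ that]) (use \<theta> in auto)
    have "1 / 800 * real (2 * l) \<le> L / 40" using l by simp
    then show "exp (1 / 800 * real (2 * l)) \<le> Em" by (simp add: Em_def)
    have "\<theta> / real l \<le> \<theta> / 1" using l \<theta> by (intro divide_left_mono) auto
    then show "\<theta> + \<theta> / real l \<le> \<Lambda>" "\<theta> / 2 + (2 + 1 / (1 / 800)) + \<theta> / real l \<le> \<Lambda>"
      using \<theta>(1) by (simp_all add: \<Lambda>_def)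
    show "18432 * 1 * real l ^ 5 * Em\<^sup>2 * q \<le> \<theta>\<^sup>2"
    proof -
      have Em2: "Em\<^sup>2 = exp (L / 20)" by (simp add: Em_def exp_double[symmetric])
      have q': "q \<le> N powr (- 1 / 10)"
        using mult_right_mono[OF sqrt_pow5_le_powr(2)[OF d] q(1)] q(2) by linarith
      have "18432 * 1 * real l ^ 5 * Em\<^sup>2 * q \<le> 18432 * 1 * (10 * L) ^ 5 * Em\<^sup>2 * N powr (- 1 / 10)"
        using l q q' L' by (intro mult_mono mult_right_mono mult_left_mono power_mono) auto
      also have "\<dots> \<le> 1" using large by (simp add: Em2 L_def)
      also have "\<dots> \<le> \<theta>\<^sup>2" using \<theta> d by simp
      finally show ?thesis .
    qed
  qed (use \<theta> l q in auto)
  have qd: "q * d \<le> 1"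
    using mult_right_mono[OF sqrt_pow5_le_powr(3)[OF d] q(1)] q(2) N10 by (simp add: mult.commute)
  \<comment> \<open>The constant exceeds \<open>1000^2 * exp 1\<close>, so each of the
    \<open>l \<ge> 5 * L\<close> steps gains a factor \<open>exp 1\<close> over
    \<open>\<Lambda>^2\<close>, in total at least \<open>N powr 5\<close>.\<close>
  define D where "D = 3000000 * (L / s)"
  have Ls: "1 \<le> L / s" using dL d by linarith
  then have D1: "1 \<le> D" by (simp add: D_def)
  have tail: "exp (d * (exp s - 1) - s * (D - 1)) \<le> N powr (- 4)"
  proof -
    have "exp s \<le> exp 1 * \<eta>"
    proof (cases "ln \<eta> \<le> 1")
      case True
      then show ?thesis using \<eta> by (simp add: s_def max_def)
    next
      case False
      then have "exp s = 1 * \<eta>" using \<eta> by (simp add: s_def max_def)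
      also have "\<dots> \<le> exp 1 * \<eta>" using \<eta> by (intro mult_right_mono) auto
      finally show ?thesis .
    qed
    also have "\<dots> \<le> 3 * \<eta>" using e_less_272 \<eta> by (intro mult_right_mono) auto
    also have "\<dots> \<le> 3 * \<eta>\<^sup>2" using \<open>\<eta> \<le> \<eta>\<^sup>2\<close> by simp
    finally have "d * exp s \<le> d * (3 * \<eta>\<^sup>2)" using d by (intro mult_left_mono) auto
    then have "d * exp s \<le> 3 * L" using \<eta>2 by (simp add: mult_ac)
    moreover have "s * D = 3000000 * L" using s1 by (simp add: D_def)
    ultimately have "d * (exp s - 1) - s * (D - 1) \<le> - 4 * ln N"
      using sL d L' by (simp add: right_diff_distrib L_def)
    then have "exp (d * (exp s - 1) - s * (D - 1)) \<le> exp (- 4 * ln N)" by simp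
    then show ?thesis unfolding exp_minus_ln[OF N] .
  qed
  note NN = mult_powr_minus[OF N]
  have t1: "real (card I) * exp (d * (exp s - 1) - s * (D - 1)) \<le> N powr (- 3)"
    unfolding NN(1)[symmetric] using card N by (intro mult_mono tail) auto
  have t2: "real (card J) * exp (d * (exp s - 1) - s * (D - 1)) \<le> N powr (- 3)"
    unfolding NN(1)[symmetric] using card N by (intro mult_mono tail) auto
  have t3: "(real (card I + card J))\<^sup>2 * (2 * 1 * \<Lambda> ^ (2 * l)) / (1 + sqrt (D * D)) ^ l \<le> 8 * N powr (- 3)"
  proof -
    have \<Lambda>2l: "\<Lambda> ^ (2 * l) = (1000000 * d) ^ l"
      by (simp add: \<Lambda>_def power_mult power_mult_distrib \<theta>)
    have "1000000 * d * exp 1 \<le> 1000000 * d * 3" using e_less_272 d by (intro mult_left_mono) auto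
    also have "\<dots> \<le> 1 + D" unfolding D_def using dL by linarith
    also have "D = sqrt (D * D)" using D1 by simp
    finally have "(1000000 * d * exp 1) ^ l \<le> (1 + sqrt (D * D)) ^ l" using d by (intro power_mono) auto
    moreover have "N powr 5 \<le> exp 1 ^ l"
    proof -
      have "exp (5 * L) \<le> exp 1 ^ l" using l by (simp add: exp_of_nat_mult[symmetric])
      then show ?thesis using N by (simp add: powr_def L_def)
    qed
    then have "(1000000 * d) ^ l * N powr 5 \<le> (1000000 * d) ^ l * exp 1 ^ l" using d by (intro mult_left_mono) auto
    ultimately have den: "(1000000 * d) ^ l * N powr 5 \<le> (1 + sqrt (D * D)) ^ l"
      unfolding power_mult_distrib[of "1000000 * d" "exp 1" l] by (rule order_trans[rotated])
    have pos: "0 < (1000000 * d) ^ l * N powr 5" using d N by simp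
    have "(real (card I + card J))\<^sup>2 \<le> (2 * N)\<^sup>2" using card by (intro power_mono) auto
    then have "(real (card I + card J))\<^sup>2 * (2 * 1 * \<Lambda> ^ (2 * l)) \<le> (2 * N)\<^sup>2 * (2 * (1000000 * d) ^ l)"
      unfolding \<Lambda>2l using d by (intro mult_mono) auto
    then have "(real (card I + card J))\<^sup>2 * (2 * 1 * \<Lambda> ^ (2 * l)) / (1 + sqrt (D * D)) ^ l
        \<le> (2 * N)\<^sup>2 * (2 * (1000000 * d) ^ l) / ((1000000 * d) ^ l * N powr 5)"
      using den pos d by (intro frac_le) auto
    also have "\<dots> = 8 * (N\<^sup>2 * N powr (- 5))"
      using d N by (simp add: powr_minus field_simps power_mult_distrib)
    finally show ?thesis unfolding NN(2) .
  qed
  have "1 - 10 * N powr (- 3) \<le> measure_pmf.prob (edge_pmf I J p) (norm_le_event I J p (sqrt D + sqrt D + 2))"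
    using high_probability_general[OF fin p row col q(1) qd qd _ D1 D1 wc, of s] s1 t1 t2 t3
    unfolding norm_le_event_def by simp
  also have "\<dots> \<le> measure_pmf.prob (edge_pmf I J p)
      (norm_le_event I J p ((2 * sqrt 3000000 + 2) * sqrt (ln N / max 1 (ln (sqrt (ln N / d))))))"
  proof (intro measure_pmf.finite_measure_mono norm_le_event_mono)
    show "0 \<le> sqrt D + sqrt D + 2" using D1 by simp
    have "1 \<le> sqrt (L / s)" using Ls by simp
    moreover have "sqrt D = sqrt 3000000 * sqrt (L / s)" by (simp only: D_def real_sqrt_mult)
    ultimately have "sqrt D + sqrt D + 2 \<le> (2 * sqrt 3000000 + 2) * sqrt (L / s)"
      by (simp only: distrib_right)
    then show "sqrt D + sqrt D + 2 \<le> (2 * sqrt 3000000 + 2) * sqrt (ln N / max 1 (ln (sqrt (ln N / d))))"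
      by (simp only: L_def s_def \<eta>_def)
  qed auto
  finally show ?thesis .
qed

text \<open>In terms of \<open>ln N\<close>, the losses \<open>exp (k * sqrt (ln N))\<close> and
  \<open>exp (ln N / 20)\<close>, even with powers of \<open>ln N\<close>, are beaten by
  \<open>exp (- ln N / 10)\<close>.\<close>

lemma eventually_large:
  assumes g: "0 < (g::real)"
  shows "eventually (\<lambda>N::real. 1 \<le> ln N \<and> 64 / g \<le> ln N \<and> N powr (- 1 / 10) \<le> 1 \<and>
    18432 * (1 / sqrt g) * (10 ^ 5 * sqrt (ln N) ^ 5) * exp (160 * sqrt (ln N / g)) * N powr (- 1 / 10) \<le> g \<and>
    18432 * (10 * ln N) ^ 5 * exp (ln N / 20) * N powr (- 1 / 10) \<le> 1) at_top"
proof -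
  define k where "k = 160 / sqrt g"
  define C where "C = 18432 * (1 / sqrt g) * 10 ^ 5"
  have k: "0 < k" and C: "0 < C" using g by (auto simp: k_def C_def)
  have ev: "eventually (\<lambda>N. Q (ln N)) at_top" if "eventually Q at_top" for Q :: "real \<Rightarrow> bool"
    using that ln_at_top by (rule eventually_compose_filterlim)
  have "((\<lambda>L::real. sqrt L ^ 5 * exp (k * sqrt L) * exp (- L / 10)) \<longlongrightarrow> 0) at_top"
    using k by real_asymp
  then have "eventually (\<lambda>L::real. sqrt L ^ 5 * exp (k * sqrt L) * exp (- L / 10) < g / C) at_top"
    using g C by (intro order_tendstoD) auto
  note 1 = ev[OF this]
  have "((\<lambda>L::real. 18432 * (10 * L) ^ 5 * exp (L / 20) * exp (- L / 10)) \<longlongrightarrow> 0) at_top"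
    by real_asymp
  then have "eventually (\<lambda>L::real. 18432 * (10 * L) ^ 5 * exp (L / 20) * exp (- L / 10) < 1) at_top"
    by (rule order_tendstoD) simp
  note 2 = ev[OF this]
  note 3 = ev[OF eventually_ge_at_top[of 1]] and 4 = ev[OF eventually_ge_at_top[of "64 / g"]]
  from 1 2 3 4 eventually_gt_at_top[of "0 :: real"] show ?thesis
  proof eventually_elim
    case (elim N)
    have N: "N powr (- 1 / 10) = exp (- ln N / 10)" using elim(5) by (simp add: powr_def)
    have "18432 * (1 / sqrt g) * (10 ^ 5 * sqrt (ln N) ^ 5) * exp (160 * sqrt (ln N / g)) * N powr (- 1 / 10) =
        C * (sqrt (ln N) ^ 5 * exp (k * sqrt (ln N)) * exp (- ln N / 10))"
      unfolding N by (simp add: C_def k_def real_sqrt_divide)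
    also have "\<dots> \<le> C * (g / C)" using elim(1) C by (intro mult_left_mono) auto
    also have "\<dots> = g" using C by simp
    finally have "18432 * (1 / sqrt g) * (10 ^ 5 * sqrt (ln N) ^ 5) * exp (160 * sqrt (ln N / g)) * N powr (- 1 / 10) \<le> g" .
    moreover have "N powr (- 1 / 10) \<le> 1" unfolding N using elim(3) by (subst exp_le_one_iff) linarith
    moreover have "18432 * (10 * ln N) ^ 5 * exp (ln N / 20) * N powr (- 1 / 10) \<le> 1"
      unfolding N using elim(2) by (rule less_imp_le)
    ultimately show ?case using elim(3,4) by blast
  qed
qed

section \<open>The largest singular value\<close>

text \<open>Guarantees that \<open>sigma_max\<close> is a maximum over a nonempty set. A complex
  eigenvalue exists; it is real since both the Hermitian form and the squared length of the
  eigenvector are, and as a root of the real characteristic polynomial it is an eigenvalue of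
  \<open>A\<close> itself.\<close>

lemma hermitian_eigenvalue_exists:
  fixes A :: "real mat"
  assumes A: "A \<in> carrier_mat n n" and sym: "transpose_mat A = A" and n: "n > 0"
  shows "\<exists>l. eigenvalue A l"
proof -
  let ?C = "map_mat complex_of_real A"
  have C: "?C \<in> carrier_mat n n" using A by simp
  from spectrum_non_empty[OF C n] obtain k where k: "eigenvalue ?C k" by (auto simp: spectrum_def)
  then obtain v where v: "v \<in> carrier_vec n" "v \<noteq> 0\<^sub>v n" "?C *\<^sub>v v = k \<cdot>\<^sub>v v"
    using C by (auto simp: eigenvalue_def eigenvector_def)
  have row: "(\<Sum>j<n. complex_of_real (A $$ (i, j)) * v $ j) = k * v $ i" if "i < n" for i
  proof -
    have "(?C *\<^sub>v v) $ i = (\<Sum>j<n. complex_of_real (A $$ (i, j)) * v $ j)"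
      using that C v(1) A by (simp add: scalar_prod_def atLeast0LessThan)
    then show ?thesis unfolding v(3) using v(1) that by simp
  qed
  have Asym: "A $$ (i, j) = A $$ (j, i)" if "i < n" "j < n" for i j
    using sym A that by (metis carrier_matD index_transpose_mat(1))
  define q where "q = (\<Sum>i<n. cnj (v $ i) * v $ i)"
  define s where "s = (\<Sum>i<n. \<Sum>j<n. cnj (v $ i) * (complex_of_real (A $$ (i, j)) * v $ j))"
  have s1: "s = k * q"
  proof -
    have "s = (\<Sum>i<n. cnj (v $ i) * (k * v $ i))"
      unfolding s_def by (intro sum.cong refl) (simp add: sum_distrib_left[symmetric] row)
    then show ?thesis by (simp add: q_def sum_distrib_left mult_ac)
  qed
  have "cnj s = (\<Sum>i<n. \<Sum>j<n. v $ i * (complex_of_real (A $$ (i, j)) * cnj (v $ j)))"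
    by (simp add: s_def)
  also have "\<dots> = (\<Sum>j<n. \<Sum>i<n. v $ i * (complex_of_real (A $$ (i, j)) * cnj (v $ j)))"
    by (rule sum.swap)
  also have "\<dots> = s"
    unfolding s_def by (intro sum.cong refl) (simp add: Asym mult_ac)
  finally have "cnj s = s" .
  moreover have "cnj q = q" by (simp add: q_def mult.commute)
  moreover have "q \<noteq> 0"
  proof
    assume "q = 0"
    then have "Re q = 0" by simp
    then have "(\<Sum>i<n. (cmod (v $ i))\<^sup>2) = 0"
      by (simp add: q_def complex_mult_cnj cmod_power2 mult.commute[of "cnj _"])
    then have "\<forall>i<n. v $ i = 0" by (subst (asm) sum_nonneg_eq_0_iff) auto
    then have "v = 0\<^sub>v n" using v(1) by (intro eq_vecI) auto
    then show False using v(2) by simp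
  qed
  ultimately have "cnj k = k" unfolding s1 by simp
  then have k': "k = complex_of_real (Re k)" by (simp add: complex_eq_iff)
  have "poly (char_poly ?C) k = 0" using eigenvalue_root_char_poly[OF C] k by simp
  also have "char_poly ?C = map_poly complex_of_real (char_poly A)"
    by (rule of_real_hom.char_poly_hom[OF A])
  finally have "poly (map_poly complex_of_real (char_poly A)) (complex_of_real (Re k)) = 0"
    using k' by simp
  then have "poly (char_poly A) (Re k) = 0" by simp
  then show ?thesis using eigenvalue_root_char_poly[OF A] by auto
qed

lemma sigma_max_le:
  fixes A :: "real mat"
  assumes A: "A \<in> carrier_mat n m" and m: "m > 0" and b: "0 \<le> b"
    and bound: "\<And>v :: nat \<Rightarrow> real. (\<Sum>i<n. (\<Sum>j<m. A $$ (i, j) * v j)\<^sup>2) \<le> b\<^sup>2 * (\<Sum>j<m. (v j)\<^sup>2)"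
  shows "sigma_max A \<le> b"
proof -
  let ?B = "transpose_mat A * A"
  have B: "?B \<in> carrier_mat m m" using A by simp
  have symB: "transpose_mat ?B = ?B"
    using A by (simp add: transpose_mult[of "transpose_mat A" m n A m])
  have eq: "singular_values A = sqrt ` spectrum ?B"
    by (auto simp: singular_values_def spectrum_def)
  have fin: "finite (singular_values A)"
    unfolding eq using card_finite_spectrum(1)[OF B] by simp
  have ne: "singular_values A \<noteq> {}"
    unfolding eq using hermitian_eigenvalue_exists[OF B symB m] by (auto simp: spectrum_def)
  have "s \<le> b" if "s \<in> singular_values A" for s
  proof -
    obtain l where s: "s = sqrt l" and l: "eigenvalue ?B l" using \<open>s \<in> _\<close> by (auto simp: singular_values_def)
    then obtain v where v: "v \<in> carrier_vec m" "v \<noteq> 0\<^sub>v m" "?B *\<^sub>v v = l \<cdot>\<^sub>v v"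
      using B A by (auto simp: eigenvalue_def eigenvector_def)
    have "(A *\<^sub>v v) \<bullet> (A *\<^sub>v v) = v \<bullet> (?B *\<^sub>v v)"
    proof -
      have "?B *\<^sub>v v = transpose_mat A *\<^sub>v (A *\<^sub>v v)"
        using A v by (intro assoc_mult_mat_vec) auto
      then show ?thesis
        using transpose_vec_mult_scalar[OF A v(1), of "A *\<^sub>v v"] A v(1)
          comm_scalar_prod[of "transpose_mat A *\<^sub>v (A *\<^sub>v v)" m v] by simp
    qed
    then have "(A *\<^sub>v v) \<bullet> (A *\<^sub>v v) = l * (v \<bullet> v)" using v by simp
    moreover have "(A *\<^sub>v v) \<bullet> (A *\<^sub>v v) = (\<Sum>i<n. (\<Sum>j<m. A $$ (i, j) * v $ j)\<^sup>2)"
      using A v(1) by (simp add: scalar_prod_def atLeast0LessThan power2_eq_square)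
    moreover have vv: "v \<bullet> v = (\<Sum>j<m. (v $ j)\<^sup>2)"
      using v(1) by (simp add: scalar_prod_def atLeast0LessThan power2_eq_square)
    ultimately have le: "l * (\<Sum>j<m. (v $ j)\<^sup>2) \<le> b\<^sup>2 * (\<Sum>j<m. (v $ j)\<^sup>2)"
      using bound[of "\<lambda>j. v $ j"] by simp
    have "(\<Sum>j<m. (v $ j)\<^sup>2) \<noteq> 0"
    proof
      assume "(\<Sum>j<m. (v $ j)\<^sup>2) = 0"
      then have "\<forall>j<m. v $ j = 0" by (subst (asm) sum_nonneg_eq_0_iff) auto
      then have "v = 0\<^sub>v m" using v(1) by (intro eq_vecI) auto
      then show False using v(2) by simp
    qed
    then have "(\<Sum>j<m. (v $ j)\<^sup>2) > 0" by (simp add: sum_nonneg order_less_le)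
    then have "l \<le> b\<^sup>2" using le by simp
    then show ?thesis unfolding s using b by (intro real_le_lsqrt) auto
  qed
  then show ?thesis unfolding sigma_max_def using fin ne by simp
qed

lemma bipartite_ER_eq: "bipartite_ER n m p = map_pmf (\<lambda>f. {e. f e}) (edge_pmf {..<n} {..<m} p)"
  by (simp add: bipartite_ER_def edge_pmf_def)

lemma expectation_entry:
  assumes p: "0 \<le> p i j" "p i j \<le> 1" and ij: "i < n" "j < m"
  shows "measure_pmf.expectation (bipartite_ER n m p) (\<lambda>E. biadjacency n m E $$ (i, j)) = p i j"
proof -
  have "measure_pmf.expectation (bipartite_ER n m p) (\<lambda>E. biadjacency n m E $$ (i, j)) =
      measure_pmf.expectation (edge_pmf {..<n} {..<m} p) (\<lambda>f. of_bool (f (i, j)))"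
    unfolding bipartite_ER_eq integral_map_pmf using ij
    by (intro Bochner_Integration.integral_cong refl) (simp add: biadjacency_def)
  also have "\<dots> = measure_pmf.expectation (map_pmf (\<lambda>f. f (i, j)) (edge_pmf {..<n} {..<m} p)) of_bool"
    by (simp only: integral_map_pmf)
  also have "map_pmf (\<lambda>f. f (i, j)) (edge_pmf {..<n} {..<m} p) = bernoulli_pmf (p i j)"
    unfolding edge_pmf_def using ij by (subst Pi_pmf_component) auto
  also have "measure_pmf.expectation (bernoulli_pmf (p i j)) of_bool = p i j" using p by simp
  finally show ?thesis .
qed

lemma centered_biadjacency_entry:
  assumes p: "\<And>i j. i < n \<Longrightarrow> j < m \<Longrightarrow> 0 \<le> p i j \<and> p i j \<le> 1" and ij: "i < n" "j < m"
  shows "centered_biadjacency n m p {e. f e} $$ (i, j) = centered_entry {..<n} {..<m} p f i j"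
  using ij p[OF ij]
  by (simp add: centered_biadjacency_def expectation_mat_def expectation_entry)
     (simp add: biadjacency_def centered_entry_def)

lemma centered_biadjacency_carrier: "centered_biadjacency n m p E \<in> carrier_mat n m"
  unfolding centered_biadjacency_def expectation_mat_def by (intro minus_carrier_mat mat_carrier)

lemma sigma_max_centered_le:
  assumes p: "\<And>i j. i < n \<Longrightarrow> j < m \<Longrightarrow> 0 \<le> p i j \<and> p i j \<le> 1" and m: "1 \<le> m" and t: "0 \<le> t"
    and f: "f \<in> norm_le_event {..<n} {..<m} p t"
  shows "sigma_max (centered_biadjacency n m p {e. f e}) \<le> t"
proof (rule sigma_max_le[OF centered_biadjacency_carrier _ t])
  fix v :: "nat \<Rightarrow> real"
  have "(\<Sum>i<n. (\<Sum>j<m. centered_biadjacency n m p {e. f e} $$ (i, j) * v j)\<^sup>2) =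
      (\<Sum>i<n. (\<Sum>j<m. centered_entry {..<n} {..<m} p f i j * v j)\<^sup>2)"
    by (intro sum.cong refl arg_cong[where f = "\<lambda>x. x\<^sup>2"]) (simp add: centered_biadjacency_entry p)
  then show "(\<Sum>i<n. (\<Sum>j<m. centered_biadjacency n m p {e. f e} $$ (i, j) * v j)\<^sup>2) \<le> t\<^sup>2 * (\<Sum>j<m. (v j)\<^sup>2)"
    using f by (simp add: norm_le_event_def)
qed (use m in simp)

text \<open>The Frobenius norm as a deterministic bound, for small \<open>N\<close> and for the
  exceptional event in the expectation.\<close>

lemma norm_le_event_trivial:
  assumes fin: "finite I" "finite J"
    and p: "\<And>i j. i \<in> I \<Longrightarrow> j \<in> J \<Longrightarrow> 0 \<le> p i j \<and> p i j \<le> 1"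
  shows "f \<in> norm_le_event I J p (sqrt (real (card I) * real (card J)))"
  unfolding norm_le_event_def mem_Collect_eq
proof
  fix v :: "_ \<Rightarrow> real"
  have "(\<Sum>i\<in>I. (\<Sum>j\<in>J. centered_entry I J p f i j * v j)\<^sup>2) \<le> (\<Sum>i\<in>I. real (card J) * (\<Sum>j\<in>J. (v j)\<^sup>2))"
  proof (rule sum_mono)
    fix i assume i: "i \<in> I"
    have "(\<Sum>j\<in>J. centered_entry I J p f i j * v j)\<^sup>2 \<le>
        (\<Sum>j\<in>J. (centered_entry I J p f i j)\<^sup>2) * (\<Sum>j\<in>J. (v j)\<^sup>2)"
      by (rule Cauchy_Schwarz_ineq_sum)
    also have "(\<Sum>j\<in>J. (centered_entry I J p f i j)\<^sup>2) \<le> (\<Sum>j\<in>J. 1)"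
    proof (rule sum_mono)
      fix j assume j: "j \<in> J"
      have "\<bar>centered_entry I J p f i j\<bar> \<le> 1" using p[OF i j] by (auto simp: centered_entry_def)
      then show "(centered_entry I J p f i j)\<^sup>2 \<le> 1" by (simp add: abs_square_le_1)
    qed
    finally show "(\<Sum>j\<in>J. centered_entry I J p f i j * v j)\<^sup>2 \<le> real (card J) * (\<Sum>j\<in>J. (v j)\<^sup>2)"
      by (simp add: mult_right_mono sum_nonneg)
  qed
  also have "\<dots> = (sqrt (real (card I) * real (card J)))\<^sup>2 * (\<Sum>j\<in>J. (v j)\<^sup>2)" by simp
  finally show "(\<Sum>i\<in>I. (\<Sum>j\<in>J. centered_entry I J p f i j * v j)\<^sup>2) \<le>
      (sqrt (real (card I) * real (card J)))\<^sup>2 * (\<Sum>j\<in>J. (v j)\<^sup>2)" .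
qed

lemma sigma_max_centered_le_max:
  assumes p: "\<And>i j. i < n \<Longrightarrow> j < m \<Longrightarrow> 0 \<le> p i j \<and> p i j \<le> 1" and m: "1 \<le> m"
  shows "sigma_max (centered_biadjacency n m p {e. f e}) \<le> real (max n m)"
proof -
  have "sigma_max (centered_biadjacency n m p {e. f e}) \<le> sqrt (real n * real m)"
    using norm_le_event_trivial[of "{..<n}" "{..<m}" p f] p by (intro sigma_max_centered_le[OF p m]) auto
  also have "\<dots> \<le> sqrt (real (max n m) * real (max n m))"
    by (intro real_sqrt_le_mono mult_mono) auto
  finally show ?thesis by simp
qed

lemma expectation_le_of_prob:
  fixes X :: "'a \<Rightarrow> real"
  assumes fin: "finite (set_pmf D)" and t: "0 \<le> t" and M: "\<And>x. X x \<le> M" "0 \<le> M"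
    and pr: "1 - \<epsilon> \<le> measure_pmf.prob D {x. X x \<le> t}"
  shows "measure_pmf.expectation D X \<le> t + M * \<epsilon>"
proof -
  have int: "integrable (measure_pmf D) h" for h :: "'a \<Rightarrow> real"
    using fin by (rule integrable_measure_pmf_finite)
  let ?G = "{x. X x \<le> t}"
  have "measure_pmf.expectation D X \<le> measure_pmf.expectation D (\<lambda>x. t + M * indicator (- ?G) x)"
  proof (rule integral_mono[OF int int])
    fix x
    show "X x \<le> t + M * indicator (- ?G) x"
      using M(1)[of x] t by (auto simp: indicator_def)
  qed
  also have "\<dots> = t + M * measure_pmf.prob D (- ?G)"
    by (simp add: int)
  also have "measure_pmf.prob D (- ?G) = 1 - measure_pmf.prob D ?G"
    using measure_pmf.prob_compl[of ?G D] by (simp add: Compl_eq_Diff_UNIV)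
  also have "t + M * (1 - measure_pmf.prob D ?G) \<le> t + M * \<epsilon>"
    using pr M(2) by (intro add_left_mono mult_left_mono) auto
  finally show ?thesis .
qed

text \<open>For \<open>N \<ge> 2\<close> the error term, before division by \<open>sqrt d\<close>,
  is bounded below by an absolute constant and can absorb additive constants. If the logarithm
  exceeds 1, it is at most \<open>L / d\<close>, so the ratio is at least \<open>d\<close>.\<close>

lemma log_ratio_lower:
  fixes d L :: real
  assumes d: "1 \<le> d" and L: "ln 2 \<le> L"
  shows "ln 2 \<le> L / max 1 (ln (sqrt (L / d)))"
proof -
  have "0 < ln (2::real)" by simp
  with L have L0: "0 < L" by linarith
  define e where "e = sqrt (L / d)"
  have e: "0 < e" "e\<^sup>2 * d = L" using L0 d by (auto simp: e_def)
  show ?thesis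
  proof (cases "ln e \<le> 1")
    case True
    then show ?thesis using L by (simp add: e_def[symmetric] max_def)
  next
    case False
    have "ln e \<le> e - 1" using e by (intro ln_le_minus_one)
    then have e1: "1 \<le> e" "ln e \<le> e" using False by auto
    then have "e * 1 \<le> e * e" by (intro mult_left_mono) auto
    then have "e \<le> e\<^sup>2" by (simp only: power2_eq_square mult_1_right)
    then have "ln e \<le> e\<^sup>2" using e1 by linarith
    then have "ln e * d \<le> L" using e(2) d mult_right_mono[of "ln e" "e\<^sup>2" d] by simp
    then have "d \<le> L / ln e" using False by (simp add: field_simps)
    moreover have "ln 2 \<le> (1::real)" using ln_le_minus_one[of "2::real"] by simp
    ultimately have "ln 2 \<le> L / ln e" using d by linarith
    then show ?thesis using False by (simp add: e_def[symmetric] max_def)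
  qed
qed

text \<open>The larger of the two maximal sums is \<open>d\<close>, the smaller is
  \<open>gamma_ratio n m p * d\<close>; so \<open>sqrt a + sqrt b\<close> is exactly the leading
  term after multiplication by \<open>sqrt d\<close>.\<close>

lemma degree_parameters:
  assumes nm: "1 \<le> n" "1 \<le> m" and p: "\<And>i j. i < n \<Longrightarrow> j < m \<Longrightarrow> 0 \<le> p i j \<and> p i j \<le> 1"
    and g: "0 < g" "g \<le> gamma_ratio n m p"
    and d: "gamma_ratio n m p powr (- 1 / 2) \<le> max_expected_degree n m p"
  defines "d \<equiv> max_expected_degree n m p"
  shows "1 \<le> d" "g * d \<le> max_row_sum n m p" "max_row_sum n m p \<le> d"
    "g * d \<le> max_col_sum n m p" "max_col_sum n m p \<le> d"
    "sqrt (max_row_sum n m p) + sqrt (max_col_sum n m p) = sqrt d * (1 + sqrt (gamma_ratio n m p))"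
    "\<And>i. i < n \<Longrightarrow> (\<Sum>j<m. p i j) \<le> max_row_sum n m p"
    "\<And>j. j < m \<Longrightarrow> (\<Sum>i<n. p i j) \<le> max_col_sum n m p"
proof -
  let ?a = "max_row_sum n m p" and ?b = "max_col_sum n m p" and ?g = "gamma_ratio n m p"
  show row: "(\<Sum>j<m. p i j) \<le> ?a" if "i < n" for i
    unfolding max_row_sum_def using that by (intro Max_ge) auto
  show col: "(\<Sum>i<n. p i j) \<le> ?b" if "j < m" for j
    unfolding max_col_sum_def using that by (intro Max_ge) auto
  have dmax: "d = max ?a ?b" by (simp add: d_def max_expected_degree_def)
  show ad: "?a \<le> d" and bd: "?b \<le> d" by (auto simp: dmax)
  have "0 \<le> (\<Sum>j<m. p 0 j)" using p nm by (intro sum_nonneg) auto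
  then have "0 \<le> ?a" using row[of 0] nm by simp
  moreover have "0 \<le> (\<Sum>i<n. p i 0)" using p nm by (intro sum_nonneg) auto
  then have "0 \<le> ?b" using col[of 0] nm by simp
  ultimately have ab: "0 \<le> ?a" "0 \<le> ?b" by auto
  have gr: "?g = min (?a / d) (?b / d)"
    by (simp add: gamma_ratio_def rho_max_def rho_tilde_max_def d_def)
  \<comment> \<open>For \<open>d = 0\<close> the quotients would be 0 by the convention on division,
    against \<open>0 < g\<close>.\<close>
  have "d \<noteq> 0"
  proof
    assume "d = 0"
    then show False using gr g by simp
  qed
  then have d0: "0 < d" using ad ab by linarith
  have "g \<le> ?a / d" "g \<le> ?b / d" using g gr by auto
  then show "g * d \<le> ?a" "g * d \<le> ?b" using d0 by (auto simp: field_simps)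
  have g1: "?g \<le> 1" "0 < ?g" using gr ad bd d0 g by (auto simp: min_def)
  have "?g powr 0 \<le> ?g powr (- 1 / 2)" using g1 by (intro powr_mono') auto
  then show "1 \<le> d" using d g1 by (simp add: d_def)
  show "sqrt ?a + sqrt ?b = sqrt d * (1 + sqrt ?g)"
  proof (cases "?a \<le> ?b")
    case True
    then have "d = ?b" "?g = ?a / d" using d0 by (auto simp: dmax gr min_def divide_right_mono)
    then have "sqrt d * sqrt ?g = sqrt ?a" using d0 by (simp flip: real_sqrt_mult)
    then show ?thesis using \<open>d = ?b\<close> by (simp add: distrib_left)
  next
    case False
    then have "d = ?a" "?g = ?b / d" using d0 by (auto simp: dmax gr min_def divide_right_mono divide_le_cancel)
    then have "sqrt d * sqrt ?g = sqrt ?b" using d0 by (simp flip: real_sqrt_mult)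
    then show ?thesis using \<open>d = ?a\<close> by (simp add: distrib_left)
  qed
qed

theorem theorem2p2:
  fixes \<gamma>\<^sub>0 :: real
  assumes "0 < \<gamma>\<^sub>0" and "\<gamma>\<^sub>0 \<le> 1"
  shows "\<exists>K>0. \<forall>(n::nat) (m::nat) (p :: nat \<Rightarrow> nat \<Rightarrow> real).
    let d = max_expected_degree n m p; N = max n m in
      n \<ge> 1 \<longrightarrow> m \<ge> 1 \<longrightarrow>
      (\<forall>i<n. \<forall>j<m. 0 \<le> p i j \<and> p i j \<le> 1) \<longrightarrow>
      gamma_ratio n m p \<ge> \<gamma>\<^sub>0 \<longrightarrow>
      d \<ge> gamma_ratio n m p powr (- 1 / 2) \<longrightarrow>
      d powr (7 / 2) * (MAX (i, j)\<in>{..<n} \<times> {..<m}. p i j) \<le> real N powr (- 1 / 10) \<longrightarrow>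
      1 / sqrt d *
          measure_pmf.expectation (bipartite_ER n m p)
            (\<lambda>E. sigma_max (centered_biadjacency n m p E))
        \<le> sigma_bound K n m p \<and>
      measure_pmf.prob (bipartite_ER n m p)
          {E. 1 / sqrt d * sigma_max (centered_biadjacency n m p E) \<le> sigma_bound K n m p}
        \<ge> 1 - K * real N powr (- 3)"
proof -
  obtain N0 :: real where N0: "\<And>N. N0 \<le> N \<Longrightarrow> 1 \<le> ln N \<and> 64 / \<gamma>\<^sub>0 \<le> ln N \<and> N powr (- 1 / 10) \<le> 1 \<and>
    18432 * (1 / sqrt \<gamma>\<^sub>0) * (10 ^ 5 * sqrt (ln N) ^ 5) * exp (160 * sqrt (ln N / \<gamma>\<^sub>0)) * N powr (- 1 / 10) \<le> \<gamma>\<^sub>0 \<and>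
    18432 * (10 * ln N) ^ 5 * exp (ln N / 20) * N powr (- 1 / 10) \<le> 1"
    using eventually_large[OF assms(1)] unfolding eventually_at_top_linorder by blast
  \<comment> \<open>The summand with \<open>N0\<close> covers small \<open>N\<close>, through the bound \<open>N\<close> on the singular value.\<close>
  define Cp where "Cp = (2 + 8 * exp 2 / sqrt \<gamma>\<^sub>0) + 10"
  define Cn where "Cn = (6 / sqrt \<gamma>\<^sub>0 + 2) + (2 * sqrt 3000000 + 2)"
  define K where "K = Cn + (Cp + \<bar>N0\<bar>) / sqrt (ln 2)"
  have C0: "0 < Cp" "0 < Cn" using assms by (auto simp: Cp_def Cn_def intro!: add_pos_nonneg)
  have ln2: "0 < sqrt (ln 2 :: real)" "sqrt (ln 2 :: real) \<le> 1" using ln_le_minus_one[of "2::real"] by auto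
  have K0: "0 < K" using C0 ln2 by (auto simp: K_def intro!: add_pos_nonneg)
  have KCp: "Cp \<le> K"
  proof -
    have "Cp / 1 \<le> (Cp + \<bar>N0\<bar>) / sqrt (ln 2)" using C0 ln2 by (intro frac_le) auto
    then show ?thesis using C0 by (simp add: K_def)
  qed
  show ?thesis
  proof (intro exI[of _ K] conjI K0 allI, unfold Let_def, intro impI)
    fix n m :: nat and p :: "nat \<Rightarrow> nat \<Rightarrow> real"
    assume nm: "1 \<le> n" "1 \<le> m" and p': "\<forall>i<n. \<forall>j<m. 0 \<le> p i j \<and> p i j \<le> 1"
      and gam: "\<gamma>\<^sub>0 \<le> gamma_ratio n m p"
      and dg: "gamma_ratio n m p powr (- 1 / 2) \<le> max_expected_degree n m p"
      and sp: "max_expected_degree n m p powr (7 / 2) * (MAX (i, j)\<in>{..<n} \<times> {..<m}. p i j)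
        \<le> real (max n m) powr (- 1 / 10)"
    define d where "d = max_expected_degree n m p"
    define N where "N = real (max n m)"
    define q where "q = (MAX (i, j)\<in>{..<n} \<times> {..<m}. p i j)"
    define a where "a = max_row_sum n m p"
    define b where "b = max_col_sum n m p"
    have p: "0 \<le> p i j \<and> p i j \<le> 1" if "i < n" "j < m" for i j using p' that by blast
    have pq: "p i j \<le> q" if "i < n" "j < m" for i j
    proof -
      have "(case (i, j) of (i, j) \<Rightarrow> p i j) \<in> (\<lambda>(i, j). p i j) ` ({..<n} \<times> {..<m})"
        using that by (intro imageI) auto
      then show ?thesis unfolding q_def by (intro Max_ge) auto
    qed
    have q0: "0 \<le> q" using pq[of 0 0] p[of 0 0] nm by simp
    note par = degree_parameters[OF nm p assms(1) gam dg, folded d_def a_def b_def]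
    have d1: "1 \<le> d" by (rule par(1))
    have sp': "d powr (7 / 2) * q \<le> N powr (- 1 / 10)" using sp by (simp add: d_def q_def N_def)
    have N1: "1 \<le> N" using nm by (simp add: N_def)
    define \<tau> where "\<tau> = sqrt (ln N / max 1 (ln (sqrt (ln N / d))))"
    have \<tau>0: "0 \<le> \<tau>" using N1 by (simp add: \<tau>_def)
    define B where "B k = sqrt a + sqrt b + k * \<tau>" for k
    have ab0: "0 \<le> a" "0 \<le> b"
    proof -
      have "0 \<le> \<gamma>\<^sub>0 * d" using assms d1 by simp
      then show "0 \<le> a" "0 \<le> b" using par(2,4) by linarith+
    qed
    have Bmono: "B k \<le> B k'" if "k \<le> k'" for k k' using that \<tau>0 by (simp add: B_def mult_right_mono)
    have B0: "0 \<le> B k" if "0 \<le> k" for k using that \<tau>0 ab0 by (simp add: B_def)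
    have bound: "sigma_bound K n m p = B K / sqrt d"
    proof -
      have "eta n m p / sqrt (max 1 (ln (eta n m p))) = \<tau> / sqrt d"
        by (simp add: eta_def \<tau>_def N_def d_def real_sqrt_divide)
      moreover have "sqrt a + sqrt b = sqrt d * (1 + sqrt (gamma_ratio n m p))" by (rule par(6))
      then have "1 + sqrt (gamma_ratio n m p) = (sqrt a + sqrt b) / sqrt d" using d1 by simp
      ultimately show ?thesis by (simp add: sigma_bound_def B_def add_divide_distrib)
    qed
    let ?S = "\<lambda>E. sigma_max (centered_biadjacency n m p E)"
    let ?M = "edge_pmf {..<n} {..<m} p"
    have ev: "{E. 1 / sqrt d * ?S E \<le> sigma_bound K n m p} = {E. ?S E \<le> B K}"
      using d1 by (auto simp: bound field_simps)
    have pr_eq: "measure_pmf.prob (bipartite_ER n m p) {E. ?S E \<le> B K} = measure_pmf.prob ?M {f. ?S {e. f e} \<le> B K}"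
      unfolding bipartite_ER_eq measure_map_pmf by (simp add: vimage_def)
    have ex_eq: "measure_pmf.expectation (bipartite_ER n m p) ?S = measure_pmf.expectation ?M (\<lambda>f. ?S {e. f e})"
      unfolding bipartite_ER_eq by simp
    have S_N: "?S {e. f e} \<le> N" for f
      unfolding N_def by (rule sigma_max_centered_le_max[OF _ nm(2)]) (rule p)
    have finM: "finite (set_pmf ?M)" by (intro finite_edge_pmf) auto
    have "measure_pmf.expectation ?M (\<lambda>f. ?S {e. f e}) \<le> B K \<and>
        1 - K * N powr (- 3) \<le> measure_pmf.prob ?M {f. ?S {e. f e} \<le> B K}"
    proof (cases "N0 \<le> N \<and> 2 \<le> N")
      case True
      then have large: "1 \<le> ln N" "64 / \<gamma>\<^sub>0 \<le> ln N" "N powr (- 1 / 10) \<le> 1"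
        "18432 * (1 / sqrt \<gamma>\<^sub>0) * (10 ^ 5 * sqrt (ln N) ^ 5) * exp (160 * sqrt (ln N / \<gamma>\<^sub>0)) * N powr (- 1 / 10) \<le> \<gamma>\<^sub>0"
        "18432 * (10 * ln N) ^ 5 * exp (ln N / 20) * N powr (- 1 / 10) \<le> 1"
        using N0[of N] by auto
      have N0': "0 < N" using N1 by simp
      have cardN: "real (card {..<n}) \<le> N" "real (card {..<m}) \<le> N" by (auto simp: N_def)
      have ppq: "0 \<le> p i j \<and> p i j \<le> 1 \<and> p i j \<le> q" if "i \<in> {..<n}" "j \<in> {..<m}" for i j
        using p pq that by auto
      have row: "(\<Sum>j\<in>{..<m}. p i j) \<le> a" if "i \<in> {..<n}" for i using par(7) that by simp
      have col: "(\<Sum>i\<in>{..<n}. p i j) \<le> b" if "j \<in> {..<m}" for j using par(8) that by simp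
      have pr: "1 - Cp * N powr (- 3) \<le> measure_pmf.prob ?M (norm_le_event {..<n} {..<m} p (B Cn))"
      proof (cases "ln N \<le> d")
        case True
        have "sqrt (ln N / d) \<le> 1" using True d1 by simp
        moreover have "0 < sqrt (ln N / d)" using large d1 by simp
        ultimately have "ln (sqrt (ln N / d)) \<le> 0" by (subst ln_le_zero_iff)
        then have "max 1 (ln (sqrt (ln N / d))) = 1" by linarith
        then have \<tau>: "\<tau> = sqrt (ln N)" by (simp add: \<tau>_def)
        have "1 - Cp * N powr (- 3) \<le> 1 - (2 + 8 * exp 2 / sqrt \<gamma>\<^sub>0) * N powr (- 3)"
          by (simp add: Cp_def mult_right_mono)
        also have "\<dots> \<le> measure_pmf.prob ?M
            (norm_le_event {..<n} {..<m} p (sqrt a + sqrt b + (6 / sqrt \<gamma>\<^sub>0 + 2) * sqrt (ln N)))"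
          by (rule norm_bound_dense[OF _ _ cardN N0' ppq row col q0 sp' large(3) assms par(2,3,4,5) d1 large(1,2) True large(4)])
             auto
        also have "\<dots> \<le> measure_pmf.prob ?M (norm_le_event {..<n} {..<m} p (B Cn))"
        proof (intro measure_pmf.finite_measure_mono norm_le_event_mono)
          have "B (6 / sqrt \<gamma>\<^sub>0 + 2) \<le> B Cn" by (rule Bmono) (simp add: Cn_def)
          then show "sqrt a + sqrt b + (6 / sqrt \<gamma>\<^sub>0 + 2) * sqrt (ln N) \<le> B Cn"
            unfolding B_def[of "6 / sqrt \<gamma>\<^sub>0 + 2"] \<tau> .
          show "0 \<le> sqrt a + sqrt b + (6 / sqrt \<gamma>\<^sub>0 + 2) * sqrt (ln N)"
            using ab0 large assms by simp
        qed auto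
        finally show ?thesis .
      next
        case False
        have rowd: "(\<Sum>j\<in>{..<m}. p i j) \<le> d" if "i \<in> {..<n}" for i using row[OF that] par(3) by linarith
        have cold: "(\<Sum>i\<in>{..<n}. p i j) \<le> d" if "j \<in> {..<m}" for j using col[OF that] par(5) by linarith
        have dL: "d \<le> ln N" using False by simp
        have "1 - Cp * N powr (- 3) \<le> 1 - 10 * N powr (- 3)"
          using assms by (simp add: Cp_def mult_right_mono)
        also have "\<dots> \<le> measure_pmf.prob ?M (norm_le_event {..<n} {..<m} p ((2 * sqrt 3000000 + 2) * \<tau>))"
          unfolding \<tau>_def
          by (rule norm_bound_sparse[OF _ _ cardN N0' ppq rowd cold q0 sp' large(3) d1 large(1) dL large(5)]) auto
        also have "\<dots> \<le> measure_pmf.prob ?M (norm_le_event {..<n} {..<m} p (B Cn))"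
        proof (intro measure_pmf.finite_measure_mono norm_le_event_mono)
          have "(2 * sqrt 3000000 + 2) * \<tau> \<le> B (2 * sqrt 3000000 + 2)" using ab0 by (simp add: B_def)
          also have "\<dots> \<le> B Cn" using assms by (intro Bmono) (simp add: Cn_def)
          finally show "(2 * sqrt 3000000 + 2) * \<tau> \<le> B Cn" .
          show "0 \<le> (2 * sqrt 3000000 + 2) * \<tau>" using \<tau>0 by simp
        qed auto
        finally show ?thesis .
      qed
      have BCn: "0 \<le> B Cn" using C0 by (intro B0) simp
      have "norm_le_event {..<n} {..<m} p (B Cn) \<subseteq> {f. ?S {e. f e} \<le> B Cn}"
      proof
        fix f assume "f \<in> norm_le_event {..<n} {..<m} p (B Cn)"
        then have "?S {e. f e} \<le> B Cn" by (rule sigma_max_centered_le[OF _ nm(2) BCn, rotated]) (rule p)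
        then show "f \<in> {f. ?S {e. f e} \<le> B Cn}" by simp
      qed
      then have pr2: "1 - Cp * N powr (- 3) \<le> measure_pmf.prob ?M {f. ?S {e. f e} \<le> B Cn}"
        using pr measure_pmf.finite_measure_mono[of "norm_le_event {..<n} {..<m} p (B Cn)" "{f. ?S {e. f e} \<le> B Cn}" ?M]
        by simp
      \<comment> \<open>The exceptional event adds at most
        \<open>N * Cp * N powr (- 3) \<le> Cp\<close> to the expectation; this lower bound turns the
        constant into a multiple of \<open>\<tau>\<close>.\<close>
      have \<tau>2: "sqrt (ln 2) \<le> \<tau>"
        unfolding \<tau>_def using log_ratio_lower[OF d1, of "ln N"] True by simp
      have "measure_pmf.expectation ?M (\<lambda>f. ?S {e. f e}) \<le> B Cn + N * (Cp * N powr (- 3))"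
        using S_N N1 by (intro expectation_le_of_prob[OF finM BCn _ _ pr2]) auto
      also have "N * (Cp * N powr (- 3)) = Cp * N powr (- 2)"
      proof -
        have "N powr 1 * N powr (- 3) = N powr (- 2)" by (simp only: powr_add[symmetric]) simp
        then show ?thesis using N1 by simp
      qed
      also have "Cp * N powr (- 2) \<le> Cp * 1"
      proof -
        have "N powr (- 2) \<le> N powr 0" using N1 by (intro powr_mono) auto
        then show ?thesis using C0 N1 by (intro mult_left_mono) auto
      qed
      also have "Cp * 1 \<le> Cp / sqrt (ln 2) * \<tau>" using \<tau>2 ln2 C0 by (simp add: field_simps)
      also have "\<dots> \<le> (Cp + \<bar>N0\<bar>) / sqrt (ln 2) * \<tau>"
        using \<tau>0 ln2 by (intro mult_right_mono divide_right_mono) auto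
      also have "B Cn + (Cp + \<bar>N0\<bar>) / sqrt (ln 2) * \<tau> = B K" by (simp add: B_def K_def distrib_right)
      finally have ex: "measure_pmf.expectation ?M (\<lambda>f. ?S {e. f e}) \<le> B K" by simp
      have "B Cn \<le> B K" using C0 ln2 by (intro Bmono) (simp add: K_def)
      then have "measure_pmf.prob ?M {f. ?S {e. f e} \<le> B Cn} \<le> measure_pmf.prob ?M {f. ?S {e. f e} \<le> B K}"
        by (intro measure_pmf.finite_measure_mono) auto
      moreover have "Cp * N powr (- 3) \<le> K * N powr (- 3)" using KCp by (intro mult_right_mono) auto
      ultimately show ?thesis using ex pr2 by simp
    next
      case False
      have NB: "N \<le> B K"
      proof (cases "2 \<le> N")
        case True
        then have NN0: "N \<le> \<bar>N0\<bar>" using False by simp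
        have \<tau>2: "sqrt (ln 2) \<le> \<tau>"
          unfolding \<tau>_def using log_ratio_lower[OF d1, of "ln N"] True by simp
        have "N \<le> \<bar>N0\<bar> / sqrt (ln 2) * sqrt (ln 2)" using NN0 ln2 by simp
        also have "\<dots> \<le> K * \<tau>"
        proof (intro mult_mono \<tau>2)
          have "\<bar>N0\<bar> / sqrt (ln 2) \<le> (Cp + \<bar>N0\<bar>) / sqrt (ln 2)"
            using C0 ln2 by (intro divide_right_mono) auto
          then show "\<bar>N0\<bar> / sqrt (ln 2) \<le> K" using C0 by (simp add: K_def)
        qed (use K0 in auto)
        also have "\<dots> \<le> B K" using ab0 by (simp add: B_def)
        finally show ?thesis .
      next
        case False
        \<comment> \<open>For \<open>N = 1\<close> the logarithm and with it \<open>\<tau>\<close>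
          vanish, so the leading term has to suffice; it is at least 1 because
          \<open>d \<ge> 1\<close>.\<close>
        then have "N = 1" using N1 by (simp add: N_def)
        moreover have "1 * 1 \<le> sqrt d * (1 + sqrt (gamma_ratio n m p))"
          using d1 gam assms by (intro mult_mono) auto
        moreover have "sqrt a + sqrt b = sqrt d * (1 + sqrt (gamma_ratio n m p))" by (rule par(6))
        ultimately have "N \<le> sqrt a + sqrt b" by linarith
        then show ?thesis using K0 \<tau>0 by (simp add: B_def add_increasing2)
      qed
      then have all: "?S {e. f e} \<le> B K" for f using S_N[of f] by linarith
      have "measure_pmf.expectation ?M (\<lambda>f. ?S {e. f e}) \<le> measure_pmf.expectation ?M (\<lambda>f. B K)"
        using all by (intro integral_mono integrable_measure_pmf_finite[OF finM]) auto
      then have "measure_pmf.expectation ?M (\<lambda>f. ?S {e. f e}) \<le> B K" by simp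
      moreover have "{f :: nat \<times> nat \<Rightarrow> bool. ?S {e. f e} \<le> B K} = UNIV" using all by auto
      ultimately show ?thesis using K0 by simp
    qed
    then have "measure_pmf.expectation (bipartite_ER n m p) ?S \<le> B K"
      and "1 - K * N powr (- 3) \<le> measure_pmf.prob (bipartite_ER n m p) {E. 1 / sqrt d * ?S E \<le> sigma_bound K n m p}"
      unfolding ev pr_eq ex_eq by auto
    moreover from this(1) have "1 / sqrt d * measure_pmf.expectation (bipartite_ER n m p) ?S \<le> sigma_bound K n m p"
      unfolding bound using d1 by (simp add: divide_right_mono)
    ultimately show "1 / sqrt (max_expected_degree n m p) * measure_pmf.expectation (bipartite_ER n m p) ?S \<le> sigma_bound K n m p \<and>
      1 - K * real (max n m) powr (- 3) \<le> measure_pmf.prob (bipartite_ER n m p)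
        {E. 1 / sqrt (max_expected_degree n m p) * ?S E \<le> sigma_bound K n m p}"
      unfolding d_def[symmetric] N_def[symmetric] by blast
  qed
qed

end
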